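(* Let $c>1$ be an odd integer and let $a$ be an integer. Then as $n\to\infty$, \[ v(a,c;n)\sim \frac{1}{16\,c\,n^{3/4}}e^{\pi\sqrt{n}}\sim \frac{n^{1/4}}{2c}\,\overline{p}(n). \]
   Context: For $q=e^{2\pi i\tau}$ with $\tau$ in the upper half-plane and $w=e^{2\pi i z}$, write $(A;q)_n=\prod_{k=0}^{n-1}(1-Aq^k)$ and $(A,B;q)_n=(A;q)_n(B;q)_n$. The integers $v(m,n)$ ($m\in\mathbb{Z}$, $n\ge 0$) are defined by \[ V(w;q):=\sum_{n\ge0}\frac{(-wq,-w^{-1}q;q)_n\,q^n}{(q;q^2)_{n+1}}=\sum_{n\ge 0,\ m\in\mathbb{Z}} v(m,n)w^mq^n . \] Combinatorially, $v(m,n)$ counts odd-balanced unimodal sequences of size $2n+2$ and rank $m$: unimodal sequences (weakly increasing then weakly decreasing positive integers) whose peak is even, where odd parts may repeat but must occur identically on both sides of the peak, the remaining parts satisfy strict inequalities, and the rank is the number of parts after the peak minus the number of parts before the peak. For integers $a$ and $c\ge1$, $v(a,c;n):=\sum_{m\equiv a \pmod c} v(m,n)$. The overpartition function $\overline{p}(n)$ is defined by $\sum_{n\ge0}\overline{p}(n)q^n=\prod_{k\ge1}\frac{1+q^k}{1-q^k}$. *)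

theory Defs
  imports
    "HOL-Analysis.Analysis"
    "HOL-Computational_Algebra.Computational_Algebra"
    "HOL-Number_Theory.Number_Theory"
begin

definition qpoch :: "'a::comm_ring_1 \<Rightarrow> 'a \<Rightarrow> nat \<Rightarrow> 'a" where
  "qpoch A q n = (\<Prod>k<n. 1 - A * q ^ k)"

text \<open>
  The coefficient rings used below (the integers and Laurent series over the integers) are not
  division rings, so the library's \<^const>\<open>inverse\<close> on power series is not available.
  The following is the inverse of a power series with constant coefficient 1.
\<close>

definition fps_recip :: "'a::comm_ring_1 fps \<Rightarrow> 'a fps" where
  "fps_recip F = fps_right_inverse F 1"

lemma fps_recip_works:
  assumes "fps_nth F 0 = 1"
  shows "F * fps_recip F = 1"
  unfolding fps_recip_def by (rule fps_right_inverse) (use assms in simp)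

text \<open>
  \<open>V(w;q)\<close> as a power series in \<open>q\<close> (\<^const>\<open>fps_X\<close>) whose coefficients are Laurent series in
  \<open>w\<close> (\<^const>\<open>fls_X\<close>, with inverse \<^const>\<open>fls_X_inv\<close>). The infinite sum is taken in the
  \<open>q\<close>-adic topology; the coefficients are in fact Laurent polynomials, see
  \<open>oddbal_eq_0\<close> below.
\<close>

definition V_term :: "nat \<Rightarrow> int fls fps" where
  "V_term n =
     qpoch (- (fps_const fls_X * fps_X)) fps_X n *
     qpoch (- (fps_const fls_X_inv * fps_X)) fps_X n *
     fps_X ^ n * fps_recip (qpoch fps_X (fps_X ^ 2) (n + 1))"

definition V_series :: "int fls fps" where
  "V_series = (\<Sum>n. V_term n)"

definition oddbal :: "int \<Rightarrow> nat \<Rightarrow> int" where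
  "oddbal m n = fls_nth (fps_nth V_series n) m"

text \<open>
  The sum over all \<open>m\<close> congruent to \<open>a\<close> is restricted to the nonzero terms, because
  \<^const>\<open>sum\<close> is 0 on infinite index sets; only finitely many terms are nonzero, see
  \<open>finite_oddbal_support\<close> below.
\<close>

definition oddbal_mod :: "int \<Rightarrow> int \<Rightarrow> nat \<Rightarrow> int" where
  "oddbal_mod a c n = (\<Sum>m | [m = a] (mod c) \<and> oddbal m n \<noteq> 0. oddbal m n)"

definition overpartition_series :: "int fps" where
  "overpartition_series = (\<Prod>k. (1 + fps_X ^ Suc k) * fps_recip (1 - fps_X ^ Suc k))"

definition overpartition :: "nat \<Rightarrow> int" where
  "overpartition n = fps_nth overpartition_series n"


subsection \<open>Well-definedness of the series\<close>

lemma qpoch_nth_0 [simp]: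
  fixes A :: "'a::comm_ring_1 fps"
  assumes "fps_nth A 0 = 0"
  shows "fps_nth (qpoch A q n) 0 = 1"
  unfolding qpoch_def using assms by (induction n) auto

lemma V_denominator: "qpoch fps_X (fps_X ^ 2) n * fps_recip (qpoch fps_X (fps_X ^ 2) n) = (1 :: int fls fps)"
  by (intro fps_recip_works qpoch_nth_0) simp

lemma V_term_nth_eq_0: "N < n \<Longrightarrow> fps_nth (V_term n) N = 0"
  unfolding V_term_def by (simp add: mult.assoc mult.left_commute[of _ "fps_X ^ n"] fps_X_power_mult_nth)

lemma V_sums: "V_term sums V_series"
proof -
  define S where "S = Abs_fps (\<lambda>N. \<Sum>n\<le>N. fps_nth (V_term n) N)"
  have "V_term sums S"
    unfolding sums_def
  proof (rule tendsto_fpsI)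
    fix N
    show "\<forall>\<^sub>F k in sequentially. fps_nth (\<Sum>n<k. V_term n) N = fps_nth S N"
      using eventually_gt_at_top[of N]
    proof eventually_elim
      case (elim k)
      have "(\<Sum>n<k. fps_nth (V_term n) N) = (\<Sum>n\<le>N. fps_nth (V_term n) N)"
        by (rule sum.mono_neutral_right) (use elim V_term_nth_eq_0 in auto)
      then show ?case by (simp add: S_def fps_sum_nth)
    qed
  qed
  then show ?thesis unfolding V_series_def by (simp add: sums_iff)
qed

lemma V_series_nth: "fps_nth V_series N = (\<Sum>n\<le>N. fps_nth (V_term n) N)"
proof -
  from V_sums have "\<forall>\<^sub>F k in sequentially. fps_nth (\<Sum>n<k. V_term n) N = fps_nth V_series N"
    unfolding sums_def tendsto_fps_iff by blast
  then obtain K where K: "\<And>k. k \<ge> K \<Longrightarrow> fps_nth (\<Sum>n<k. V_term n) N = fps_nth V_series N"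
    by (auto simp: eventually_sequentially)
  define k where "k = max K (Suc N)"
  have "fps_nth V_series N = (\<Sum>n<k. fps_nth (V_term n) N)"
    using K[of k] by (simp add: k_def fps_sum_nth)
  also have "\<dots> = (\<Sum>n\<le>N. fps_nth (V_term n) N)"
    by (rule sum.mono_neutral_right) (use V_term_nth_eq_0 in \<open>auto simp: k_def\<close>)
  finally show ?thesis .
qed

definition rank_bounded :: "int fls fps \<Rightarrow> bool" where
  "rank_bounded F \<longleftrightarrow> (\<forall>n m. fls_nth (fps_nth F n) m \<noteq> 0 \<longrightarrow> \<bar>m\<bar> \<le> int n)"

lemma fls_sum_nth': "fls_nth (sum f A) m = (\<Sum>x\<in>A. fls_nth (f x) m)"
  by (induction A rule: infinite_finite_induct) auto

lemma fls_mult_bounded: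
  fixes f g :: "int fls"
  assumes "\<And>m. fls_nth f m \<noteq> 0 \<Longrightarrow> \<bar>m\<bar> \<le> a" "\<And>m. fls_nth g m \<noteq> 0 \<Longrightarrow> \<bar>m\<bar> \<le> b"
  assumes "fls_nth (f * g) m \<noteq> 0"
  shows "\<bar>m\<bar> \<le> a + b"
proof -
  from assms(3) have "(\<Sum>i=fls_subdegree f..m - fls_subdegree g. fls_nth f i * fls_nth g (m - i)) \<noteq> 0"
    by (simp add: fls_times_nth(2))
  then obtain i where "fls_nth f i * fls_nth g (m - i) \<noteq> 0"
    by (meson sum.neutral)
  then have "\<bar>i\<bar> \<le> a" "\<bar>m - i\<bar> \<le> b" using assms(1,2) by auto
  then show ?thesis by linarith
qed

lemma rank_bounded_mult:
  assumes "rank_bounded F" "rank_bounded G"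
  shows "rank_bounded (F * G)"
  unfolding rank_bounded_def
proof (intro allI impI)
  fix n m assume "fls_nth (fps_nth (F * G) n) m \<noteq> 0"
  then have "(\<Sum>i=0..n. fls_nth (fps_nth F i * fps_nth G (n - i)) m) \<noteq> 0"
    by (simp add: fps_mult_nth fls_sum_nth')
  then obtain i where i: "i \<in> {0..n}" "fls_nth (fps_nth F i * fps_nth G (n - i)) m \<noteq> 0"
    by (meson sum.neutral)
  have "\<bar>m\<bar> \<le> int i + int (n - i)"
    by (rule fls_mult_bounded[OF _ _ i(2)]) (use assms in \<open>auto simp: rank_bounded_def\<close>)
  then show "\<bar>m\<bar> \<le> int n" using i by auto
qed

lemma rank_bounded_1: "rank_bounded 1"
  by (auto simp: rank_bounded_def split: if_splits)

lemma rank_bounded_X: "rank_bounded fps_X"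
  by (auto simp: rank_bounded_def fps_X_def split: if_splits)

lemma rank_bounded_wX: "rank_bounded (fps_const fls_X * fps_X)" "rank_bounded (fps_const fls_X_inv * fps_X)"
  by (auto simp: rank_bounded_def fps_X_def split: if_splits)

lemma rank_bounded_diff: "rank_bounded F \<Longrightarrow> rank_bounded G \<Longrightarrow> rank_bounded (F - G)"
  unfolding rank_bounded_def by (metis fls_minus_nth fps_sub_nth diff_0_right)

lemma rank_bounded_uminus: "rank_bounded F \<Longrightarrow> rank_bounded (- F)"
  by (simp add: rank_bounded_def)

lemma rank_bounded_power: "rank_bounded F \<Longrightarrow> rank_bounded (F ^ k)"
  by (induction k) (auto simp: rank_bounded_1 rank_bounded_mult)

lemma rank_bounded_qpoch: "rank_bounded A \<Longrightarrow> rank_bounded q \<Longrightarrow> rank_bounded (qpoch A q n)"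
  unfolding qpoch_def
  by (induction n)
     (auto intro!: rank_bounded_1 rank_bounded_mult rank_bounded_diff rank_bounded_power)

lemma rank_bounded_recip:
  assumes "rank_bounded F"
  shows "rank_bounded (fps_recip F)"
proof -
  have "\<forall>m. fls_nth (fps_nth (fps_recip F) n) m \<noteq> 0 \<longrightarrow> \<bar>m\<bar> \<le> int n" for n
  proof (induction n rule: less_induct)
    case (less n)
    show ?case
    proof (cases n)
      case 0
      then show ?thesis by (auto simp: fps_recip_def split: if_splits)
    next
      case (Suc k)
      show ?thesis
      proof (intro allI impI)
        fix m assume "fls_nth (fps_nth (fps_recip F) n) m \<noteq> 0"
        then have "(\<Sum>i=1..n. fls_nth (fps_nth F i * fps_nth (fps_recip F) (n - i)) m) \<noteq> 0"
          by (simp add: fps_recip_def Suc fls_sum_nth' del: fps_right_inverse_constructor.simps(1))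
        then obtain i where i: "i \<in> {1..n}" "fls_nth (fps_nth F i * fps_nth (fps_recip F) (n - i)) m \<noteq> 0"
          by (meson sum.neutral)
        have "\<bar>m\<bar> \<le> int i + int (n - i)"
          by (rule fls_mult_bounded[OF _ _ i(2)])
             (use assms less[of "n - i"] i(1) in \<open>auto simp: rank_bounded_def\<close>)
        then show "\<bar>m\<bar> \<le> int n" using i by auto
      qed
    qed
  qed
  then show ?thesis by (simp add: rank_bounded_def)
qed

lemma rank_bounded_V_term: "rank_bounded (V_term n)"
  unfolding V_term_def
  by (intro rank_bounded_mult rank_bounded_qpoch rank_bounded_uminus rank_bounded_wX rank_bounded_X
        rank_bounded_recip rank_bounded_power)

lemma oddbal_eq_0:
  assumes "\<bar>m\<bar> > int n"
  shows "oddbal m n = 0"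
proof -
  have "fls_nth (fps_nth (V_term k) n) m = 0" for k
    using rank_bounded_V_term[of k] assms by (fastforce simp: rank_bounded_def)
  then show ?thesis by (simp add: oddbal_def V_series_nth fls_sum_nth')
qed

lemma finite_oddbal_support: "finite {m. oddbal m n \<noteq> 0}"
  by (rule finite_subset[of _ "{- int n..int n}"]) (use oddbal_eq_0[of n] in \<open>force+\<close>)

lemma overpartition_has_prod:
  "(\<lambda>k. (1 + fps_X ^ Suc k) * fps_recip (1 - fps_X ^ Suc k)) has_prod overpartition_series"
proof -
  define f :: "nat \<Rightarrow> int fps" where "f = (\<lambda>k. (1 + fps_X ^ Suc k) * fps_recip (1 - fps_X ^ Suc k))"
  have f: "fps_nth (f k) N = (if N = 0 then 1 else 0)" if "N \<le> k" for k N
  proof -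
    have "f k - 1 = fps_X ^ Suc k * (fps_recip (1 - fps_X ^ Suc k) * 2)"
      using fps_recip_works[of "1 - fps_X ^ Suc k :: int fps"] unfolding f_def
      by (simp add: algebra_simps)
    then have "fps_nth (f k - 1) N = 0" using that by (simp only: fps_X_power_mult_nth) simp
    then show ?thesis by auto
  qed
  define P where "P = (\<lambda>n. \<Prod>i\<le>n. f i)"
  have step: "fps_nth (P (Suc n)) N = fps_nth (P n) N" if "N \<le> n" for n N
  proof -
    have "fps_nth (P (Suc n)) N = (\<Sum>i=0..N. fps_nth (P n) i * fps_nth (f (Suc n)) (N - i))"
      by (simp add: P_def fps_mult_nth)
    also have "\<dots> = (\<Sum>i=0..N. if i = N then fps_nth (P n) i else 0)"
      by (rule sum.cong) (use that in \<open>auto simp: f\<close>)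
    finally show ?thesis by simp
  qed
  have stab: "fps_nth (P n) N = fps_nth (P N) N" if "N \<le> n" for n N
    using that by (induction n rule: dec_induct) (auto simp: step)
  define S where "S = Abs_fps (\<lambda>N. fps_nth (P N) N)"
  have lim: "P \<longlonglongrightarrow> S"
    by (rule tendsto_fpsI)
       (auto simp: S_def eventually_sequentially intro!: exI stab)
  have "fps_nth S 0 = 1"
    by (simp add: S_def P_def f)
  then have "S \<noteq> 0" by auto
  with lim have "f has_prod S"
    by (simp add: has_prod_def raw_has_prod_def P_def)
  then show ?thesis
    unfolding overpartition_series_def f_def using has_prod_unique by blast
qed

end

theory Submission
  imports Defs "HOL-Probability.Probability" "HOL-Real_Asymp.Real_Asymp"
begin

text \<open>
  Write \<open>R\<^sub>N(w) = (-wq)\<^sub>N (-q/w)\<^sub>N / (q;q\<^sup>2)\<^sub>N\<^sub>+\<^sub>1\<close>, so that \<open>V(w) = \<Sum>\<^sub>N q\<^sup>N R\<^sub>N(w)\<close>, and let \<open>u = w + 1/w\<close>.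
  The difference \<open>R\<^sub>N\<^sub>+\<^sub>1 - R\<^sub>N\<close> is \<open>u q\<^sup>N\<^sup>+\<^sup>1 R\<^sub>N\<close> plus an error with nonnegative coefficients, so telescoping
  expresses \<open>u q V(w)\<close> as \<open>R\<^sub>\<infinity>(w) - 1/(1-q)\<close> minus the sum of the errors. At \<open>w = 1\<close> this sum is
  coefficientwise at most \<open>(1-q) V(1)\<close>, which makes it negligible for every residue class.
  By the Jacobi triple product \<open>(1 + 1/w) R\<^sub>\<infinity>(w) = P(q) \<Sum>\<^sub>m w\<^sup>m q\<^sup>T\<^sup>(\<^sup>m\<^sup>)\<close> with \<open>T(m) = m(m+1)/2\<close> and \<open>P\<close>
  the overpartition series, so each residue class of ranks is governed by the sums of \<open>p(n - T(m))\<close>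
  over \<open>m\<close> in a residue class, \<open>p\<close> denoting the overpartition function. These are equidistributed
  because \<open>p\<close> is monotone. For odd \<open>c\<close> the factors \<open>u\<close> and \<open>1 + 1/w\<close> are inverted modulo
  \<open>w\<^sup>c - 1\<close> by alternating sums. What remains is \<open>p(n) \<sim> e\<^sup>\<pi>\<^sup>\<surd>\<^sup>n / (8n)\<close>, proved by the circle method:
  a single explicit inequality bounds \<open>|P|\<close> on the whole circle by an integrable function on the
  Gaussian scale, so dominated convergence applies, and the constant comes from the triple product at \<open>w = 1\<close>.
\<close>

subsection \<open>Ranks as coefficients of integer power series\<close>

text \<open>Two obstacles shape the argument. First, V(w) is not an infinite product, and a direct
  circle method would need its behaviour at roots of unity w. Telescoping leaves the single product
  P, with positive, monotone coefficients. The error bound rests on the factor 1/(1-q) in R_N: (1-q)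
  R_N(1) still has nonnegative coefficients, and so the errors add up to at most a difference of
  consecutive coefficients of R_oo(1). Second, P(e^-t) contains a factor sqrt t that its Lambert
  series does not give term by term: the coefficients 2/j (j odd) have one sign, so the constant
  -1/2 in the expansion of 1/(e^x - 1) yields a divergent sum. The triple product at w = 1 avoids
  this: prod (1+q^k)^3 = P(q) sum q^T(k) over k >= 0. On the left the coefficients alternate, so
  that sum converges, to ln 2; the theta sum on the right is a Riemann sum of a Gaussian. Off the
  real axis only the change of log P from the real point of equal modulus enters, and there the
  divergent constants cancel. No modular transformation is used.\<close>

definition slice :: "int \<Rightarrow> int fls fps \<Rightarrow> int fps" where
  "slice m F = Abs_fps (\<lambda>n. fls_nth (fps_nth F n) m)"

definition fls_embed :: "int fps \<Rightarrow> int fls fps" where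
  "fls_embed f = Abs_fps (\<lambda>n. fls_const (fps_nth f n))"

lemma slice_nth [simp]: "fps_nth (slice m F) n = fls_nth (fps_nth F n) m"
  by (simp add: slice_def)

lemma fls_embed_nth [simp]: "fps_nth (fls_embed f) n = fls_const (fps_nth f n)"
  by (simp add: fls_embed_def)

lemma slice_add: "slice m (F + G) = slice m F + slice m G"
  by (simp add: fps_eq_iff)

lemma slice_embed_mult: "slice m (fls_embed f * F) = f * slice m F"
  by (simp add: fps_eq_iff fps_mult_nth fls_sum_nth')

lemma slice_X_mult: "slice m (fps_const fls_X * F) = slice (m - 1) F"
  "slice m (fps_const fls_X_inv * F) = slice (m + 1) F"
  by (simp_all add: fps_eq_iff fls_X_times_conv_shift fls_X_inv_times_conv_shift)

lemma slice_1: "slice m 1 = (if m = 0 then 1 else 0)"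
  by (simp add: fps_eq_iff)

lemma fls_const_sum: "fls_const (sum f A) = (\<Sum>x\<in>A. fls_const (f x))"
  by (rule fls_eqI) (simp add: fls_sum_nth')

lemma fls_embed_mult: "fls_embed (f * g) = fls_embed f * fls_embed g"
  by (simp add: fps_eq_iff fps_mult_nth fls_const_sum)

lemma fls_embed_diff: "fls_embed (f - g) = fls_embed f - fls_embed g"
  by (simp add: fps_eq_iff fls_minus_const)

lemma fls_embed_add: "fls_embed (f + g) = fls_embed f + fls_embed g"
  by (simp add: fps_eq_iff fls_plus_const)

lemma fls_embed_1: "fls_embed 1 = 1"
  by (simp add: fps_eq_iff)

lemma fls_embed_X: "fls_embed fps_X = fps_X"
  by (simp add: fps_eq_iff fps_X_def)

lemma fls_embed_power: "fls_embed (f ^ k) = fls_embed f ^ k"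
  by (induction k) (simp_all add: fls_embed_1 fls_embed_mult)

lemma fls_embed_X_power: "fls_embed (fps_X ^ k) = fps_X ^ k"
  by (simp add: fls_embed_power fls_embed_X)

lemma fls_embed_qpoch: "fls_embed (qpoch A q n) = qpoch (fls_embed A) (fls_embed q) n"
  unfolding qpoch_def
  by (induction n) (simp_all add: fls_embed_1 fls_embed_mult fls_embed_diff fls_embed_power)

lemma fps_recip_unique:
  fixes F G :: "'a::comm_ring_1 fps"
  assumes "F * G = 1" "fps_nth F 0 = 1"
  shows "fps_recip F = G"
proof -
  have "G = G * (F * fps_recip F)" using fps_recip_works[OF assms(2)] by simp
  also have "\<dots> = (F * G) * fps_recip F" by (simp only: ac_simps)
  finally show ?thesis using assms(1) by simp
qed

lemma fls_embed_recip:
  assumes "fps_nth f 0 = 1"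
  shows "fps_recip (fls_embed f) = fls_embed (fps_recip f)"
  by (rule fps_recip_unique)
     (use assms fps_recip_works[OF assms] in \<open>simp_all flip: fls_embed_mult add: fls_embed_1\<close>)

lemma fps_recip_mult:
  fixes F G :: "'a::comm_ring_1 fps"
  assumes "fps_nth F 0 = 1" "fps_nth G 0 = 1"
  shows "fps_recip (F * G) = fps_recip F * fps_recip G"
proof (rule fps_recip_unique)
  have "F * G * (fps_recip F * fps_recip G) = (F * fps_recip F) * (G * fps_recip G)"
    by (simp only: ac_simps)
  then show "F * G * (fps_recip F * fps_recip G) = 1"
    using assms by (simp add: fps_recip_works)
qed (use assms in simp)

lemma fps_recip_1: "fps_recip (1 :: 'a::comm_ring_1 fps) = 1"
  by (rule fps_recip_unique) auto

lemma fps_recip_nth_0 [simp]: "fps_nth (fps_recip F) 0 = (1::'a::comm_ring_1)"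
  by (simp add: fps_recip_def)

text \<open>The coefficient of w^m in (-wq;q)_N (-q/w;q)_N: one step of the recursion multiplies by
  (1 + w q^(N+1)) (1 + q^(N+1)/w). From here on only integer power series in q are
  manipulated.\<close>

primrec pair_coeff :: "nat \<Rightarrow> int \<Rightarrow> int fps" where
  "pair_coeff 0 m = (if m = 0 then 1 else 0)"
| "pair_coeff (Suc N) m = (1 + fps_X ^ (2 * N + 2)) * pair_coeff N m
     + fps_X ^ (N + 1) * (pair_coeff N (m - 1) + pair_coeff N (m + 1))"

lemma slice_qpoch_pair:
  "slice m (qpoch (- (fps_const fls_X * fps_X)) fps_X N * qpoch (- (fps_const fls_X_inv * fps_X)) fps_X N)
     = pair_coeff N m"
proof (induction N arbitrary: m)
  case 0
  then show ?case by (simp add: qpoch_def slice_1)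
next
  case (Suc N)
  define F :: "int fls fps" where "F = qpoch (- (fps_const fls_X * fps_X)) fps_X N * qpoch (- (fps_const fls_X_inv * fps_X)) fps_X N"
  let ?w = "fps_const (fls_X :: int fls)" and ?v = "fps_const (fls_X_inv :: int fls)"
  have wv: "?w * ?v = 1" by (simp add: fls_X_times_conv_shift fls_X_inv_conv_shift_1)
  have "qpoch (- (?w * fps_X)) fps_X (Suc N) * qpoch (- (?v * fps_X)) fps_X (Suc N)
      = F * ((1 + ?w * fps_X * fps_X ^ N) * (1 + ?v * fps_X * fps_X ^ N))"
    by (simp add: qpoch_def F_def algebra_simps)
  also have "(1 + ?w * fps_X * fps_X ^ N) * (1 + ?v * fps_X * fps_X ^ N)
     = 1 + (?w * ?v) * (fps_X * fps_X ^ N * fps_X * fps_X ^ N) + ?w * (fps_X * fps_X ^ N) + ?v * (fps_X * fps_X ^ N)"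
    by (simp only: algebra_simps mult_1_left)
  also have "F * \<dots> = fls_embed (1 + fps_X ^ (2 * N + 2)) * F
       + fls_embed (fps_X ^ (N + 1)) * (?w * F + ?v * F)"
    unfolding wv
    by (simp add: fls_embed_1 fls_embed_add fls_embed_X_power fls_embed_mult fls_embed_X algebra_simps power_add mult_2 mult_2_right)
  finally show ?case
    using Suc by (simp add: slice_add slice_embed_mult slice_X_mult F_def del: power_Suc)
qed

definition odd_den :: "nat \<Rightarrow> int fps" where
  "odd_den N = fps_recip (qpoch fps_X (fps_X ^ 2) (N + 1))"

lemma slice_V_term: "slice m (V_term N) = fps_X ^ N * odd_den N * pair_coeff N m"
proof -
  have "V_term N = fls_embed (fps_X ^ N * odd_den N) *
     (qpoch (- (fps_const fls_X * fps_X)) fps_X N * qpoch (- (fps_const fls_X_inv * fps_X)) fps_X N)"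
    unfolding V_term_def odd_den_def
    by (simp add: fls_embed_mult fls_embed_X_power fls_embed_qpoch fls_embed_X flip: fls_embed_recip)
  then show ?thesis by (simp add: slice_embed_mult slice_qpoch_pair)
qed

lemma oddbal_eq: "oddbal m n = (\<Sum>N\<le>n. fps_nth (fps_X ^ N * odd_den N * pair_coeff N m) n)"
  unfolding oddbal_def V_series_nth fls_sum_nth' by (simp flip: slice_V_term)

lemma pair_coeff_eq_0: "\<bar>m\<bar> > int N \<Longrightarrow> pair_coeff N m = 0"
  by (induction N arbitrary: m) auto

subsection \<open>Sums over residue classes\<close>

text \<open>As for \<open>oddbal_mod\<close>, only nonzero terms are summed, because
  \<open>sum\<close> is 0 on infinite sets. The modulus c = 1 gives the sum over all integers, that
  is, the value at w = 1.\<close>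

definition class_sum :: "int \<Rightarrow> int \<Rightarrow> (int \<Rightarrow> 'a::comm_monoid_add) \<Rightarrow> 'a" where
  "class_sum c a f = (\<Sum>m | [m = a] (mod c) \<and> f m \<noteq> 0. f m)"

lemma class_sum_eq:
  assumes "finite A" "\<And>m. f m \<noteq> 0 \<Longrightarrow> m \<in> A"
  shows "class_sum c a f = (\<Sum>m | m \<in> A \<and> [m = a] (mod c). f m)"
  unfolding class_sum_def
  by (rule sum.mono_neutral_left) (use assms in auto)

lemma finite_support_bounded: 
  fixes f :: "int \<Rightarrow> 'a::zero"
  assumes "\<And>m. \<bar>m\<bar> > int M \<Longrightarrow> f m = 0"
  shows "finite {m. f m \<noteq> 0}"
  by (rule finite_subset[of _ "{- int M..int M}"]) (use assms in \<open>force+\<close>)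

lemma class_sum_add:
  assumes "finite {m. f m \<noteq> 0}" "finite {m. g m \<noteq> 0}"
  shows "class_sum c a (\<lambda>m. f m + g m) = class_sum c a f + class_sum c a g"
proof -
  let ?A = "{m. f m \<noteq> 0} \<union> {m. g m \<noteq> 0}"
  have *: "class_sum c a h = (\<Sum>m | m \<in> ?A \<and> [m = a] (mod c). h m)" if "\<And>m. h m \<noteq> 0 \<Longrightarrow> m \<in> ?A" for h
    by (rule class_sum_eq) (use assms that in auto)
  have "class_sum c a f = (\<Sum>m | m \<in> ?A \<and> [m = a] (mod c). f m)"
    "class_sum c a g = (\<Sum>m | m \<in> ?A \<and> [m = a] (mod c). g m)"
    "class_sum c a (\<lambda>m. f m + g m) = (\<Sum>m | m \<in> ?A \<and> [m = a] (mod c). f m + g m)"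
    by (rule *; auto)+
  then show ?thesis by (simp only: sum.distrib)
qed

lemma class_sum_mult:
  fixes f :: "int \<Rightarrow> 'a::comm_ring_1"
  assumes "finite {m. f m \<noteq> 0}"
  shows "class_sum c a (\<lambda>m. k * f m) = k * class_sum c a f"
proof -
  have "class_sum c a (\<lambda>m. k * f m) = (\<Sum>m | m \<in> {m. f m \<noteq> 0} \<and> [m = a] (mod c). k * f m)"
    by (rule class_sum_eq) (use assms in auto)
  then show ?thesis by (simp add: class_sum_def sum_distrib_left conj_commute)
qed

lemma class_sum_shift: "class_sum c a (\<lambda>m. f (m + k)) = class_sum c (a + k) f"
proof -
  have "[m - k = a] (mod c) \<longleftrightarrow> [m = a + k] (mod c)" for m
    by (metis cong_add_rcancel diff_add_cancel)
  then show ?thesis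
    unfolding class_sum_def
    by (intro sum.reindex_bij_witness[of _ "\<lambda>m. m - k" "\<lambda>m. m + k"]) (auto simp: cong_add_rcancel)
qed

lemma class_sum_nth:
  fixes f :: "int \<Rightarrow> 'a::comm_ring_1 fps"
  assumes "finite {m. f m \<noteq> 0}"
  shows "class_sum c a (\<lambda>m. fps_nth (f m) n) = fps_nth (class_sum c a f) n"
proof -
  have "class_sum c a (\<lambda>m. fps_nth (f m) n) = (\<Sum>m | m \<in> {m. f m \<noteq> 0} \<and> [m = a] (mod c). fps_nth (f m) n)"
    by (rule class_sum_eq) (use assms in auto)
  then show ?thesis by (simp add: class_sum_def fps_sum_nth conj_commute)
qed

lemma class_sum_sum:
  assumes "finite I" "\<And>i. i \<in> I \<Longrightarrow> finite {m. f i m \<noteq> 0}"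
  shows "class_sum c a (\<lambda>m. \<Sum>i\<in>I. f i m) = (\<Sum>i\<in>I. class_sum c a (f i))"
  using assms
proof (induction I)
  case empty
  then show ?case by (simp add: class_sum_def)
next
  case (insert x F)
  have "finite {m. (\<Sum>i\<in>F. f i m) \<noteq> 0}"
    by (rule finite_subset[of _ "\<Union>i\<in>F. {m. f i m \<noteq> 0}"])
       (use insert in \<open>auto intro: sum.neutral\<close>)
  then show ?case using insert by (simp add: class_sum_add)
qed

lemma class_sum_mono1:
  fixes f :: "int \<Rightarrow> int"
  assumes "finite {m. f m \<noteq> 0}" "\<And>m. f m \<ge> 0"
  shows "class_sum c a f \<le> class_sum 1 b f"
  unfolding class_sum_def using assms by (intro sum_mono2) auto

lemma class_sum_1: "class_sum 1 a f = class_sum 1 0 f"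
  by (simp add: class_sum_def)

lemma class_sum_cong_class: "[a = b] (mod c) \<Longrightarrow> class_sum c a f = class_sum c b f"
  unfolding class_sum_def by (metis cong_trans cong_sym)

section \<open>Power series with nonnegative coefficients\<close>

definition fps_nonneg :: "int fps \<Rightarrow> bool" where
  "fps_nonneg F \<longleftrightarrow> (\<forall>n. fps_nth F n \<ge> 0)"

lemma fps_nonneg_add: "fps_nonneg F \<Longrightarrow> fps_nonneg G \<Longrightarrow> fps_nonneg (F + G)"
  by (simp add: fps_nonneg_def)

lemma fps_nonneg_mult: "fps_nonneg F \<Longrightarrow> fps_nonneg G \<Longrightarrow> fps_nonneg (F * G)"
  by (auto simp: fps_nonneg_def fps_mult_nth intro!: sum_nonneg)

lemma fps_nonneg_X_power: "fps_nonneg (fps_X ^ k)"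
  by (simp add: fps_nonneg_def fps_X_power_iff)

lemma fps_nonneg_01: "fps_nonneg 0" "fps_nonneg 1" "fps_nonneg 2"
  by (auto simp: fps_nonneg_def numeral_fps_const)

lemma fps_nonneg_prod: "(\<And>i. i \<in> A \<Longrightarrow> fps_nonneg (f i)) \<Longrightarrow> fps_nonneg (prod f A)"
  by (induction A rule: infinite_finite_induct) (auto simp: fps_nonneg_01 fps_nonneg_mult)

lemma fps_nonneg_sum: "(\<And>i. i \<in> A \<Longrightarrow> fps_nonneg (f i)) \<Longrightarrow> fps_nonneg (sum f A)"
  by (induction A rule: infinite_finite_induct) (auto simp: fps_nonneg_01 fps_nonneg_add)

lemma fps_nonneg_recip:
  assumes "k > 0"
  shows "fps_nonneg (fps_recip (1 - fps_X ^ k))"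
proof -
  define H :: "int fps" where "H = fps_recip (1 - fps_X ^ k)"
  have "(1 - fps_X ^ k) * H = 1"
    unfolding H_def by (rule fps_recip_works) (use assms in simp)
  then have H: "H = 1 + fps_X ^ k * H" by (simp add: algebra_simps)
  have "fps_nth H n \<ge> 0" for n
  proof (induction n rule: less_induct)
    case (less n)
    have "fps_nth H n = fps_nth 1 n + (if n < k then 0 else fps_nth H (n - k))"
      by (subst H) (simp add: fps_X_power_mult_nth)
    then show ?case using less[of "n - k"] assms by auto
  qed
  then show ?thesis by (simp add: H_def fps_nonneg_def)
qed

lemmas fps_nonneg_intros = fps_nonneg_add fps_nonneg_mult fps_nonneg_X_power fps_nonneg_01 fps_nonneg_prod
  fps_nonneg_sum fps_nonneg_recip

lemma fps_recip_prod:
  fixes f :: "'b \<Rightarrow> 'a::comm_ring_1 fps"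
  assumes "\<And>i. i \<in> A \<Longrightarrow> fps_nth (f i) 0 = 1"
  shows "fps_recip (prod f A) = (\<Prod>i\<in>A. fps_recip (f i)) \<and> fps_nth (prod f A) 0 = 1"
  using assms
  by (induction A rule: infinite_finite_induct) (auto simp: fps_recip_1 fps_recip_mult)

lemma odd_den_eq: "odd_den N = (\<Prod>i<N+1. fps_recip (1 - fps_X ^ (2 * i + 1)))"
proof -
  have "odd_den N = fps_recip (\<Prod>i<N+1. 1 - fps_X ^ (2 * i + 1))"
    unfolding odd_den_def qpoch_def by (simp flip: power_mult del: prod.lessThan_Suc)
  then show ?thesis by (subst (asm) fps_recip_prod[THEN conjunct1]) auto
qed

lemma odd_den_Suc: "odd_den (Suc N) = odd_den N * fps_recip (1 - fps_X ^ (2 * N + 3))"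
  by (simp add: odd_den_eq algebra_simps numeral_3_eq_3)

lemma pair_coeff_nonneg: "fps_nonneg (pair_coeff N m)"
  by (induction N arbitrary: m) (auto intro!: fps_nonneg_intros simp del: power_Suc)

text \<open>The factor with \<open>i = 0\<close> is 1/(1 - q), so multiplying by 1 - q merely
  removes it. The bound on the error terms in \<open>step_error_1_le\<close> depends on
  this.\<close>

lemma odd_den_nonneg: "fps_nonneg (odd_den N)" "fps_nonneg ((1 - fps_X) * odd_den N)"
proof -
  show "fps_nonneg (odd_den N)" unfolding odd_den_eq by (auto intro!: fps_nonneg_intros simp del: power_Suc)
  have "(1 - fps_X) * odd_den N = ((1 - fps_X) * fps_recip (1 - fps_X)) * (\<Prod>i<N. fps_recip (1 - fps_X ^ (2 * Suc i + 1)))"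
    unfolding odd_den_eq Suc_eq_plus1[symmetric] prod.lessThan_Suc_shift by (simp add: mult.assoc)
  also have "(1 - fps_X) * fps_recip (1 - fps_X) = (1::int fps)" by (rule fps_recip_works) simp
  finally show "fps_nonneg ((1 - fps_X) * odd_den N)" by (auto intro!: fps_nonneg_intros simp del: power_Suc)
qed

text \<open>The part of R_N(w) whose ranks are congruent to a modulo c. These series stand in for
  the values of R_N at the c-th roots of unity and keep all coefficients nonnegative
  integers.\<close>

definition class_coeff :: "int \<Rightarrow> nat \<Rightarrow> int \<Rightarrow> int fps" where
  "class_coeff c N a = odd_den N * class_sum c a (pair_coeff N)"

lemma finite_pair_coeff: "finite {m. pair_coeff N m \<noteq> 0}"
  by (rule finite_support_bounded[of N]) (rule pair_coeff_eq_0)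

lemma finite_pair_coeff_shift: "finite {m. pair_coeff N (m + k) \<noteq> 0}"
  using finite_vimageI[OF finite_pair_coeff[of N], of "\<lambda>m. m + k"] by (simp add: vimage_def inj_def)

lemma finite_mult_support:
  fixes f :: "int \<Rightarrow> 'a::comm_ring_1"
  shows "finite {m. f m \<noteq> 0} \<Longrightarrow> finite {m. k * f m \<noteq> 0}"
  by (erule rev_finite_subset) auto

lemma finite_add_support:
  fixes f :: "int \<Rightarrow> 'a::comm_ring_1"
  shows "finite {m. f m \<noteq> 0} \<Longrightarrow> finite {m. g m \<noteq> 0} \<Longrightarrow> finite {m. f m + g m \<noteq> 0}"
  by (rule finite_subset[of _ "{m. f m \<noteq> 0} \<union> {m. g m \<noteq> 0}"]) auto

lemmas finite_supports = finite_mult_support finite_add_support finite_pair_coeff finite_pair_coeff_shift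
  finite_pair_coeff_shift[where k = "- 1", simplified]

lemma class_sum_pair_coeff_Suc:
  "class_sum c a (pair_coeff (Suc N)) = (1 + fps_X ^ (2 * N + 2)) * class_sum c a (pair_coeff N)
     + fps_X ^ (N + 1) * (class_sum c (a - 1) (pair_coeff N) + class_sum c (a + 1) (pair_coeff N))"
proof -
  have "class_sum c a (pair_coeff (Suc N)) = class_sum c a (\<lambda>m. (1 + fps_X ^ (2 * N + 2)) * pair_coeff N m
     + fps_X ^ (N + 1) * (pair_coeff N (m + - 1) + pair_coeff N (m + 1)))"
    by (rule arg_cong[of _ _ "class_sum c a"]) (simp add: fun_eq_iff)
  also have "\<dots> = (1 + fps_X ^ (2 * N + 2)) * class_sum c a (pair_coeff N)
     + fps_X ^ (N + 1) * (class_sum c a (\<lambda>m. pair_coeff N (m + - 1)) + class_sum c a (\<lambda>m. pair_coeff N (m + 1)))"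
    by (subst class_sum_add class_sum_mult; (intro finite_supports)?)+ simp
  also have "class_sum c a (\<lambda>m. pair_coeff N (m + - 1)) = class_sum c (a - 1) (pair_coeff N)"
    by (subst class_sum_shift) simp
  also have "class_sum c a (\<lambda>m. pair_coeff N (m + 1)) = class_sum c (a + 1) (pair_coeff N)"
    by (rule class_sum_shift)
  finally show ?thesis .
qed

lemma class_coeff_0: "class_coeff c 0 a = (if [a = 0] (mod c) then fps_recip (1 - fps_X) else 0)"
proof -
  have "class_sum c a (pair_coeff 0) = (\<Sum>m | m \<in> {0} \<and> [m = a] (mod c). pair_coeff 0 m)"
    by (rule class_sum_eq) (auto split: if_splits)
  also have "\<dots> = (if [a = 0] (mod c) then 1 else 0)"
    by (auto simp: cong_sym_eq Collect_conv_if)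
  finally show ?thesis by (auto simp: class_coeff_def odd_den_eq)
qed

text \<open>This is (1 - q^(2N+3)) R_(N+1) = (1 + w q^(N+1)) (1 + q^(N+1)/w) R_N, where
  multiplication by w or 1/w moves the residue class by one.\<close>

lemma class_coeff_Suc:
  "(1 - fps_X ^ (2 * N + 3)) * class_coeff c (Suc N) a = (1 + fps_X ^ (2 * N + 2)) * class_coeff c N a
     + fps_X ^ (N + 1) * (class_coeff c N (a - 1) + class_coeff c N (a + 1))"
proof -
  have "(1 - fps_X ^ (2 * N + 3)) * class_coeff c (Suc N) a
      = ((1 - fps_X ^ (2 * N + 3)) * fps_recip (1 - fps_X ^ (2 * N + 3))) * (odd_den N * class_sum c a (pair_coeff (Suc N)))"
    by (simp only: class_coeff_def odd_den_Suc ac_simps)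
  also have "(1 - fps_X ^ (2 * N + 3)) * fps_recip (1 - fps_X ^ (2 * N + 3)) = (1::int fps)"
    by (rule fps_recip_works) simp
  finally show ?thesis
    by (simp only: class_sum_pair_coeff_Suc class_coeff_def mult_1_left) (simp only: algebra_simps)
qed

lemma oddbal_mod_eq: "oddbal_mod a c n = (\<Sum>N\<le>n. fps_nth (fps_X ^ N * class_coeff c N a) n)"
proof -
  have fin: "finite {m. fps_nth (fps_X ^ N * odd_den N * pair_coeff N m) n \<noteq> 0}" for N
    by (rule finite_subset[OF _ finite_pair_coeff[of N]]) auto
  have "oddbal_mod a c n = class_sum c a (\<lambda>m. oddbal m n)"
    by (simp add: oddbal_mod_def class_sum_def)
  also have "\<dots> = (\<Sum>N\<le>n. class_sum c a (\<lambda>m. fps_nth (fps_X ^ N * odd_den N * pair_coeff N m) n))"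
    unfolding oddbal_eq by (rule class_sum_sum) (auto intro: fin)
  also have "\<dots> = (\<Sum>N\<le>n. fps_nth (fps_X ^ N * class_coeff c N a) n)"
    by (intro sum.cong refl)
       (simp add: class_sum_nth class_sum_mult finite_supports class_coeff_def mult.assoc)
  finally show ?thesis .
qed

lemma fps_nonneg_class_sum:
  assumes "finite {m. f m \<noteq> 0}" "\<And>m. fps_nonneg (f m)"
  shows "fps_nonneg (class_sum c a f)"
  unfolding class_sum_def by (intro fps_nonneg_sum) (use assms in auto)

lemma class_coeff_nonneg: "fps_nonneg (class_coeff c N a)" "fps_nonneg ((1 - fps_X) * class_coeff c N a)"
proof -
  have *: "fps_nonneg (class_sum c a (pair_coeff N))"
    by (rule fps_nonneg_class_sum) (auto intro: finite_pair_coeff pair_coeff_nonneg)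
  show "fps_nonneg (class_coeff c N a)"
    unfolding class_coeff_def by (intro fps_nonneg_mult * odd_den_nonneg)
  show "fps_nonneg ((1 - fps_X) * class_coeff c N a)"
    using fps_nonneg_mult[OF odd_den_nonneg(2) *] by (simp only: class_coeff_def mult.assoc)
qed

text \<open>All terms are nonnegative, so one class never exceeds the total. Hence error estimates
  are needed at w = 1 only.\<close>

lemma class_coeff_le: "fps_nonneg (class_coeff 1 N b - class_coeff c N a)"
proof -
  have "fps_nonneg (class_sum 1 b (pair_coeff N) - class_sum c a (pair_coeff N))"
    unfolding fps_nonneg_def
    using class_sum_mono1[of "\<lambda>m. fps_nth (pair_coeff N m) n" c a b for n] pair_coeff_nonneg[of N]
      finite_subset[OF _ finite_pair_coeff[of N], of "{m. fps_nth (pair_coeff N m) n \<noteq> 0}" for n]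
    by (fastforce simp: fps_nonneg_def finite_pair_coeff simp flip: class_sum_nth)
  from fps_nonneg_mult[OF odd_den_nonneg(1)[of N] this] show ?thesis
    by (simp add: class_coeff_def algebra_simps)
qed

lemma class_coeff_1: "class_coeff 1 N a = class_coeff 1 N 0"
  unfolding class_coeff_def by (subst class_sum_1) simp

subsection \<open>A finite Jacobi triple product\<close>

text \<open>Divisibility of a difference by q^N serves as congruence to precision N; with it finite
  products replace limits of power series.\<close>

lemma fps_X_power_dvd_nth:
  fixes F G :: "'a::comm_ring_1 fps"
  assumes "fps_X ^ N dvd F - G" "n < N"
  shows "fps_nth F n = fps_nth G n"
proof -
  from assms(1) obtain H where "F - G = fps_X ^ N * H" by (elim dvdE)
  then have "fps_nth (F - G) n = 0" using assms(2) by (simp only: fps_X_power_mult_nth) simp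
  then show ?thesis by simp
qed

lemma dvd_diff_mult:
  fixes F :: "'a::comm_ring_1"
  assumes "d dvd F - G" "d dvd F' - G'"
  shows "d dvd F * F' - G * G'"
proof -
  have "F * F' - G * G' = (F - G) * F' + G * (F' - G')" by (simp add: algebra_simps)
  then show ?thesis using assms by simp
qed

lemma dvd_diff_trans:
  fixes F :: "'a::comm_ring_1"
  assumes "d dvd F - G" "d dvd G - H"
  shows "d dvd F - H"
  using dvd_add[OF assms] by simp

lemma dvd_diff_recip:
  fixes F :: "'a::comm_ring_1 fps"
  assumes "d dvd F - G" "fps_nth F 0 = 1" "fps_nth G 0 = 1"
  shows "d dvd fps_recip F - fps_recip G"
proof -
  have "fps_recip F - fps_recip G
      = (G * fps_recip G) * fps_recip F - (F * fps_recip F) * fps_recip G"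
    using assms by (simp add: fps_recip_works)
  also have "\<dots> = (F - G) * (- (fps_recip F * fps_recip G))"
    by (simp add: algebra_simps)
  finally show ?thesis using assms(1) by simp
qed

lemma dvd_diff_prod:
  fixes f :: "nat \<Rightarrow> 'a::comm_ring_1 fps"
  assumes "\<And>i. fps_X ^ (i + 1) dvd f i - 1" "K \<le> L"
  shows "fps_X ^ (K + 1) dvd (\<Prod>i<L. f i) - (\<Prod>i<K. f i)"
  using assms(2)
proof (induction L rule: dec_induct)
  case base
  then show ?case by simp
next
  case (step L)
  have "(\<Prod>i<Suc L. f i) - (\<Prod>i<K. f i) = (\<Prod>i<L. f i) * (f L - 1) + ((\<Prod>i<L. f i) - (\<Prod>i<K. f i))"
    by (simp add: algebra_simps)
  moreover have "fps_X ^ (K + 1) dvd f L - 1"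
    using assms(1)[of L] step(1) by (meson add_le_mono1 dvd_trans le_imp_power_dvd)
  ultimately show ?case using step.IH by (simp only: dvd_add dvd_mult)
qed

section \<open>Finite q-products and truncations of the overpartition series\<close>

definition q_fact :: "nat \<Rightarrow> int fps" where
  "q_fact k = (\<Prod>i<k. 1 - fps_X ^ (i + 1))"

definition q_fact_plus :: "nat \<Rightarrow> int fps" where
  "q_fact_plus k = (\<Prod>i<k. 1 + fps_X ^ (i + 1))"

definition odd_fact :: "nat \<Rightarrow> int fps" where
  "odd_fact k = (\<Prod>i<k. 1 - fps_X ^ (2 * i + 1))"

lemma fact_nth_0 [simp]: "fps_nth (q_fact k) 0 = 1" "fps_nth (q_fact_plus k) 0 = 1" "fps_nth (odd_fact k) 0 = 1"
  by (induction k) (simp_all add: q_fact_def q_fact_plus_def odd_fact_def)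

lemma fact_cong:
  assumes "K \<le> L"
  shows "fps_X ^ (K + 1) dvd q_fact L - q_fact K" "fps_X ^ (K + 1) dvd q_fact_plus L - q_fact_plus K"
    "fps_X ^ (K + 1) dvd odd_fact L - odd_fact K"
  unfolding q_fact_def q_fact_plus_def odd_fact_def
  by (rule dvd_diff_prod[OF _ assms]; simp add: le_imp_power_dvd flip: power_Suc)+

text \<open>Both sides are (q;q^2)_N (q^2;q^2)_N. This is the finite form of Euler's identity
  between partitions into odd and into distinct parts.\<close>

lemma odd_fact_eq: "odd_fact N * q_fact N * q_fact_plus N = q_fact (2 * N)"
proof (induction N)
  case 0
  then show ?case by (simp add: q_fact_def q_fact_plus_def odd_fact_def)
next
  case (Suc N)
  have "odd_fact (Suc N) * q_fact (Suc N) * q_fact_plus (Suc N)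
     = (odd_fact N * q_fact N * q_fact_plus N) * (1 - fps_X ^ (2 * N + 1)) * ((1 - fps_X ^ (N + 1)) * (1 + fps_X ^ (N + 1)))"
    by (simp add: q_fact_def q_fact_plus_def odd_fact_def mult_ac)
  also have "(1 - fps_X ^ (N + 1)) * (1 + fps_X ^ (N + 1)) = (1 - fps_X ^ (2 * N + 2) :: int fps)"
    by (simp add: algebra_simps power_add mult_2 mult_2_right power2_eq_square)
  finally show ?case unfolding Suc by (simp add: q_fact_def mult_ac)
qed

lemma odd_den_conv: "odd_den N = fps_recip (odd_fact (N + 1))"
  unfolding odd_den_eq odd_fact_def by (subst fps_recip_prod[THEN conjunct1]) auto

text \<open>By \<open>odd_fact_eq\<close>, \<open>odd_fact N * q_fact_plus N\<close> equals
  (q;q)_(2N) / (q;q)_N, whose factors 1 - q^k all have k > N and are therefore 1 at this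
  precision.\<close>

lemma odd_den_cong: "fps_X ^ (N + 1) dvd odd_den N - q_fact_plus N"
proof -
  have "fps_X ^ (N + 1) dvd fps_recip (q_fact N) * (q_fact (2 * N) - q_fact N)"
    by (intro dvd_mult fact_cong) simp
  also have "fps_recip (q_fact N) * (q_fact (2 * N) - q_fact N)
     = (q_fact N * fps_recip (q_fact N)) * (odd_fact N * q_fact_plus N) - q_fact N * fps_recip (q_fact N)"
    unfolding odd_fact_eq[symmetric] by (simp only: algebra_simps)
  finally have 1: "fps_X ^ (N + 1) dvd odd_fact N * q_fact_plus N - 1"
    by (simp add: fps_recip_works)
  have "fps_X ^ (N + 1) dvd odd_fact (N + 1) * q_fact_plus N - odd_fact N * q_fact_plus N"
    by (intro dvd_diff_mult fact_cong) auto
  from dvd_diff_trans[OF this 1] have "fps_X ^ (N + 1) dvd - odd_den N * (odd_fact (N + 1) * q_fact_plus N - 1)"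
    by (rule dvd_mult)
  also have "- odd_den N * (odd_fact (N + 1) * q_fact_plus N - 1)
      = odd_den N - (odd_fact (N + 1) * fps_recip (odd_fact (N + 1))) * q_fact_plus N"
    by (simp add: odd_den_conv algebra_simps)
  finally show ?thesis by (simp add: fps_recip_works)
qed

definition overpartition_prod :: "nat \<Rightarrow> int fps" where
  "overpartition_prod K = (\<Prod>k<K. (1 + fps_X ^ Suc k) * fps_recip (1 - fps_X ^ Suc k))"

lemma overpartition_prod_eq: "overpartition_prod K = q_fact_plus K * fps_recip (q_fact K)"
  unfolding overpartition_prod_def q_fact_plus_def q_fact_def prod.distrib
  by (subst fps_recip_prod[THEN conjunct1]) auto

lemma overpartition_prod_cong:
  assumes "K \<le> L"
  shows "fps_X ^ (K + 1) dvd overpartition_prod L - overpartition_prod K"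
  unfolding overpartition_prod_eq using assms by (intro dvd_diff_mult dvd_diff_recip fact_cong) auto

lemma overpartition_eq:
  assumes "n \<le> K"
  shows "overpartition n = fps_nth (overpartition_prod K) n"
proof -
  have "overpartition_prod \<longlonglongrightarrow> overpartition_series"
    using has_prod_imp_tendsto'[OF overpartition_has_prod] by (simp add: overpartition_prod_def[abs_def])
  then have "\<forall>\<^sub>F k in sequentially. fps_nth (overpartition_prod k) n = fps_nth overpartition_series n"
    by (simp add: tendsto_fps_iff)
  then obtain L where L: "\<And>k. k \<ge> L \<Longrightarrow> fps_nth (overpartition_prod k) n = fps_nth overpartition_series n"
    by (auto simp: eventually_sequentially)
  have "fps_nth (overpartition_prod (max K L)) n = fps_nth (overpartition_prod K) n"
    by (rule fps_X_power_dvd_nth[OF overpartition_prod_cong]) (use assms in auto)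
  then show ?thesis using L[of "max K L"] by (simp add: overpartition_def)
qed

lemma overpartition_series_cong: "fps_X ^ (K + 1) dvd overpartition_series - overpartition_prod K"
proof -
  have "fps_nth (overpartition_series - overpartition_prod K) n = 0" if "n < K + 1" for n
    using that overpartition_eq[of n K] by (simp add: overpartition_def)
  then have "overpartition_series - overpartition_prod K
      = fps_X ^ (K + 1) * Abs_fps (\<lambda>n. fps_nth (overpartition_series - overpartition_prod K) (n + (K + 1)))"
    unfolding fps_eq_iff fps_X_power_mult_nth by simp
  then show ?thesis by (metis dvd_triv_left)
qed

lemma overpartition_prod_nonneg: "fps_nonneg (overpartition_prod K)"
  unfolding overpartition_prod_def by (intro fps_nonneg_intros) auto

lemma overpartition_nonneg: "overpartition n \<ge> 0"
  using overpartition_prod_nonneg[of n] by (simp add: overpartition_eq[of n n] fps_nonneg_def)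

lemma overpartition_prod_le:
  assumes "K \<le> L"
  shows "fps_nth (overpartition_prod K) n \<le> fps_nth (overpartition_prod L) n"
  using assms
proof (induction L rule: dec_induct)
  case (step L)
  define R :: "int fps" where "R = fps_recip (1 - fps_X ^ Suc L)"
  have "(1 - fps_X ^ Suc L) * R = 1" unfolding R_def by (rule fps_recip_works) simp
  then have "(1 + fps_X ^ Suc L) * R = 1 + 2 * fps_X ^ Suc L * R" by (simp add: algebra_simps)
  then have "overpartition_prod (Suc L) - overpartition_prod L = overpartition_prod L * (2 * fps_X ^ Suc L * R)"
    unfolding overpartition_prod_def prod.lessThan_Suc R_def by (simp only: distrib_left mult_1_right add_diff_cancel_left')
  moreover have "fps_nonneg (overpartition_prod L * (2 * fps_X ^ Suc L * R))"
    unfolding R_def by (intro fps_nonneg_intros overpartition_prod_nonneg) auto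
  ultimately have "fps_nth (overpartition_prod L) n \<le> fps_nth (overpartition_prod (Suc L)) n"
    by (simp add: fps_nonneg_def) (metis diff_ge_0_iff_ge fps_sub_nth)
  with step show ?case by simp
qed simp

lemma overpartition_prod_le_overpartition: "fps_nth (overpartition_prod K) n \<le> overpartition n"
  using overpartition_prod_le[of K "max K n" n] overpartition_eq[of n "max K n"] by simp

text \<open>Multiplication by 1 - q cancels the denominator of the first factor of the product, and
  the other factors have nonnegative coefficients. Monotonicity is what makes the residue classes
  equidistributed later.\<close>

lemma overpartition_mono: "mono overpartition"
proof -
  have "overpartition n \<le> overpartition (Suc n)" for n
  proof -
  define G :: "int fps" where "G = (\<Prod>k<n. (1 + fps_X ^ Suc (Suc k)) * fps_recip (1 - fps_X ^ Suc (Suc k)))"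
  have "(1 - fps_X) * overpartition_prod (Suc n) = ((1 - fps_X) * fps_recip (1 - fps_X)) * ((1 + fps_X) * G)"
    by (simp add: overpartition_prod_def prod.lessThan_Suc_shift G_def mult_ac del: prod.lessThan_Suc)
  also have "(1 - fps_X) * fps_recip (1 - fps_X) = (1::int fps)" by (rule fps_recip_works) simp
  finally have *: "(1 - fps_X) * overpartition_prod (Suc n) = (1 + fps_X ^ 1) * G" by simp
  have "fps_nonneg ((1 + fps_X ^ 1) * G)"
    unfolding G_def by (intro fps_nonneg_intros) auto
  then have "0 \<le> fps_nth ((1 - fps_X) * overpartition_prod (Suc n)) (Suc n)"
    unfolding * by (simp add: fps_nonneg_def)
  then show "overpartition n \<le> overpartition (Suc n)"
    using overpartition_eq[of n "Suc n"] overpartition_eq[of "Suc n" "Suc n"]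
    by (simp add: algebra_simps)
  qed
  then show ?thesis by (simp add: mono_iff_le_Suc)
qed

text \<open>Taken on all integers, where T(m) = T(-m-1): every triangular number occurs twice, which
  accounts for the factor 2 in front of \<open>triple_coeff\<close>.\<close>

definition tri :: "int \<Rightarrow> nat" where
  "tri m = nat (m * (m + 1) div 2)"

lemma tri_eq: "2 * int (tri m) = m * (m + 1)"
proof -
  have "even (m * (m + 1))" by simp
  moreover have "m * (m + 1) \<ge> 0" by (cases "m \<ge> 0") (auto intro: mult_nonpos_nonpos)
  ultimately show ?thesis by (simp add: tri_def)
qed

lemma tri_ge: "int (tri m) \<ge> \<bar>m\<bar> - 1"
proof -
  have "m * (m + 1) \<ge> 2 * (\<bar>m\<bar> - 1)"
  proof (cases "m \<ge> 0")
    case True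
    then have "0 \<le> m * (m - 1)" by (cases "m = 0") auto
    then show ?thesis using True by (simp add: algebra_simps)
  next
    case False
    have "0 \<le> (m + 1) * (m + 2)" using False by (cases "m = -1") (auto intro: mult_nonpos_nonpos)
    then show ?thesis using False by (simp add: algebra_simps)
  qed
  then have "2 * (\<bar>m\<bar> - 1) \<le> 2 * int (tri m)" by (simp only: tri_eq)
  then show ?thesis by simp
qed

text \<open>The coefficient of \<open>w\<^sup>m\<close> in the product of \<open>(1 + w q\<^sup>k) (1 + w\<^sup>-\<^sup>1 q\<^sup>k\<^sup>-\<^sup>1)\<close> over \<open>1 \<le> k \<le> N\<close>.\<close>

primrec jacobi_coeff :: "nat \<Rightarrow> int \<Rightarrow> int fps" where
  "jacobi_coeff 0 m = (if m = 0 then 1 else 0)"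
| "jacobi_coeff (Suc N) m = (1 + fps_X ^ (2 * N + 1)) * jacobi_coeff N m
     + fps_X ^ (N + 1) * jacobi_coeff N (m - 1) + fps_X ^ N * jacobi_coeff N (m + 1)"

text \<open>The factor 1 + 1/w completes (-wq;q)_N (-q/w;q)_N to (-wq;q)_N (-1/w;q)_(N+1), which is
  the Jacobi product times its next factor 1 + q^N/w.\<close>

lemma pair_coeff_add_pair_coeff:
  "pair_coeff N m + pair_coeff N (m + 1) = jacobi_coeff N m + fps_X ^ N * jacobi_coeff N (m + 1)"
proof (induction N arbitrary: m)
  case 0
  then show ?case by simp
next
  case (Suc N)
  define x :: "int fps" where "x = fps_X ^ N"
  have p: "fps_X ^ (2 * N + 2) = fps_X ^ 2 * x ^ 2" "fps_X ^ (2 * N + 1) = fps_X * x ^ 2"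
    "fps_X ^ (N + 1) = fps_X * x" "fps_X ^ Suc N = fps_X * x" "fps_X ^ N = x"
    by (simp_all add: x_def power_add power_mult mult.commute power2_eq_square mult_2 mult_2_right mult.left_commute)
  have "pair_coeff (Suc N) m + pair_coeff (Suc N) (m + 1)
     = (1 + fps_X ^ 2 * x ^ 2) * (pair_coeff N m + pair_coeff N (m + 1))
     + fps_X * x * ((pair_coeff N (m - 1) + pair_coeff N (m - 1 + 1)) + (pair_coeff N (m + 1) + pair_coeff N (m + 1 + 1)))"
    unfolding pair_coeff.simps p by (simp add: algebra_simps)
  also have "\<dots> = jacobi_coeff (Suc N) m + fps_X ^ Suc N * jacobi_coeff (Suc N) (m + 1)"
    unfolding Suc jacobi_coeff.simps p by (simp add: algebra_simps power2_eq_square)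
  finally show ?case .
qed

text \<open>1/(q;q)_k, continued by 0 to negative k as usual for q-binomial coefficients; this makes
  \<open>inv_q_fact_pred\<close> hold at \<open>i = 0\<close> too.\<close>

definition inv_q_fact :: "int \<Rightarrow> int fps" where
  "inv_q_fact k = (if k < 0 then 0 else fps_recip (q_fact (nat k)))"

lemma inv_q_fact_pred:
  "inv_q_fact (int i - 1) = (1 - fps_X ^ i) * inv_q_fact (int i)"
proof (cases i)
  case 0
  then show ?thesis by (simp add: inv_q_fact_def)
next
  case (Suc j)
  have "q_fact (Suc j) = q_fact j * (1 - fps_X ^ Suc j)"
    by (simp add: q_fact_def)
  then have "fps_recip (q_fact (Suc j)) = fps_recip (q_fact j) * fps_recip (1 - fps_X ^ Suc j)"
    by (simp add: fps_recip_mult)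
  moreover have "(1 - fps_X ^ Suc j) * fps_recip (1 - fps_X ^ Suc j) = (1::int fps)"
    by (rule fps_recip_works) simp
  ultimately have "(1 - fps_X ^ Suc j) * fps_recip (q_fact (Suc j)) = fps_recip (q_fact j)"
    by (metis mult.left_commute mult.right_neutral)
  then show ?thesis by (simp add: inv_q_fact_def Suc nat_add_distrib del: power_Suc)
qed

text \<open>The finite triple product: the coefficient of w^m is the q-binomial coefficient of 2N
  over N+m, times q^T(m). After the common factor \<open>A\<close> is taken out, the induction step
  is a polynomial identity in powers of q.\<close>

lemma jacobi_coeff_eq:
  "jacobi_coeff N m = q_fact (2 * N) * inv_q_fact (int N + m) * inv_q_fact (int N - m) * fps_X ^ tri m"
proof (induction N arbitrary: m)
  case 0
  then show ?case by (auto simp: q_fact_def inv_q_fact_def tri_def fps_recip_1)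
next
  case (Suc N)
  consider "\<bar>m\<bar> \<ge> int N + 2" | "\<bar>m\<bar> \<le> int N + 1" by linarith
  then show ?case
  proof cases
    case 1
    then have "jacobi_coeff N m = 0" "jacobi_coeff N (m - 1) = 0" "jacobi_coeff N (m + 1) = 0"
      unfolding Suc by (auto simp: inv_q_fact_def)
    moreover have "inv_q_fact (int (Suc N) + m) * inv_q_fact (int (Suc N) - m) = 0"
      using 1 by (auto simp: inv_q_fact_def)
    ultimately show ?thesis by (simp add: mult.assoc)
  next
    case 2
    define i j where "i = nat (int N + 1 + m)" and "j = nat (int N + 1 - m)"
    have ij: "int i = int N + 1 + m" "int j = int N + 1 - m" "i + j = 2 * N + 2" using 2 by (auto simp: i_def j_def)
    define x y p r A :: "int fps" where "x = fps_X ^ i" and "y = fps_X ^ j"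
      and "p = fps_X ^ (2 * N + 1)" and "r = fps_X ^ (2 * N + 2)"
      and "A = q_fact (2 * N) * inv_q_fact (int i) * inv_q_fact (int j) * fps_X ^ tri m"
    \<comment> \<open>Truncated subtraction gives \<open>x' = 1\<close> when \<open>i = 0\<close>;
      there \<open>x'\<close> is always accompanied by the factor 1 - x = 0. The same holds for
      \<open>y'\<close> and \<open>j\<close>.\<close>
    define x' y' :: "int fps" where "x' = fps_X ^ (i - 1)" and "y' = fps_X ^ (j - 1)"
    have e: "inv_q_fact (int N + m) = (1 - x) * inv_q_fact (int i)"
      "inv_q_fact (int N - m) = (1 - y) * inv_q_fact (int j)"
      using inv_q_fact_pred[of i] inv_q_fact_pred[of j] by (simp_all add: ij x_def y_def)
    have e2: "inv_q_fact (int N + (m - 1)) = (1 - x') * (1 - x) * inv_q_fact (int i)"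
    proof (cases i)
      case 0
      then have "int N + (m - 1) < 0" using ij by simp
      then show ?thesis by (simp add: inv_q_fact_def x_def 0)
    next
      case (Suc i')
      then have *: "int N + (m - 1) = int i' - 1" "int i' = int i - 1" "x' = fps_X ^ i'"
        using ij by (simp_all add: x'_def)
      show ?thesis
        unfolding *(1,3) inv_q_fact_pred[of i']
        unfolding *(2) inv_q_fact_pred[of i] x_def mult.assoc ..
    qed
    have e3: "inv_q_fact (int N - (m + 1)) = (1 - y') * (1 - y) * inv_q_fact (int j)"
    proof (cases j)
      case 0
      then have "int N - (m + 1) < 0" using ij by simp
      then show ?thesis by (simp add: inv_q_fact_def y_def 0)
    next
      case (Suc j')
      then have *: "int N - (m + 1) = int j' - 1" "int j' = int j - 1" "y' = fps_X ^ j'"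
        using ij by (simp_all add: y'_def)
      show ?thesis
        unfolding *(1,3) inv_q_fact_pred[of j']
        unfolding *(2) inv_q_fact_pred[of j] y_def mult.assoc ..
    qed
    have t: "N + 1 + tri (m - 1) = j + tri m" "N + tri (m + 1) = i + tri m"
      using tri_eq[of m] tri_eq[of "m - 1"] tri_eq[of "m + 1"] ij by (simp_all add: algebra_simps)
    have s: "int N + (m + 1) = int i" "int N - (m - 1) = int j" using ij by auto
    have "jacobi_coeff (Suc N) m = (1 + p) * (q_fact (2 * N) * inv_q_fact (int N + m) * inv_q_fact (int N - m) * fps_X ^ tri m)
      + q_fact (2 * N) * inv_q_fact (int N + (m - 1)) * inv_q_fact (int N - (m - 1)) * (fps_X ^ (N + 1) * fps_X ^ tri (m - 1))
      + q_fact (2 * N) * inv_q_fact (int N + (m + 1)) * inv_q_fact (int N - (m + 1)) * (fps_X ^ N * fps_X ^ tri (m + 1))"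
      unfolding jacobi_coeff.simps Suc p_def by (simp only: mult_ac)
    also have "\<dots> = ((1 + p) * (1 - x) * (1 - y) + y * (1 - x') * (1 - x) + x * (1 - y') * (1 - y)) * A"
      unfolding power_add[symmetric] t e e2 e3 s
      by (simp add: A_def power_add x_def[symmetric] y_def[symmetric] algebra_simps)
    also have "(1 + p) * (1 - x) * (1 - y) + y * (1 - x') * (1 - x) + x * (1 - y') * (1 - y) = (1 - p) * (1 - r)"
    proof -
      have xy: "x * y = r" using ij(3) by (simp add: x_def y_def r_def flip: power_add)
      have yx': "y * x' = p" if "i > 0"
      proof -
        have "j + (i - 1) = 2 * N + 1" using that ij(3) by linarith
        then show ?thesis by (simp add: y_def x'_def p_def flip: power_add)
      qed
      have xy': "x * y' = p" if "j > 0"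
      proof -
        have "i + (j - 1) = 2 * N + 1" using that ij(3) by linarith
        then show ?thesis by (simp add: x_def y'_def p_def flip: power_add)
      qed
      consider "i = 0" "j > 0" | "j = 0" "i > 0" | "i > 0" "j > 0" using ij(3) by linarith
      then show ?thesis
      proof cases
        case 1
        then have "x = 1" by (simp add: x_def)
        moreover have "y = r" "y' = p" using xy xy' 1 \<open>x = 1\<close> by auto
        ultimately show ?thesis by simp
      next
        case 2
        then have "y = 1" by (simp add: y_def)
        moreover have "x = r" "x' = p" using xy yx' 2 \<open>y = 1\<close> by auto
        ultimately show ?thesis by simp
      next
        case 3
        have "(1 + p) * (1 - x) * (1 - y) + y * (1 - x') * (1 - x) + x * (1 - y') * (1 - y)
          = (1 + p) * (1 - x - y + x * y) + (y - y * x') * (1 - x) + (x - x * y') * (1 - y)"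
          by (simp add: algebra_simps)
        also have "\<dots> = (1 + p) * (1 - x - y + x * y) + (y - p) * (1 - x) + (x - p) * (1 - y)"
          using yx' xy' 3 by simp
        also have "\<dots> = (1 + p) + (p - 1) * (x * y) - 2 * p" by (simp add: algebra_simps)
        finally show ?thesis unfolding xy by (simp add: algebra_simps)
      qed
    qed
    also have "(1 - p) * (1 - r) * A = q_fact (2 * Suc N) * inv_q_fact (int (Suc N) + m) * inv_q_fact (int (Suc N) - m) * fps_X ^ tri m"
    proof -
      have *: "int (Suc N) + m = int i" "int (Suc N) - m = int j" using ij by simp_all
      show ?thesis unfolding * by (simp add: A_def p_def r_def q_fact_def mult_ac)
    qed
    finally show ?thesis .
  qed
qed

text \<open>With K = N - |m|, the smaller of N+m and N-m, every q-product involved agrees with its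
  K-th truncation up to q^K, and together they leave (-q;q)_K / (q;q)_K. The factor q^T(m) restores
  the lost precision because T(m) >= |m| - 1.\<close>

lemma jacobi_coeff_cong: "fps_X ^ N dvd odd_den N * jacobi_coeff N m - overpartition_series * fps_X ^ tri m"
proof (cases "\<bar>m\<bar> \<le> int N")
  case False
  then have "jacobi_coeff N m = 0" unfolding jacobi_coeff_eq by (auto simp: inv_q_fact_def)
  moreover have "N \<le> tri m" using tri_ge[of m] False by linarith
  ultimately show ?thesis by (simp add: le_imp_power_dvd dvd_mult)
next
  case True
  let ?B = "odd_den N * (q_fact (2 * N) * inv_q_fact (int N + m) * inv_q_fact (int N - m))"
  define K where "K = nat (int N - \<bar>m\<bar>)"
  have K: "K \<le> N" "int K \<le> int N + m" "int K \<le> int N - m" "N \<le> K + 1 + tri m"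
    using True tri_ge[of m] by (auto simp: K_def)
  have e: "fps_X ^ (K + 1) dvd inv_q_fact k - fps_recip (q_fact K)" if "int K \<le> k" for k
    unfolding inv_q_fact_def using that by (auto intro!: dvd_diff_recip fact_cong simp del: power_Suc simp: fact_cong[unfolded Suc_eq_plus1[symmetric]])
  have "fps_X ^ (K + 1) dvd odd_den N - q_fact_plus N"
    by (rule dvd_trans[OF _ odd_den_cong]) (use K in \<open>simp add: le_imp_power_dvd\<close>)
  then have d: "fps_X ^ (K + 1) dvd odd_den N - q_fact_plus K"
    by (rule dvd_diff_trans) (use K fact_cong in auto)
  have "fps_X ^ (K + 1) dvd ?B
      - q_fact_plus K * (q_fact K * fps_recip (q_fact K) * fps_recip (q_fact K))"
    by (intro dvd_diff_mult d e fact_cong K) (use K in auto)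
  moreover have "q_fact_plus K * (q_fact K * fps_recip (q_fact K) * fps_recip (q_fact K)) = overpartition_prod K"
    by (simp add: fps_recip_works overpartition_prod_eq)
  ultimately have "fps_X ^ (K + 1) dvd ?B - overpartition_series"
    using overpartition_series_cong[of K] by (metis dvd_diff_trans dvd_minus_iff minus_diff_eq)
  then have "fps_X ^ (K + 1) * fps_X ^ tri m dvd (?B - overpartition_series) * fps_X ^ tri m"
    by (rule mult_dvd_mono) simp
  moreover have "fps_X ^ N dvd fps_X ^ (K + 1) * (fps_X ^ tri m :: int fps)"
    unfolding power_add[symmetric] using K by (rule_tac le_imp_power_dvd) simp
  ultimately have "fps_X ^ N dvd (?B - overpartition_series) * fps_X ^ tri m"
    by (meson dvd_trans)
  then show ?thesis
    unfolding jacobi_coeff_eq by (simp only: left_diff_distrib mult.assoc)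
qed

subsection \<open>Telescoping\<close>

lemma finite_jacobi_coeff: "finite {m. jacobi_coeff N m \<noteq> 0}"
  by (rule finite_support_bounded[of N]) (auto simp: jacobi_coeff_eq inv_q_fact_def)

lemma finite_tri_le: "finite {m. tri m \<le> n}"
proof (rule finite_subset[of _ "{- int n - 1..int n + 1}"])
  show "{m. tri m \<le> n} \<subseteq> {- int n - 1..int n + 1}"
  proof
    fix m assume "m \<in> {m. tri m \<le> n}"
    then show "m \<in> {- int n - 1..int n + 1}" using tri_ge[of m] by auto
  qed
qed simp

definition overpartition_tri :: "nat \<Rightarrow> int \<Rightarrow> int" where
  "overpartition_tri n m = (if tri m \<le> n then overpartition (n - tri m) else 0)"

text \<open>Only sums of two adjacent classes come out, because the triple product involves the
  factor 1 + 1/w. They are separated in \<open>class_coeff_limit\<close>, for odd c.\<close>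

lemma class_coeff_add_class_coeff:
  assumes "n < N"
  shows "fps_nth (class_coeff c N a) n + fps_nth (class_coeff c N (a + 1)) n = class_sum c a (overpartition_tri n)"
proof -
  have "class_coeff c N a + class_coeff c N (a + 1) = odd_den N * class_sum c a (\<lambda>m. pair_coeff N m + pair_coeff N (m + 1))"
    by (simp add: class_coeff_def class_sum_add class_sum_shift finite_supports distrib_left)
  also have "\<dots> = odd_den N * class_sum c a (jacobi_coeff N) + fps_X ^ N * (odd_den N * class_sum c a (\<lambda>m. jacobi_coeff N (m + 1)))"
  proof -
    have "finite {m. jacobi_coeff N (m + 1) \<noteq> 0}"
      using finite_vimageI[OF finite_jacobi_coeff[of N], of "\<lambda>m. m + 1"] by (simp add: vimage_def inj_def)
    then show ?thesis
      unfolding pair_coeff_add_pair_coeff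
      by (simp add: class_sum_add class_sum_mult finite_mult_support finite_jacobi_coeff distrib_left mult.left_commute)
  qed
  finally have "fps_nth (class_coeff c N a) n + fps_nth (class_coeff c N (a + 1)) n
      = fps_nth (odd_den N * class_sum c a (jacobi_coeff N) + fps_X ^ N * (odd_den N * class_sum c a (\<lambda>m. jacobi_coeff N (m + 1)))) n"
    by (simp only: fps_add_nth[symmetric])
  also have "\<dots> = fps_nth (odd_den N * class_sum c a (jacobi_coeff N)) n"
    using assms by (simp only: fps_X_power_mult_nth fps_add_nth) simp
  also have "odd_den N * class_sum c a (jacobi_coeff N) = class_sum c a (\<lambda>m. odd_den N * jacobi_coeff N m)"
    by (rule class_sum_mult[OF finite_jacobi_coeff, symmetric])
  also have "fps_nth \<dots> n = class_sum c a (\<lambda>m. fps_nth (odd_den N * jacobi_coeff N m) n)"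
    by (rule class_sum_nth[OF finite_mult_support[OF finite_jacobi_coeff], symmetric])
  also have "(\<lambda>m. fps_nth (odd_den N * jacobi_coeff N m) n) = overpartition_tri n"
  proof
    fix m
    have "fps_nth (odd_den N * jacobi_coeff N m) n = fps_nth (overpartition_series * fps_X ^ tri m) n"
      by (rule fps_X_power_dvd_nth[OF jacobi_coeff_cong assms])
    then show "fps_nth (odd_den N * jacobi_coeff N m) n = overpartition_tri n m"
      by (simp add: overpartition_tri_def overpartition_def fps_X_power_mult_right_nth)
  qed
  finally show ?thesis .
qed

text \<open>The coefficient of \<open>q\<^sup>n\<close> in \<open>\<Prod>\<^sub>k (1 + q\<^sup>k)\<^sup>3\<close>, the limit of \<^term>\<open>class_coeff 1 N 0\<close>.\<close>

definition triple_coeff :: "nat \<Rightarrow> int" where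
  "triple_coeff n = fps_nth (class_coeff 1 (Suc n) 0) n"

lemma triple_coeff_eq:
  assumes "n < N"
  shows "fps_nth (class_coeff 1 N a) n = triple_coeff n" "2 * triple_coeff n = class_sum 1 b (overpartition_tri n)"
proof -
  have *: "2 * fps_nth (class_coeff 1 N 0) n = class_sum 1 b (overpartition_tri n)" if "n < N" for N b
    using class_coeff_add_class_coeff[OF that, of 1 0] class_coeff_1[of N 1] class_sum_1[of b "overpartition_tri n"] by simp
  from *[of "Suc n" b] show "2 * triple_coeff n = class_sum 1 b (overpartition_tri n)"
    by (simp add: triple_coeff_def)
  with *[OF assms, of b] show "fps_nth (class_coeff 1 N a) n = triple_coeff n"
    using class_coeff_1[of N a] by simp
qed

definition step_error :: "int \<Rightarrow> nat \<Rightarrow> int \<Rightarrow> int fps" where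
  "step_error c N a = class_coeff c (Suc N) a - class_coeff c N a
     - fps_X ^ (N + 1) * (class_coeff c N (a - 1) + class_coeff c N (a + 1))"

text \<open>Clearing the denominator 1 - q^(2N+3) cancels the terms 1 and u q^(N+1); everything that
  survives has a positive sign.\<close>

lemma step_error_eq:
  "step_error c N a = fps_recip (1 - fps_X ^ (2 * N + 3)) *
     ((fps_X ^ (2 * N + 2) + fps_X ^ (2 * N + 3)) * class_coeff c N a
      + fps_X ^ (3 * N + 4) * (class_coeff c N (a - 1) + class_coeff c N (a + 1)))"
proof -
  define g :: "int fps" where "g = fps_recip (1 - fps_X ^ (2 * N + 3))"
  have g: "g * (1 - fps_X ^ (2 * N + 3)) = 1"
    unfolding g_def by (subst mult.commute, rule fps_recip_works) simp
  have p: "fps_X ^ (2 * N + 3) * fps_X ^ (N + 1) = (fps_X ^ (3 * N + 4) :: int fps)"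
  proof -
    have "2 * N + 3 + (N + 1) = 3 * N + 4" by simp
    then show ?thesis by (simp only: power_add[symmetric])
  qed
  have "step_error c N a = g * (1 - fps_X ^ (2 * N + 3)) * step_error c N a"
    by (simp add: g)
  also have "\<dots> = g * ((1 - fps_X ^ (2 * N + 3)) * class_coeff c (Suc N) a - (1 - fps_X ^ (2 * N + 3)) * class_coeff c N a
     - (fps_X ^ (N + 1) - fps_X ^ (2 * N + 3) * fps_X ^ (N + 1)) * (class_coeff c N (a - 1) + class_coeff c N (a + 1)))"
    unfolding step_error_def by (simp only: algebra_simps mult_1_left)
  also have "\<dots> = g *
     ((fps_X ^ (2 * N + 2) + fps_X ^ (2 * N + 3)) * class_coeff c N a
      + fps_X ^ (3 * N + 4) * (class_coeff c N (a - 1) + class_coeff c N (a + 1)))"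
    unfolding class_coeff_Suc p by (simp only: algebra_simps mult_1_left)
  finally show ?thesis by (simp only: g_def)
qed

lemma step_error_nonneg: "fps_nonneg (step_error c N a)"
  unfolding step_error_eq by (intro fps_nonneg_intros class_coeff_nonneg) auto

lemma step_error_le: "fps_nonneg (step_error 1 N 0 - step_error c N a)"
proof -
  have "step_error 1 N 0 - step_error c N a = fps_recip (1 - fps_X ^ (2 * N + 3)) *
     ((fps_X ^ (2 * N + 2) + fps_X ^ (2 * N + 3)) * (class_coeff 1 N 0 - class_coeff c N a)
      + fps_X ^ (3 * N + 4) * ((class_coeff 1 N (0 - 1) - class_coeff c N (a - 1)) + (class_coeff 1 N (0 + 1) - class_coeff c N (a + 1))))"
    unfolding step_error_eq by (simp only: algebra_simps)
  also have "fps_nonneg \<dots>"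
    by (intro fps_nonneg_intros class_coeff_le) auto
  finally show ?thesis .
qed

text \<open>Here x = q^(N+1), y = q and r = R_N(1). Up to the denominator 1 - y x^2, the left side
  is q^(N+1) (R_(N+1)(1) - R_N(1)) minus the error. On the right the factor 1 - y appears, which
  cancels against the 1/(1 - q) in r.\<close>

lemma step_error_identity:
  fixes x y r :: "'a::comm_ring_1"
  shows "x * ((x ^ 2 + y * x ^ 2 + 2 * y * x ^ 3) * r + (1 - y * x ^ 2) * (2 * x * r)) - (x ^ 2 + y * x ^ 2 + 2 * y * x ^ 3) * r
    = (x ^ 2 + x ^ 3) * ((1 - y) * r)"
  by (simp add: algebra_simps power2_eq_square power3_eq_cube)

text \<open>The weight q^(N+1) in front of the difference is the one for which summation by parts
  over N returns (1 - q) V(1).\<close>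

lemma step_error_1_le:
  "fps_nonneg (fps_X ^ (N + 1) * (class_coeff 1 (Suc N) 0 - class_coeff 1 N 0) - step_error 1 N 0)"
proof -
  let ?D = "class_coeff 1 (Suc N) 0 - class_coeff 1 N 0" and ?E = "step_error 1 N 0"
  define g :: "int fps" where "g = fps_recip (1 - fps_X ^ (2 * N + 3))"
  define x :: "int fps" where "x = fps_X ^ (N + 1)"
  define R where "R = class_coeff 1 N 0"
  have g: "(1 - fps_X * x ^ 2) * g = 1"
  proof -
    have "fps_X * x ^ 2 = fps_X ^ (2 * N + 3)" by (simp add: x_def flip: power_mult power_Suc)
    then show ?thesis unfolding g_def by (simp only:) (rule fps_recip_works, simp)
  qed
  have p: "fps_X ^ (2 * N + 2) = x ^ 2" "fps_X ^ (2 * N + 3) = fps_X * x ^ 2" "fps_X ^ (3 * N + 4) = fps_X * x ^ 3"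
    by (simp_all add: x_def flip: power_mult power_Suc)
  have e: "?E = g * ((x ^ 2 + fps_X * x ^ 2 + 2 * fps_X * x ^ 3) * R)"
    unfolding step_error_eq g_def class_coeff_1[of N "0 - 1"] class_coeff_1[of N "0 + 1"] p R_def[symmetric]
    by (simp only: distrib_right mult_2 mult.assoc distrib_left)
  have "?D = ?E + 2 * x * R"
    unfolding step_error_def class_coeff_1[of N "0 - 1"] class_coeff_1[of N "0 + 1"] x_def R_def
    by (simp only: mult_2 distrib_left distrib_right diff_add_cancel mult.assoc)
  also have "\<dots> = ?E + ((1 - fps_X * x ^ 2) * g) * (2 * x * R)"
    unfolding g by simp
  finally have D: "?D = ?E + ((1 - fps_X * x ^ 2) * g) * (2 * x * R)" .
  have "fps_X ^ (N + 1) * ?D - ?E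
     = g * (x * ((x ^ 2 + fps_X * x ^ 2 + 2 * fps_X * x ^ 3) * R + (1 - fps_X * x ^ 2) * (2 * x * R))
        - (x ^ 2 + fps_X * x ^ 2 + 2 * fps_X * x ^ 3) * R)"
    unfolding D x_def[symmetric] e by (simp only: algebra_simps mult_1_left)
  also have "\<dots> = g * ((x ^ 2 + x ^ 3) * ((1 - fps_X) * R))"
    unfolding step_error_identity ..
  also have "fps_nonneg \<dots>"
    unfolding g_def R_def x_def power_mult[symmetric] by (intro fps_nonneg_intros class_coeff_nonneg) auto
  finally show ?thesis .
qed

lemma oddbal_mod_eq_sum:
  assumes "n < M"
  shows "oddbal_mod a c n = fps_nth (\<Sum>N<M. fps_X ^ N * class_coeff c N a) n"
  unfolding oddbal_mod_eq fps_sum_nth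
  by (rule sum.mono_neutral_left) (use assms in \<open>auto simp: fps_X_power_mult_nth\<close>)

lemma class_coeff_telescope:
  "class_coeff c M a = class_coeff c 0 a + fps_X * ((\<Sum>N<M. fps_X ^ N * class_coeff c N (a - 1)) + (\<Sum>N<M. fps_X ^ N * class_coeff c N (a + 1)))
     + (\<Sum>N<M. step_error c N a)"
proof (induction M)
  case (Suc M)
  have "class_coeff c (Suc M) a = class_coeff c M a + fps_X ^ (M + 1) * (class_coeff c M (a - 1) + class_coeff c M (a + 1)) + step_error c M a"
    by (simp add: step_error_def)
  then show ?case by (subst (asm) Suc) (simp add: algebra_simps)
qed simp

lemma recip_1_minus_X: "fps_recip (1 - fps_X) = (Abs_fps (\<lambda>_. 1) :: int fps)"
proof (rule fps_recip_unique)
  show "(1 - fps_X) * Abs_fps (\<lambda>_. 1) = (1 :: int fps)"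
    by (simp add: fps_eq_iff left_diff_distrib)
qed simp

text \<open>The coefficient of q^(n+1) in the telescoped identity. The initial term R_0 = 1/(1 - q)
  has rank 0 and so contributes 1 to the class of 0 and nothing to the others.\<close>

lemma oddbal_mod_recurrence:
  assumes "n < M"
  shows "fps_nth (class_coeff c (Suc M) a) (Suc n) = (if [a = 0] (mod c) then 1 else 0)
     + oddbal_mod (a - 1) c n + oddbal_mod (a + 1) c n + fps_nth (\<Sum>N<Suc M. step_error c N a) (Suc n)"
  using assms
  by (subst class_coeff_telescope)
     (simp add: class_coeff_0 recip_1_minus_X oddbal_mod_eq_sum[of n "Suc M"] distrib_left del: sum.lessThan_Suc)

lemma oddbal_mod_1: "oddbal_mod a 1 n = oddbal_mod 0 1 n"
  by (simp add: oddbal_mod_def)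

lemma triple_coeff_recurrence:
  assumes "n < M"
  shows "triple_coeff (Suc n) = 1 + 2 * oddbal_mod 0 1 n + fps_nth (\<Sum>N<Suc M. step_error 1 N 0) (Suc n)"
  using oddbal_mod_recurrence[OF assms, of 1 0] triple_coeff_eq(1)[of "Suc n" "Suc M" 0] assms
    oddbal_mod_1[of 1 n] oddbal_mod_1[of "- 1" n] by simp

lemma step_error_sum_nonneg: "fps_nth (\<Sum>N<M. step_error c N a) n \<ge> 0"
  using fps_nonneg_sum[of "{..<M}" "\<lambda>N. step_error c N a"] step_error_nonneg by (simp add: fps_nonneg_def)

text \<open>Write v for \<open>oddbal_mod 0 1\<close> and e for the total error at w = 1. Summation
  by parts gives e <= v(n+1) - v(n) - 1. Since \<open>triple_coeff (Suc n)\<close> is 1 + 2 v(n) + e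
  and \<open>triple_coeff (Suc (Suc n))\<close> is at least 1 + 2 v(n+1), v can be eliminated. The
  resulting bound avoids circularity: it involves only \<open>triple_coeff\<close>, whose
  asymptotics do not depend on v.\<close>

lemma step_error_sum_le:
  assumes "n < M"
  shows "fps_nth (\<Sum>N<Suc M. step_error c N a) (Suc n) \<le> triple_coeff (Suc (Suc n)) - triple_coeff (Suc n)"
proof -
  let ?e = "fps_nth (\<Sum>N<Suc M. step_error 1 N 0) (Suc n)"
  have 1: "fps_nth (\<Sum>N<Suc M. step_error c N a) (Suc n) \<le> ?e"
    unfolding fps_sum_nth by (rule sum_mono) (use step_error_le[of _ c a] in \<open>auto simp: fps_nonneg_def\<close>)
  have "fps_nth (\<Sum>N<Suc M. step_error 1 N 0) (Suc n)
     \<le> fps_nth (\<Sum>N<Suc M. fps_X ^ (N + 1) * (class_coeff 1 (Suc N) 0 - class_coeff 1 N 0)) (Suc n)"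
    unfolding fps_sum_nth
  proof (rule sum_mono)
    fix N
    have "0 \<le> fps_nth (fps_X ^ (N + 1) * (class_coeff 1 (Suc N) 0 - class_coeff 1 N 0) - step_error 1 N 0) (Suc n)"
      using step_error_1_le[of N] unfolding fps_nonneg_def by blast
    then show "fps_nth (step_error 1 N 0) (Suc n) \<le> fps_nth (fps_X ^ (N + 1) * (class_coeff 1 (Suc N) 0 - class_coeff 1 N 0)) (Suc n)"
      by (simp only: fps_sub_nth)
  qed
  also have "(\<Sum>N<Suc M. fps_X ^ (N + 1) * (class_coeff 1 (Suc N) 0 - class_coeff 1 N 0))
    = (\<Sum>N<Suc (Suc M). fps_X ^ N * class_coeff 1 N 0) - class_coeff 1 0 0 - fps_X * (\<Sum>N<Suc M. fps_X ^ N * class_coeff 1 N 0)"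
    by (subst (2) sum.lessThan_Suc_shift) (simp add: algebra_simps sum_subtractf sum_distrib_left del: sum.lessThan_Suc)
  also have "fps_nth \<dots> (Suc n) = oddbal_mod 0 1 (Suc n) - 1 - oddbal_mod 0 1 n"
    using assms oddbal_mod_eq_sum[of "Suc n" "Suc (Suc M)" 0 1] oddbal_mod_eq_sum[of n "Suc M" 0 1]
    by (simp add: class_coeff_0 recip_1_minus_X del: sum.lessThan_Suc)
  finally have "?e \<le> oddbal_mod 0 1 (Suc n) - 1 - oddbal_mod 0 1 n" .
  moreover have "triple_coeff (Suc n) = 1 + 2 * oddbal_mod 0 1 n + ?e"
    by (rule triple_coeff_recurrence) fact
  moreover have "triple_coeff (Suc (Suc n)) \<ge> 1 + 2 * oddbal_mod 0 1 (Suc n)"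
    using triple_coeff_recurrence[of "Suc n" "Suc (Suc n)"] step_error_sum_nonneg[of 1 0 "Suc (Suc (Suc n))" "Suc (Suc n)"]
    by simp
  ultimately show ?thesis using 1 by linarith
qed

subsection \<open>Evaluation of the generating functions\<close>

text \<open>Absolute convergence is included so that the notion is closed under Cauchy
  products.\<close>

definition fps_sums :: "int fps \<Rightarrow> complex \<Rightarrow> complex \<Rightarrow> bool" where
  "fps_sums F z s \<longleftrightarrow> summable (\<lambda>n. norm (of_int (fps_nth F n) * z ^ n)) \<and> (\<lambda>n. of_int (fps_nth F n) * z ^ n) sums s"

lemma fps_sums_mult:
  assumes "fps_sums F z s" "fps_sums G z t"
  shows "fps_sums (F * G) z (s * t)"
proof -
  let ?f = "\<lambda>n. of_int (fps_nth F n) * z ^ n" and ?g = "\<lambda>n. of_int (fps_nth G n) * z ^ n"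
  have eq: "(\<Sum>i\<le>n. ?f i * ?g (n - i)) = of_int (fps_nth (F * G) n) * z ^ n" for n
  proof -
    have "(\<Sum>i\<le>n. ?f i * ?g (n - i)) = (\<Sum>i=0..n. of_int (fps_nth F i * fps_nth G (n - i)) * z ^ n)"
      unfolding atLeast0AtMost
      by (rule sum.cong) (auto simp: mult_ac simp flip: power_add)
    then show ?thesis by (simp add: fps_mult_nth sum_distrib_right)
  qed
  have s: "summable (\<lambda>n. norm (?f n))" "summable (\<lambda>n. norm (?g n))" "suminf ?f = s" "suminf ?g = t"
    using assms by (auto simp: fps_sums_def sums_iff)
  have "(\<lambda>n. \<Sum>i\<le>n. ?f i * ?g (n - i)) sums (s * t)"
    using Cauchy_product_sums[OF s(1,2)] s(3,4) by simp
  moreover have "summable (\<lambda>n. norm (\<Sum>i\<le>n. ?f i * ?g (n - i)))"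
  proof (rule summable_comparison_test'[OF sums_summable[OF Cauchy_product_sums[of "\<lambda>n. norm (?f n)" "\<lambda>n. norm (?g n)"]]])
    show "norm (norm (\<Sum>i\<le>n. ?f i * ?g (n - i))) \<le> (\<Sum>i\<le>n. norm (?f i) * norm (?g (n - i)))" for n
      by (simp only: real_norm_def abs_norm_cancel) (rule order_trans[OF norm_sum], simp add: norm_mult)
  qed (use s in auto)
  ultimately show ?thesis unfolding eq fps_sums_def by blast
qed

lemma fps_sums_finite:
  assumes "\<And>n. n > N \<Longrightarrow> fps_nth F n = 0"
  shows "fps_sums F z (\<Sum>n\<le>N. of_int (fps_nth F n) * z ^ n)"
  unfolding fps_sums_def using assms
  by (intro conjI summable_finite[of "{..N}"] sums_finite) auto

lemma fps_sums_binomial: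
  assumes "k > 0" "\<And>n. fps_nth F n = (if n = 0 then 1 else if n = k then c else 0)"
  shows "fps_sums F z (1 + of_int c * z ^ k)"
proof -
  have "fps_sums F z (\<Sum>n\<le>k. of_int (fps_nth F n) * z ^ n)"
    by (rule fps_sums_finite) (use assms in auto)
  also have "(\<Sum>n\<le>k. of_int (fps_nth F n) * z ^ n) = (\<Sum>n\<in>{0,k}. of_int (fps_nth F n) * z ^ n)"
    by (rule sum.mono_neutral_right) (use assms in auto)
  also have "\<dots> = 1 + of_int c * z ^ k"
    using assms by simp
  finally show ?thesis .
qed

lemma fps_sums_1: "fps_sums 1 z 1"
  using fps_sums_binomial[of 1 1 0 z] by simp

lemma fps_sums_1_plus_X_power:
  assumes "k > 0"
  shows "fps_sums (1 + fps_X ^ k) z (1 + z ^ k)"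
  using fps_sums_binomial[of k "1 + fps_X ^ k" 1 z] assms by (simp add: fps_X_power_iff)

lemma fps_sums_1_minus_X_power:
  assumes "k > 0"
  shows "fps_sums (1 - fps_X ^ k) z (1 - z ^ k)"
proof -
  have "fps_sums (1 - fps_X ^ k) z (1 + of_int (- 1) * z ^ k)"
    by (rule fps_sums_binomial) (use assms in \<open>auto simp: fps_X_power_iff\<close>)
  then show ?thesis by simp
qed

lemma fps_sums_recip:
  assumes "k > 0" "norm z < 1"
  shows "fps_sums (fps_recip (1 - fps_X ^ k)) z (1 / (1 - z ^ k))"
proof -
  define H :: "int fps" where "H = fps_recip (1 - fps_X ^ k)"
  have 1: "(1 - fps_X ^ k) * H = 1"
    unfolding H_def by (rule fps_recip_works) (use assms in simp)
  then have H: "H = 1 + fps_X ^ k * H" by (simp add: algebra_simps)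
  have "\<bar>fps_nth H n\<bar> \<le> 1" for n
  proof (induction n rule: less_induct)
    case (less n)
    have "fps_nth H n = fps_nth 1 n + (if n < k then 0 else fps_nth H (n - k))"
      by (subst H) (simp add: fps_X_power_mult_nth)
    then show ?case using less[of "n - k"] assms by auto
  qed
  then have b: "norm (of_int (fps_nth H n) :: complex) \<le> 1" for n
    by (metis of_int_1 of_int_abs of_int_le_iff norm_of_int)
  have summ: "summable (\<lambda>n. norm (of_int (fps_nth H n) * z ^ n))"
  proof (rule summable_comparison_test'[OF summable_geometric[of "norm z"]])
    show "norm (norm (of_int (fps_nth H n) * z ^ n)) \<le> norm z ^ n" for n
      using mult_right_mono[OF b[of n], of "norm z ^ n"] by (simp add: norm_mult norm_power)
  qed (use assms in simp)
  define s where "s = (\<Sum>n. of_int (fps_nth H n) * z ^ n)"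
  have s: "fps_sums H z s"
    unfolding fps_sums_def s_def using summ summable_sums[OF summable_norm_cancel[OF summ]] by (rule conjI)
  have "fps_sums ((1 - fps_X ^ k) * H) z ((1 - z ^ k) * s)"
    by (rule fps_sums_mult[OF fps_sums_1_minus_X_power[OF assms(1)] s])
  then have "fps_sums 1 z ((1 - z ^ k) * s)" unfolding 1 .
  then have "(1 - z ^ k) * s = 1"
    using fps_sums_1[of z] unfolding fps_sums_def by (blast intro: sums_unique2)
  then have "s = 1 / (1 - z ^ k)"
    using nonzero_eq_divide_eq[of "1 - z ^ k" s 1] by (cases "1 - z ^ k = 0") (auto simp: mult.commute)
  then show ?thesis using s by (simp only: H_def)
qed

lemma fps_sums_prod:
  fixes K :: nat
  assumes "\<And>i. i < K \<Longrightarrow> fps_sums (f i) z (g i)"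
  shows "fps_sums (\<Prod>i<K. f i) z (\<Prod>i<K. g i)"
  using assms
proof (induction K)
  case 0
  then show ?case using fps_sums_1[of z] by simp
qed (auto intro: fps_sums_mult)

lemma fps_sums_overpartition_prod:
  assumes "norm z < 1"
  shows "fps_sums (overpartition_prod K) z (\<Prod>k<K. (1 + z ^ Suc k) / (1 - z ^ Suc k))"
  unfolding overpartition_prod_def
proof (rule fps_sums_prod)
  fix i
  have "fps_sums (1 + fps_X ^ Suc i) z (1 + z ^ Suc i)"
    by (rule fps_sums_1_plus_X_power) simp
  from fps_sums_mult[OF this fps_sums_recip[of "Suc i" z]] assms
  show "fps_sums ((1 + fps_X ^ Suc i) * fps_recip (1 - fps_X ^ Suc i)) z ((1 + z ^ Suc i) / (1 - z ^ Suc i))"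
    by simp
qed

text \<open>Expanding 1/(1 - q^j) shows that this is the sum over k >= 1 of A(q^k), with A(z) the
  power series with coefficients \<open>a j\<close>. Its exponential is thus the product of exp
  (A(q^k)), which is used for exp (A(z)) = (1+z)/(1-z) and for exp (A(z)) = 1 + z.\<close>

definition lambert :: "(nat \<Rightarrow> real) \<Rightarrow> complex \<Rightarrow> complex" where
  "lambert a q = (\<Sum>j. of_real (a j) * (q ^ j / (1 - q ^ j)))"

lemma norm_geometric_le:
  fixes q :: complex
  assumes "norm q < 1" "j > 0"
  shows "norm (\<Sum>k<K. q ^ (j * Suc k)) \<le> norm q ^ j / (1 - norm q)"
proof -
  have "norm (\<Sum>k<K. q ^ (j * Suc k)) \<le> (\<Sum>k<K. norm q ^ (j * Suc k))"
    by (rule order_trans[OF norm_sum]) (simp add: norm_power)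
  also have "\<dots> \<le> (\<Sum>k<K. norm q ^ j * norm q ^ k)"
  proof (rule sum_mono)
    fix k
    have "j + k \<le> j * Suc k" using assms(2) by (cases j) auto
    then show "norm q ^ (j * Suc k) \<le> norm q ^ j * norm q ^ k"
      unfolding power_add[symmetric] by (rule power_decreasing) (use assms in auto)
  qed
  also have "\<dots> = norm q ^ j * (\<Sum>k<K. norm q ^ k)" by (simp add: sum_distrib_left)
  also have "(\<Sum>k<K. norm q ^ k) = (1 - norm q ^ K) / (1 - norm q)"
    using assms by (simp add: sum_gp_strict)
  also have "norm q ^ j * \<dots> \<le> norm q ^ j * (1 / (1 - norm q))"
    using assms by (intro mult_left_mono divide_right_mono) auto
  finally show ?thesis by simp
qed

lemma geometric_tail_limit:
  fixes q :: complex
  assumes "norm q < 1" "j > 0"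
  shows "(\<lambda>K. \<Sum>k<K. q ^ (j * Suc k)) \<longlonglongrightarrow> q ^ j / (1 - q ^ j)"
proof -
  have "norm (q ^ j) < 1" using assms by (simp add: norm_power power_less_one_iff)
  then have "(\<lambda>k. q ^ j * (q ^ j) ^ k) sums (q ^ j * (1 / (1 - q ^ j)))"
    by (intro sums_mult geometric_sums)
  then show ?thesis by (simp add: sums_def power_mult power_add)
qed

lemma summable_lambert_majorant:
  assumes "0 \<le> (r::real)" "r < 1" "\<And>j. \<bar>a j\<bar> \<le> C"
  shows "summable (\<lambda>j. \<bar>a j\<bar> * (r ^ j / (1 - r)))"
proof (rule summable_comparison_test'[OF summable_mult[OF summable_geometric[of r], of "C / (1 - r)"]])
  show "norm (\<bar>a j\<bar> * (r ^ j / (1 - r))) \<le> C / (1 - r) * r ^ j" for j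
    using assms(1,2) assms(3)[of j] by (auto simp: abs_mult intro!: divide_right_mono mult_right_mono)
qed (use assms in auto)

text \<open>For a finite product the k-sum is a partial geometric sum, bounded independently of its
  length by r^j / (1 - r) with r = |q|. Tannery's theorem then allows the limit under the sum over
  j.\<close>

lemma prod_tendsto_exp_lambert:
  fixes f :: "complex \<Rightarrow> complex"
  assumes q: "norm q < 1" and a: "a 0 = 0" "\<And>j. \<bar>a j\<bar> \<le> C"
    and summ: "\<And>z::complex. norm z < 1 \<Longrightarrow> summable (\<lambda>j. of_real (a j) * z ^ j)"
    and exp: "\<And>z. norm z < 1 \<Longrightarrow> exp (\<Sum>j. of_real (a j) * z ^ j) = f z"
  shows "summable (\<lambda>j. norm (of_real (a j) * (q ^ j / (1 - q ^ j))))"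
    and "(\<lambda>K. \<Prod>k<K. f (q ^ Suc k)) \<longlonglongrightarrow> exp (lambert a q)"
proof -
  let ?a = "\<lambda>j K. of_real (a j) * (\<Sum>k<K. q ^ (j * Suc k))"
  have bound: "norm (?a j K) \<le> \<bar>a j\<bar> * (norm q ^ j / (1 - norm q))" for j K
  proof (cases "j = 0")
    case False
    have "norm (?a j K) = \<bar>a j\<bar> * norm (\<Sum>k<K. q ^ (j * Suc k))"
      by (simp add: norm_mult)
    also have "\<dots> \<le> \<bar>a j\<bar> * (norm q ^ j / (1 - norm q))"
      using False by (intro mult_left_mono norm_geometric_le[OF q]) simp_all
    finally show ?thesis .
  qed (simp add: a)
  have lim: "(\<lambda>K. ?a j K) \<longlonglongrightarrow> of_real (a j) * (q ^ j / (1 - q ^ j))" for j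
  proof (cases "j = 0")
    case False
    then show ?thesis by (intro tendsto_mult tendsto_const geometric_tail_limit[OF q]) simp
  qed (simp add: a)
  have maj: "summable (\<lambda>j. \<bar>a j\<bar> * (norm q ^ j / (1 - norm q)))"
    by (rule summable_lambert_majorant[OF _ q a(2)]) simp
  have "(\<forall>\<^sub>F K in sequentially. summable (\<lambda>j. norm (?a j K))) \<and>
      summable (\<lambda>j. norm (of_real (a j) * (q ^ j / (1 - q ^ j)))) \<and> ((\<lambda>K. \<Sum>j. ?a j K) \<longlonglongrightarrow> lambert a q)"
    unfolding lambert_def
    by (rule tannerys_theorem[OF lim _ maj]) (use bound in \<open>auto intro!: always_eventually\<close>)
  then have *: "summable (\<lambda>j. norm (of_real (a j) * (q ^ j / (1 - q ^ j))))" "(\<lambda>K. \<Sum>j. ?a j K) \<longlonglongrightarrow> lambert a q"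
    by blast+
  show "summable (\<lambda>j. norm (of_real (a j) * (q ^ j / (1 - q ^ j))))" by fact
  have "exp (\<Sum>j. ?a j K) = (\<Prod>k<K. f (q ^ Suc k))" for K
  proof -
    have n: "norm (q ^ Suc k) < 1" for k
      using q by (simp add: norm_power power_less_one_iff del: power_Suc)
    have "(\<Sum>j. ?a j K) = (\<Sum>j. \<Sum>k<K. of_real (a j) * (q ^ Suc k) ^ j)"
      by (simp add: sum_distrib_left mult.commute flip: power_mult del: power_Suc)
    also have "\<dots> = (\<Sum>k<K. \<Sum>j. of_real (a j) * (q ^ Suc k) ^ j)"
      by (rule suminf_sum) (rule summ[OF n])
    finally show ?thesis using exp[OF n] by (simp add: exp_sum del: power_Suc)
  qed
  then show "(\<lambda>K. \<Prod>k<K. f (q ^ Suc k)) \<longlonglongrightarrow> exp (lambert a q)"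
    using tendsto_exp[OF *(2)] by simp
qed

definition atanh_coeff :: "nat \<Rightarrow> real" where
  "atanh_coeff j = (if odd j then 2 / real j else 0)"

text \<open>At \<open>j = 0\<close> division by zero yields 0, the constant term that the series of
  log (1 + z) needs.\<close>

definition log_coeff :: "nat \<Rightarrow> real" where
  "log_coeff j = (-1) ^ Suc j / real j"

lemma atanh_coeff_bounds: "0 \<le> atanh_coeff j" "\<bar>atanh_coeff j\<bar> \<le> 2" "atanh_coeff 0 = 0"
  by (auto simp: atanh_coeff_def divide_le_eq)

lemma log_coeff_bounds: "\<bar>log_coeff j\<bar> \<le> 1" "log_coeff 0 = 0"
  by (auto simp: log_coeff_def power_abs divide_le_eq)

lemma exp_log_series:
  fixes z :: complex
  assumes "norm z < 1"
  shows "(\<lambda>j. of_real (log_coeff j) * z ^ j) sums Ln (1 + z)"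
    and "exp (\<Sum>j. of_real (log_coeff j) * z ^ j) = 1 + z"
proof -
  show s: "(\<lambda>j. of_real (log_coeff j) * z ^ j) sums Ln (1 + z)"
    using Ln_series[OF assms] by (simp add: log_coeff_def)
  have "z \<noteq> - 1" using assms by auto
  then have "1 + z \<noteq> 0" by (auto simp: add_eq_0_iff)
  then show "exp (\<Sum>j. of_real (log_coeff j) * z ^ j) = 1 + z"
    using s by (simp add: sums_iff)
qed

lemma exp_atanh_series:
  fixes z :: complex
  assumes "norm z < 1"
  shows "summable (\<lambda>j. of_real (atanh_coeff j) * z ^ j)"
    and "exp (\<Sum>j. of_real (atanh_coeff j) * z ^ j) = (1 + z) / (1 - z)"
proof -
  have z: "norm (- z) < 1" using assms by simp
  have "(\<lambda>j. of_real (log_coeff j) * z ^ j - of_real (log_coeff j) * (- z) ^ j) sums (Ln (1 + z) - Ln (1 + - z))"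
    by (intro sums_diff exp_log_series assms z)
  also have "(\<lambda>j. of_real (log_coeff j) * z ^ j - of_real (log_coeff j) * (- z) ^ j) = (\<lambda>j. of_real (atanh_coeff j) * z ^ j)"
    by (auto simp: fun_eq_iff atanh_coeff_def log_coeff_def field_simps power_minus')
  finally have s: "(\<lambda>j. of_real (atanh_coeff j) * z ^ j) sums (Ln (1 + z) - Ln (1 + - z))" .
  then show "summable (\<lambda>j. of_real (atanh_coeff j) * z ^ j)" by (rule sums_summable)
  have "exp (Ln (1 + z)) = 1 + z" "exp (Ln (1 + - z)) = 1 - z"
    using exp_log_series(1)[OF assms] exp_log_series(2)[OF assms] exp_log_series(1)[OF z] exp_log_series(2)[OF z]
    by (simp_all add: sums_iff)
  then show "exp (\<Sum>j. of_real (atanh_coeff j) * z ^ j) = (1 + z) / (1 - z)"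
    using s by (simp add: sums_iff exp_diff)
qed

lemmas prod_tendsto_exp_lambert_atanh =
  prod_tendsto_exp_lambert[OF _ atanh_coeff_bounds(3,2) exp_atanh_series]

lemmas prod_tendsto_exp_lambert_log =
  prod_tendsto_exp_lambert[OF _ log_coeff_bounds(2,1) sums_summable[OF exp_log_series(1)] exp_log_series(2)]

text \<open>At the real point r = |z| the values \<open>g K r\<close> converge, hence are bounded;
  by nonnegativity they bound the partial sums of \<open>G\<close> at r. This gives the majorant
  with which Tannery's theorem applies at z.\<close>

lemma fps_sums_limit:
  assumes sums: "\<And>K z. norm z < 1 \<Longrightarrow> fps_sums (F K) z (g K z)"
    and lim: "\<And>z. norm z < 1 \<Longrightarrow> (\<lambda>K. g K z) \<longlonglongrightarrow> l z"
    and nonneg: "\<And>K n. fps_nth (F K) n \<ge> 0"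
    and le: "\<And>K n. fps_nth (F K) n \<le> fps_nth G n"
    and eq: "\<And>K n. n \<le> K \<Longrightarrow> fps_nth (F K) n = fps_nth G n"
    and z: "norm z < 1"
  shows "fps_sums G z (l z)"
proof -
  define r where "r = norm z"
  have r: "0 \<le> r" "r < 1" using z by (auto simp: r_def)
  have G0: "fps_nth G n \<ge> 0" for n using nonneg le order_trans by blast
  have "(\<lambda>K. norm (g K (of_real r))) \<longlonglongrightarrow> norm (l (of_real r))"
    by (intro tendsto_norm lim) (use r in auto)
  then have "Bseq (\<lambda>K. norm (g K (of_real r)))" by (intro convergent_imp_Bseq) (auto simp: convergent_def)
  then obtain B where B: "\<And>K. norm (g K (of_real r)) \<le> B" by (auto simp: Bseq_def)
  have summ: "summable (\<lambda>n. of_int (fps_nth G n) * r ^ n)"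
  proof (rule summableI_nonneg_bounded)
    fix M
    have s: "fps_sums (F M) (of_real r) (g M (of_real r))" by (rule sums) (use r in auto)
    have eq': "norm (of_int (fps_nth (F M) n) * (of_real r :: complex) ^ n) = of_int (fps_nth (F M) n) * r ^ n" for n
      using nonneg[of M n] r by (simp add: norm_mult norm_power)
    have s1: "summable (\<lambda>n. of_int (fps_nth (F M) n) * r ^ n)"
      using s unfolding fps_sums_def eq' by blast
    have "(\<lambda>n. complex_of_real (of_int (fps_nth (F M) n) * r ^ n)) sums of_real (\<Sum>n. of_int (fps_nth (F M) n) * r ^ n)"
      using s1 by (intro sums_of_real summable_sums)
    then have "g M (of_real r) = of_real (\<Sum>n. of_int (fps_nth (F M) n) * r ^ n)"
      using s by (auto simp: fps_sums_def sums_iff)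
    then have le_B: "(\<Sum>n. of_int (fps_nth (F M) n) * r ^ n) \<le> B"
      using B[of M] by simp
    have "(\<Sum>n<M. of_int (fps_nth G n) * r ^ n) = (\<Sum>n<M. of_int (fps_nth (F M) n) * r ^ n)"
      by (rule sum.cong) (auto simp: eq)
    also have "\<dots> \<le> (\<Sum>n. of_int (fps_nth (F M) n) * r ^ n)"
      by (rule sum_le_suminf[OF s1]) (use nonneg r in auto)
    finally show "(\<Sum>n<M. of_int (fps_nth G n) * r ^ n) \<le> B" using le_B by simp
  qed (use G0 r in auto)
  have norm_eq: "norm (of_int (fps_nth G n) * z ^ n) = of_int (fps_nth G n) * r ^ n" for n
    using G0[of n] by (simp add: norm_mult norm_power r_def)
  have "(\<lambda>K. \<Sum>n. of_int (fps_nth (F K) n) * z ^ n) \<longlonglongrightarrow> (\<Sum>n. of_int (fps_nth G n) * z ^ n)"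
  proof (rule tannerys_theorem[THEN conjunct2, THEN conjunct2, OF _ _ summ])
    show "(\<lambda>K. of_int (fps_nth (F K) n) * z ^ n) \<longlonglongrightarrow> of_int (fps_nth G n) * z ^ n" for n
      by (rule tendsto_eventually) (use eventually_ge_at_top[of n] in \<open>rule eventually_mono, simp add: eq\<close>)
    show "\<forall>\<^sub>F (n, K) in sequentially \<times>\<^sub>F sequentially. norm (of_int (fps_nth (F K) n) * z ^ n) \<le> of_int (fps_nth G n) * r ^ n"
    proof (intro always_eventually allI, safe)
      fix n K
      show "norm (of_int (fps_nth (F K) n) * z ^ n) \<le> of_int (fps_nth G n) * r ^ n"
        using nonneg[of K n] le[of K n] r by (auto simp: norm_mult norm_power r_def intro!: mult_right_mono)
    qed
  qed simp
  moreover have "(\<Sum>n. of_int (fps_nth (F K) n) * z ^ n) = g K z" for K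
    using sums[OF z, of K] by (simp add: fps_sums_def sums_iff)
  ultimately have "(\<Sum>n. of_int (fps_nth G n) * z ^ n) = l z"
    using lim[OF z] LIMSEQ_unique by auto
  then show ?thesis
    unfolding fps_sums_def norm_eq
    using summ summable_norm_cancel[of "\<lambda>n. of_int (fps_nth G n) * z ^ n"] by (simp add: norm_eq sums_iff)
qed

lemma fps_sums_overpartition_series:
  assumes "norm q < 1"
  shows "fps_sums overpartition_series q (exp (lambert atanh_coeff q))"
proof (rule fps_sums_limit[OF fps_sums_overpartition_prod prod_tendsto_exp_lambert_atanh(2) _ _ _ assms])
  show "0 \<le> fps_nth (overpartition_prod K) n" for K n
    using overpartition_prod_nonneg by (simp add: fps_nonneg_def)
  show "fps_nth (overpartition_prod K) n \<le> fps_nth overpartition_series n" for K n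
    using overpartition_prod_le_overpartition by (simp add: overpartition_def)
  show "fps_nth (overpartition_prod K) n = fps_nth overpartition_series n" if "n \<le> K" for K n
    using overpartition_eq[OF that] by (simp add: overpartition_def)
qed

lemma class_sum_1_pair_coeff: "class_sum 1 0 (pair_coeff N) = q_fact_plus N ^ 2"
proof (induction N)
  case 0
  have "class_sum 1 0 (pair_coeff 0) = (\<Sum>m | m \<in> {0} \<and> [m = 0] (mod 1). pair_coeff 0 m)"
    by (rule class_sum_eq) (auto split: if_splits)
  also have "\<dots> = 1" by (simp add: Collect_conv_if)
  finally show ?case by (simp only: q_fact_plus_def) simp
next
  case (Suc N)
  define x :: "int fps" where "x = fps_X ^ (N + 1)"
  have p: "fps_X ^ (2 * N + 2) = x ^ 2" 
    unfolding x_def power_mult[symmetric] by (rule arg_cong[of _ _ "(^) fps_X"]) simp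
  have "class_sum 1 0 (pair_coeff (Suc N)) = (1 + x ^ 2) * q_fact_plus N ^ 2 + x * (q_fact_plus N ^ 2 + q_fact_plus N ^ 2)"
    unfolding class_sum_pair_coeff_Suc p x_def[symmetric] class_sum_1[of "0 - 1"] class_sum_1[of "0 + 1"] Suc ..
  also have "\<dots> = (q_fact_plus N * (1 + x)) ^ 2"
    by (simp only: power2_eq_square algebra_simps mult_1_left)
  also have "q_fact_plus N * (1 + x) = q_fact_plus (Suc N)"
    by (simp add: q_fact_plus_def x_def)
  finally show ?case .
qed

text \<open>At w = 1 the numerator of R_N is the square of (-q;q)_N, and 1/(q;q^2) supplies the
  third factor by \<open>odd_den_cong\<close>.\<close>

lemma triple_coeff_eq_q_fact_plus:
  assumes "n \<le> K"
  shows "triple_coeff n = fps_nth (q_fact_plus K ^ 3) n"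
proof -
  have "fps_X ^ (K + 1) dvd odd_den (K + 1) * q_fact_plus (K + 1) ^ 2 - q_fact_plus K * q_fact_plus K ^ 2"
    unfolding power2_eq_square
  proof (intro dvd_diff_mult fact_cong)
    have "fps_X ^ (K + 1) dvd odd_den (K + 1) - q_fact_plus (K + 1)"
      by (rule dvd_trans[OF _ odd_den_cong]) (simp add: le_imp_power_dvd)
    then show "fps_X ^ (K + 1) dvd odd_den (K + 1) - q_fact_plus K"
      by (rule dvd_diff_trans) (rule fact_cong, simp)
  qed auto
  from fps_X_power_dvd_nth[OF this, of n] assms
  have "fps_nth (class_coeff 1 (K + 1) 0) n = fps_nth (q_fact_plus K ^ 3) n"
    by (simp add: class_coeff_def class_sum_1_pair_coeff power2_eq_square power3_eq_cube mult_ac)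
  then show ?thesis using triple_coeff_eq(1)[of n "K + 1" 0] assms by simp
qed

lemma fps_sums_triple_coeff:
  assumes "norm q < 1"
  shows "fps_sums (Abs_fps triple_coeff) q (exp (lambert log_coeff q) ^ 3)"
proof (rule fps_sums_limit[where F = "\<lambda>K. q_fact_plus K ^ 3" and g = "\<lambda>K z. (\<Prod>k<K. 1 + z ^ Suc k) ^ 3", OF _ _ _ _ _ assms])
  show "fps_sums (q_fact_plus K ^ 3) z ((\<Prod>k<K. 1 + z ^ Suc k) ^ 3)" for K z
  proof -
    have "fps_sums (q_fact_plus K) z (\<Prod>k<K. 1 + z ^ (k + 1))"
      unfolding q_fact_plus_def by (intro fps_sums_prod fps_sums_1_plus_X_power) simp
    then show ?thesis by (simp add: power3_eq_cube fps_sums_mult)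
  qed
  show "(\<lambda>K. (\<Prod>k<K. 1 + z ^ Suc k) ^ 3) \<longlonglongrightarrow> exp (lambert log_coeff z) ^ 3" if "norm z < 1" for z
    by (intro tendsto_power prod_tendsto_exp_lambert_log that)
  have nn: "fps_nonneg (q_fact_plus K)" for K
    unfolding q_fact_plus_def by (intro fps_nonneg_intros)
  then have nn3: "fps_nonneg (q_fact_plus K ^ 3)" for K
    by (simp add: power3_eq_cube fps_nonneg_mult)
  then show "0 \<le> fps_nth (q_fact_plus K ^ 3) n" for K n
    by (simp add: fps_nonneg_def)
  show eq: "fps_nth (q_fact_plus K ^ 3) n = fps_nth (Abs_fps triple_coeff) n" if "n \<le> K" for K n
    using triple_coeff_eq_q_fact_plus[OF that] by simp
  show "fps_nth (q_fact_plus K ^ 3) n \<le> fps_nth (Abs_fps triple_coeff) n" for K n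
  proof -
    have cube_step: "fps_nonneg (q_fact_plus (Suc L) ^ 3 - q_fact_plus L ^ 3)" for L
    proof -
      define x y where "x = q_fact_plus L" and "y = fps_X ^ (L + 1) * q_fact_plus L"
      have "q_fact_plus (Suc L) = x + y" by (simp add: q_fact_plus_def x_def y_def algebra_simps)
      then have "q_fact_plus (Suc L) ^ 3 - q_fact_plus L ^ 3 = (x + y) ^ 3 - x ^ 3" by (simp only: x_def)
      also have "\<dots> = y * (x * x + x * x + x * x + x * y + x * y + x * y + y * y)"
        by (simp only: power3_eq_cube) (simp only: algebra_simps add_diff_cancel_left' add_diff_cancel_right')
      also have "fps_nonneg \<dots>"
        unfolding x_def y_def by (intro fps_nonneg_intros nn)
      finally show ?thesis .
    qed
    have "fps_nth (q_fact_plus K ^ 3) n \<le> fps_nth (q_fact_plus L ^ 3) n" if "K \<le> L" for L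
      using that
    proof (induction L rule: dec_induct)
      case (step M)
      have "0 \<le> fps_nth (q_fact_plus (Suc M) ^ 3 - q_fact_plus M ^ 3) n"
        using cube_step[of M] unfolding fps_nonneg_def by blast
      then show ?case using step.IH by (simp only: fps_sub_nth)
    qed simp
    from this[of "max K n"] eq[of n "max K n"] show ?thesis by simp
  qed
qed

subsection \<open>The generating function of overpartitions off the real axis\<close>

lemma inverse_squares_sums': "(\<lambda>n. 1 / (real n + 1)\<^sup>2) sums (pi\<^sup>2 / 6)"
  using inverse_squares_sums by (simp add: add.commute)

lemma inverse_even_squares_sums:
  "(\<lambda>n. if odd n then 2 / (real n + 1)\<^sup>2 else 0) sums (1 / 2 * (pi\<^sup>2 / 6))"
proof -
  have "(\<lambda>n. 1 / 2 * (1 / (real n + 1)\<^sup>2)) sums (1 / 2 * (pi\<^sup>2 / 6))"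
    by (rule sums_mult[OF inverse_squares_sums'])
  also have "(\<lambda>n. 1 / 2 * (1 / (real n + 1)\<^sup>2)) = (\<lambda>n. (\<lambda>n. if odd n then 2 / (real n + 1)\<^sup>2 else 0) (2 * n + 1))"
  proof
    fix n
    have "real (2 * n + 1) + 1 = 2 * (real n + 1)" by simp
    then show "1 / 2 * (1 / (real n + 1)\<^sup>2) = (if odd (2 * n + 1) then 2 / (real (2 * n + 1) + 1)\<^sup>2 else 0)"
      by (simp only: power_mult_distrib) simp
  qed
  finally show ?thesis
  proof (subst (asm) sums_mono_reindex)
    show "(if odd n then 2 / (real n + 1)\<^sup>2 else 0) = 0" if "n \<notin> range (\<lambda>n. 2 * n + 1)" for n
      using that by (metis oddE rangeI)
  qed (auto simp: strict_mono_def)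
qed

text \<open>Twice zeta(2) minus its even part: pi^2/3 - pi^2/12. This number, called A below, fixes
  the growth rate, since 2 sqrt (A n) = pi sqrt n.\<close>

lemma atanh_coeff_sums: "(\<lambda>j. atanh_coeff j / real j) sums (pi\<^sup>2 / 4)"
proof -
  have 1: "(\<lambda>n. 2 / (real n + 1)\<^sup>2) sums (2 * (pi\<^sup>2 / 6))"
    using sums_mult[OF inverse_squares_sums', of 2] by simp
  have "(\<lambda>n. atanh_coeff (Suc n) / real (Suc n)) sums (2 * (pi\<^sup>2 / 6) - 1 / 2 * (pi\<^sup>2 / 6))"
    using sums_diff[OF 1 inverse_even_squares_sums]
    by (rule sums_cong[THEN iffD1, rotated]) (auto simp: atanh_coeff_def power2_eq_square add.commute)
  then show ?thesis by (subst (asm) sums_Suc_iff) (simp add: atanh_coeff_bounds)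
qed

lemma Re_power_quotient_le:
  fixes q :: complex
  assumes "norm q < 1" "j > 0"
  shows "Re (q ^ j / (1 - q ^ j)) \<le> norm q ^ j / (1 - norm q ^ j)"
proof -
  have r: "norm q ^ j < 1" using assms by (simp add: power_less_one_iff)
  have "Re (q ^ j / (1 - q ^ j)) \<le> norm (q ^ j / (1 - q ^ j))" by (rule complex_Re_le_cmod)
  also have "\<dots> = norm q ^ j / norm (1 - q ^ j)" by (simp add: norm_divide norm_power)
  also have "\<dots> \<le> norm q ^ j / (1 - norm q ^ j)"
    using norm_triangle_ineq2[of 1 "q ^ j"] r by (intro divide_left_mono) (auto simp: norm_power intro!: mult_pos_pos)
  finally show ?thesis .
qed

text \<open>The coefficients are nonnegative, and the real part of each term is largest at the real
  point of equal modulus. Keeping only the loss in the term j = 1, whose coefficient is 2, already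
  suffices on the whole circle.\<close>

lemma Re_lambert_atanh_le:
  assumes "norm q < 1"
  shows "Re (lambert atanh_coeff q) \<le> Re (lambert atanh_coeff (of_real (norm q))) - 2 * (norm q / (1 - norm q) - Re (q / (1 - q)))"
proof -
  define r where "r = norm q"
  have r: "norm (complex_of_real r) < 1" "r < 1" using assms by (auto simp: r_def)
  let ?D = "\<lambda>j. Re (of_real (atanh_coeff j) * (of_real r ^ j / (1 - of_real r ^ j))) - Re (of_real (atanh_coeff j) * (q ^ j / (1 - q ^ j)))"
  have "?D sums (Re (lambert atanh_coeff (of_real r)) - Re (lambert atanh_coeff q))"
    unfolding lambert_def
    by (intro sums_diff sums_Re summable_sums summable_norm_cancel[OF prod_tendsto_exp_lambert_atanh(1)] assms r)
  moreover have D: "?D j = atanh_coeff j * (r ^ j / (1 - r ^ j) - Re (q ^ j / (1 - q ^ j)))" for j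
  proof -
    have "complex_of_real r ^ j / (1 - of_real r ^ j) = of_real (r ^ j / (1 - r ^ j))" by simp
    then show ?thesis by (simp only: Re_complex_of_real times_complex.sel Im_complex_of_real) (simp add: algebra_simps)
  qed
  moreover have "?D j \<ge> 0" for j
    unfolding D using Re_power_quotient_le[OF assms, of j] atanh_coeff_bounds(1)[of j]
    by (cases "j = 0") (auto simp: atanh_coeff_bounds(3) r_def intro!: mult_nonneg_nonneg)
  ultimately have "?D 1 \<le> Re (lambert atanh_coeff (of_real r)) - Re (lambert atanh_coeff q)"
    using sum_le_suminf[of ?D "{1}"] by (simp only: sums_iff) auto
  then show ?thesis unfolding D by (simp add: atanh_coeff_def r_def)
qed

section \<open>A bound for P on the whole circle\<close>

lemma sin_ge_half:
  assumes "0 \<le> x" "x \<le> pi / 2"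
  shows "x / 2 \<le> sin x"
proof (cases "x \<le> pi / 3")
  case True
  have "(\<lambda>x. sin x - x / 2) 0 \<le> (\<lambda>x. sin x - x / 2) x"
  proof (rule DERIV_nonneg_imp_nondecreasing[OF assms(1)])
    fix y assume y: "0 \<le> y" "y \<le> x"
    have "cos (pi / 3) \<le> cos y" by (rule cos_monotone_0_pi_le) (use y True pi_gt_zero in linarith)+
    then show "\<exists>d. ((\<lambda>x. sin x - x / 2) has_real_derivative d) (at y) \<and> 0 \<le> d"
      by (intro exI[of _ "cos y - 1 / 2"]) (auto intro!: derivative_eq_intros simp: cos_60)
  qed
  then show ?thesis by simp
next
  case False
  have "x / 2 \<le> pi / 4" using assms by simp
  \<comment> \<open>A rational number between pi/4 and sqrt 3 / 2.\<close>
  also have "\<dots> \<le> 4 / 5" using pi_less_4 pi_approx by simp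
  also have "\<dots> \<le> sqrt 3 / 2"
    using real_le_rsqrt[of "8/5" 3] by (simp add: power2_eq_square)
  also have "\<dots> = sin (pi / 3)" by (simp add: sin_60)
  also have "\<dots> \<le> sin x" by (rule sin_monotone_2pi_le) (use assms False pi_gt_zero in linarith)+
  finally show ?thesis .
qed

lemma one_minus_cos_ge:
  assumes "\<bar>\<theta>\<bar> \<le> pi"
  shows "\<theta>\<^sup>2 / 8 \<le> 1 - cos \<theta>"
proof -
  have "(\<bar>\<theta>\<bar> / 2) / 2 \<le> sin (\<bar>\<theta>\<bar> / 2)" by (rule sin_ge_half) (use assms in auto)
  then have "((\<bar>\<theta>\<bar> / 2) / 2)\<^sup>2 \<le> (sin (\<bar>\<theta>\<bar> / 2))\<^sup>2" by (rule power_mono) simp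
  moreover have "cos \<theta> = cos (2 * (\<bar>\<theta>\<bar> / 2))" by simp
  ultimately show ?thesis by (simp only: cos_double_sin) (simp add: power_divide)
qed

text \<open>With c = 1 - cos theta the saving is exactly r (1+r) c / ((1-r) |1-q|^2), where |1-q|^2
  = (1-r)^2 + 2 r c. The estimate then follows from 1 - r <= t, r >= 1/2 and c >= theta^2 /
  8.\<close>

lemma minor_arc_saving:
  assumes t: "0 < t" "t \<le> 1 / 2" and th: "\<bar>\<theta>\<bar> \<le> pi"
  defines "r \<equiv> exp (- t)" and "q \<equiv> exp (- Complex t \<theta>)"
  shows "\<theta>\<^sup>2 / (16 * t * (t\<^sup>2 + \<theta>\<^sup>2)) \<le> r / (1 - r) - Re (q / (1 - q))"
proof -
  have r: "0 < r" "r < 1" "1 - r \<le> t" "1 / 2 \<le> r"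
    using t exp_ge_add_one_self[of "- t"] by (auto simp: r_def)
  define c where "c = 1 - cos \<theta>"
  have c: "c \<ge> \<theta>\<^sup>2 / 8" "c \<ge> 0" using one_minus_cos_ge[OF th] by (auto simp: c_def)
  have q: "q = Complex (r * cos \<theta>) (- r * sin \<theta>)"
    by (simp add: q_def r_def complex_eq_iff Re_exp Im_exp)
  have n: "(1 - r * cos \<theta>)\<^sup>2 + (r * sin \<theta>)\<^sup>2 = (1 - r)\<^sup>2 + 2 * r * c"
  proof -
    have "(1 - r * cos \<theta>)\<^sup>2 + (r * sin \<theta>)\<^sup>2 = 1 - 2 * r * cos \<theta> + r\<^sup>2 * ((sin \<theta>)\<^sup>2 + (cos \<theta>)\<^sup>2)"
      by (simp add: power2_eq_square algebra_simps del: sin_cos_squared_add sin_cos_squared_add2 sin_cos_squared_add3)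
    also have "\<dots> = (1 - r)\<^sup>2 + 2 * r * c"
      unfolding sin_cos_squared_add by (simp add: c_def power2_eq_square algebra_simps)
    finally show ?thesis .
  qed
  have pos: "(1 - r)\<^sup>2 + 2 * r * c > 0" using r c by (intro add_pos_nonneg) auto
  have "Re (q / (1 - q)) = Re ((1 / (1 - q)) - 1)"
  proof -
    have "q \<noteq> 1" using pos n by (auto simp: q complex_eq_iff)
    then have "q / (1 - q) = 1 / (1 - q) - 1" by (simp add: field_simps)
    then show ?thesis by simp
  qed
  also have "\<dots> = (1 - r * cos \<theta>) / ((1 - r)\<^sup>2 + 2 * r * c) - 1"
    by (simp add: Re_divide q n)
  finally have "r / (1 - r) - Re (q / (1 - q)) = 1 / (1 - r) - (1 - r * cos \<theta>) / ((1 - r)\<^sup>2 + 2 * r * c)"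
  proof -
    assume *: "Re (q / (1 - q)) = (1 - r * cos \<theta>) / ((1 - r)\<^sup>2 + 2 * r * c) - 1"
    have "r / (1 - r) = 1 / (1 - r) - 1" using r by (simp add: field_simps)
    then show ?thesis using * by simp
  qed
  also have "\<dots> = (((1 - r)\<^sup>2 + 2 * r * c) - (1 - r) * (1 - r * (1 - c))) / ((1 - r) * ((1 - r)\<^sup>2 + 2 * r * c))"
    using r pos by (subst diff_frac_eq) (auto simp: c_def mult.commute)
  also have "((1 - r)\<^sup>2 + 2 * r * c) - (1 - r) * (1 - r * (1 - c)) = r * (1 + r) * c"
    by (simp add: power2_eq_square algebra_simps)
  finally have eq: "r / (1 - r) - Re (q / (1 - q)) = r * (1 + r) * c / ((1 - r) * ((1 - r)\<^sup>2 + 2 * r * c))" .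
  have "(1 - r) * ((1 - r)\<^sup>2 + 2 * r * c) \<le> t * (t\<^sup>2 + 2 * c)"
    using r c t by (intro mult_mono add_mono power_mono) (auto intro!: mult_left_le_one_le)
  then have "r * (1 + r) * c / (t * (t\<^sup>2 + 2 * c)) \<le> r / (1 - r) - Re (q / (1 - q))"
    unfolding eq using r c pos t by (intro divide_left_mono) (auto intro!: mult_pos_pos add_pos_nonneg)
  moreover have "1 / 2 * c \<le> r * (1 + r) * c"
    using r c mult_mono[of "1/2" r 1 "1 + r"] by (intro mult_right_mono) auto
  then have "1 / 2 * c / (t * (t\<^sup>2 + 2 * c)) \<le> r * (1 + r) * c / (t * (t\<^sup>2 + 2 * c))"
    using t c by (intro divide_right_mono) auto
  moreover have "\<theta>\<^sup>2 / (16 * t * (t\<^sup>2 + \<theta>\<^sup>2)) \<le> 1 / 2 * c / (t * (t\<^sup>2 + 2 * c))"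
  proof -
    have p: "t\<^sup>2 + \<theta>\<^sup>2 > 0" "t\<^sup>2 + 2 * c > 0" using t c by (auto intro: add_pos_nonneg)
    have "\<theta>\<^sup>2 * (t\<^sup>2 + 2 * c) \<le> 8 * c * (t\<^sup>2 + \<theta>\<^sup>2)"
    proof -
      have "\<theta>\<^sup>2 * t\<^sup>2 \<le> 8 * c * t\<^sup>2" using c by (intro mult_right_mono) auto
      moreover have "\<theta>\<^sup>2 * (2 * c) \<le> 8 * c * \<theta>\<^sup>2" using c by (simp add: mult.commute mult_right_mono)
      ultimately show ?thesis by (simp add: algebra_simps)
    qed
    then have "\<theta>\<^sup>2 / (t\<^sup>2 + \<theta>\<^sup>2) \<le> 8 * c / (t\<^sup>2 + 2 * c)"
      using p by (simp add: divide_simps)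
    then have "\<theta>\<^sup>2 / (t\<^sup>2 + \<theta>\<^sup>2) / (16 * t) \<le> 8 * c / (t\<^sup>2 + 2 * c) / (16 * t)"
      using t by (intro divide_right_mono) auto
    moreover have "\<theta>\<^sup>2 / (16 * t * (t\<^sup>2 + \<theta>\<^sup>2)) = \<theta>\<^sup>2 / (t\<^sup>2 + \<theta>\<^sup>2) / (16 * t)"
      by (simp add: mult.commute)
    moreover have "8 * c / (t\<^sup>2 + 2 * c) / (16 * t) = 1 / 2 * c / (t * (t\<^sup>2 + 2 * c))"
      using p t by simp
    ultimately show ?thesis by (simp only:)
  qed
  ultimately show ?thesis by linarith
qed

lemma minor_arc_bound:
  assumes t: "0 < t" "t \<le> 1 / 2" and th: "\<bar>\<theta>\<bar> \<le> pi"
  shows "norm (exp (lambert atanh_coeff (exp (- Complex t \<theta>))))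
     \<le> exp (Re (lambert atanh_coeff (of_real (exp (- t))))) * exp (- (\<theta>\<^sup>2 / (8 * t * (t\<^sup>2 + \<theta>\<^sup>2))))"
proof -
  have n: "norm (exp (- Complex t \<theta>)) = exp (- t)" by simp
  then have "Re (lambert atanh_coeff (exp (- Complex t \<theta>))) \<le> Re (lambert atanh_coeff (of_real (exp (- t))))
      - 2 * (exp (- t) / (1 - exp (- t)) - Re (exp (- Complex t \<theta>) / (1 - exp (- Complex t \<theta>))))"
    using Re_lambert_atanh_le[of "exp (- Complex t \<theta>)"] t unfolding n by simp
  also have "\<dots> \<le> Re (lambert atanh_coeff (of_real (exp (- t)))) - 2 * (\<theta>\<^sup>2 / (16 * t * (t\<^sup>2 + \<theta>\<^sup>2)))"
    using minor_arc_saving[OF assms] by (intro diff_left_mono mult_left_mono) auto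
  also have "2 * (\<theta>\<^sup>2 / (16 * t * (t\<^sup>2 + \<theta>\<^sup>2))) = \<theta>\<^sup>2 / (8 * t * (t\<^sup>2 + \<theta>\<^sup>2))"
    by simp
  finally show ?thesis by (simp flip: exp_add)
qed

text \<open>Removing the pole at 0 isolates the main term A/z of the Lambert series, as the poles
  1/(jz) add up to it.\<close>

definition bernoulli_rem :: "complex \<Rightarrow> complex" where
  "bernoulli_rem w = 1 / (exp w - 1) - 1 / w"

lemma exp_neq_1:
  assumes "Re w > 0"
  shows "exp w \<noteq> (1::complex)"
proof
  assume "exp w = 1"
  then have "norm (exp w) = 1" by simp
  then show False using assms by simp
qed

lemma bernoulli_rem_deriv:
  assumes "Re w > 0"
  shows "(bernoulli_rem has_field_derivative (1 / w\<^sup>2 - exp w / (exp w - 1)\<^sup>2)) (at w within S)"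
proof -
  have "w \<noteq> 0" using assms by auto
  then show ?thesis
    unfolding bernoulli_rem_def[abs_def] using exp_neq_1[OF assms]
    by (auto intro!: derivative_eq_intros simp: power2_eq_square)
qed

text \<open>
  Any exponent strictly between \<open>-3/2\<close> and \<open>-1\<close> would do: below \<open>-1\<close> it makes the sum over \<open>j\<close>
  in \<open>lambert_atanh_local\<close> converge, and above \<open>-3/2\<close> it makes the resulting error vanish on the
  Gaussian scale \<open>\<bar>\<theta>\<bar> \<sim> t\<^sup>3\<^sup>/\<^sup>2\<close>.
\<close>

lemma bernoulli_rem_deriv_bound:
  assumes x: "Re w > 0" "\<bar>Im w\<bar> \<le> Re w"
  shows "norm (1 / w\<^sup>2 - exp w / (exp w - 1)\<^sup>2) \<le> 4 * Re w powr (- 5 / 4)"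
proof -
  define x where "x = Re w"
  \<comment> \<open>\<open>S\<close> is 2 sinh (w/2), and e^w / (e^w - 1)^2 = 1/S^2.\<close>
  define S where "S = exp (w / 2) - exp (- (w / 2))"
  have x0: "x > 0" using x by (simp add: x_def)
  have w0: "w \<noteq> 0" using x by auto
  have "exp w - 1 = exp (w / 2) * S" "exp w = exp (w / 2) * exp (w / 2)"
    by (simp_all add: S_def algebra_simps flip: exp_add)
  then have "exp w / (exp w - 1)\<^sup>2 = 1 / S\<^sup>2"
    by (simp add: power2_eq_square)
  then have e: "1 / w\<^sup>2 - exp w / (exp w - 1)\<^sup>2 = 1 / w\<^sup>2 - 1 / S\<^sup>2" by simp
  have "x \<le> exp (x / 2) - exp (- (x / 2))"
  proof -
    define f :: "real \<Rightarrow> real" where "f = (\<lambda>x. exp (x / 2) - exp (- (x / 2)) - x)"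
    have "f 0 \<le> f x"
    proof (rule DERIV_nonneg_imp_nondecreasing[where f = f])
      fix y :: real
      have "0 \<le> (exp (y / 4) - exp (- (y / 4)))\<^sup>2" by simp
      also have "\<dots> = exp (y / 2) + exp (- (y / 2)) - 2"
        by (simp add: power2_eq_square algebra_simps flip: exp_add)
      finally show "\<exists>d. (f has_real_derivative d) (at y) \<and> 0 \<le> d"
        unfolding f_def
        by (intro exI[of _ "exp (y / 2) * (1 / 2) + exp (- (y / 2)) * (1 / 2) - 1"])
           (auto intro!: derivative_eq_intros)
    qed (use x0 in simp)
    then show ?thesis by (simp add: f_def)
  qed
  also have "\<dots> = norm (exp (w / 2)) - norm (exp (- (w / 2)))" by (simp add: x_def)
  also have "\<dots> \<le> norm S" unfolding S_def by (rule norm_triangle_ineq2)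
  finally have S: "x \<le> norm S" .
  then have S0: "S \<noteq> 0" using x0 by auto
  have wx: "x \<le> norm w" using complex_Re_le_cmod[of w] by (simp add: x_def)
  \<comment> \<open>Away from 0 each of 1/w^2 and 1/S^2 is at most 1/x^2. Near 0 they nearly cancel:
    S - w is O(w^3), so the difference stays bounded.\<close>
  show ?thesis
  proof (cases "x \<le> 1 / 2")
    case False
    have "norm (1 / w\<^sup>2 - 1 / S\<^sup>2) \<le> norm (1 / w\<^sup>2) + norm (1 / S\<^sup>2)" by (rule norm_triangle_ineq4)
    also have "\<dots> = 1 / norm w ^ 2 + 1 / norm S ^ 2" by (simp add: norm_divide norm_power)
    also have "\<dots> \<le> 1 / x ^ 2 + 1 / x ^ 2"
      using wx S x0 w0 S0 by (intro add_mono divide_left_mono power_mono) auto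
    also have "\<dots> = 2 * x powr (- 3 / 4) * x powr (- 5 / 4)"
      using x0 by (simp add: powr_minus_divide powr_numeral flip: powr_add)
    also have "\<dots> \<le> 2 * 2 * x powr (- 5 / 4)"
    proof (intro mult_right_mono mult_left_mono)
      have "x powr (- 3 / 4) \<le> (1 / 2) powr (- 3 / 4)" using False by (intro powr_mono2') auto
      also have "\<dots> = 2 powr (3 / 4)" by (simp add: powr_minus_divide powr_divide)
      also have "\<dots> \<le> 2 powr 1" by (intro powr_mono) auto
      finally show "x powr (- 3 / 4) \<le> 2" by simp
    qed auto
    finally show ?thesis unfolding e x_def by simp
  next
    case True
    have "norm w ^ 2 \<le> x ^ 2 + x ^ 2"
      unfolding cmod_power2 x_def using power_mono[of "\<bar>Im w\<bar>" "Re w" 2] x by simp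
    then have wle: "norm w ^ 2 \<le> 2 * x ^ 2" by simp
    have "x ^ 2 \<le> (1 / 2) ^ 2" using True x0 by (intro power_mono) auto
    then have "norm w ^ 2 \<le> 1 ^ 2" using wle by (simp add: power2_eq_square)
    then have w1: "norm w \<le> 1" by (rule power2_le_imp_le) simp
    define v where "v = w / 2"
    have T: "norm (exp u - (1 + u + u\<^sup>2 / 2)) \<le> 3 / 2 * norm v ^ 3" if "u = v \<or> u = - v" for u
    proof -
      have "norm u = norm v" "\<bar>Re u\<bar> = \<bar>Re v\<bar>" using that by auto
      moreover have "\<bar>Re v\<bar> \<le> 1" using abs_Re_le_cmod[of v] w1 by (simp add: v_def)
      then have "exp \<bar>Re v\<bar> \<le> exp 1" by simp
      then have "exp \<bar>Re v\<bar> \<le> 3" using exp_le by linarith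
      moreover have "norm (exp u - (\<Sum>i\<le>2. u ^ i / fact i)) \<le> exp \<bar>Re u\<bar> * norm u ^ Suc 2 / fact 2"
        by (rule Taylor_exp)
      moreover have "(\<Sum>i\<le>2. u ^ i / fact i) = 1 + u + u\<^sup>2 / 2"
        by (simp add: eval_nat_numeral)
      ultimately have "norm (exp u - (1 + u + u\<^sup>2 / 2)) \<le> exp \<bar>Re v\<bar> * norm v ^ 3 / 2"
        by (simp add: numeral_3_eq_3 numeral_2_eq_2)
      also have "\<dots> \<le> 3 * norm v ^ 3 / 2"
        using \<open>exp \<bar>Re v\<bar> \<le> 3\<close> by (intro divide_right_mono mult_right_mono) auto
      finally show ?thesis by simp
    qed
    have "S - w = (exp v - (1 + v + v\<^sup>2 / 2)) - (exp (- v) - (1 + (- v) + (- v)\<^sup>2 / 2))"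
      by (simp add: S_def v_def field_simps)
    also have "norm \<dots> \<le> 3 / 2 * norm v ^ 3 + 3 / 2 * norm v ^ 3"
      by (rule order_trans[OF norm_triangle_ineq4 add_mono[OF T T]]) auto
    finally have d1: "norm (S - w) \<le> 3 / 8 * norm w ^ 3"
      by (simp add: v_def norm_divide power_divide)
    have "norm w ^ 3 \<le> norm w ^ 1" by (rule power_decreasing) (use w1 in auto)
    moreover have "norm (S + w) \<le> norm (S - w) + 2 * norm w"
      using norm_triangle_ineq[of "S - w" "2 * w"] by (simp add: norm_mult add.commute)
    ultimately have "norm (S + w) \<le> 3 * norm w"
      using d1 norm_ge_zero[of w] unfolding power_one_right by linarith
    then have num: "norm (S - w) * norm (S + w) \<le> 3 / 8 * norm w ^ 3 * (3 * norm w)"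
      using d1 by (intro mult_mono) auto
    have "norm w ^ 2 / 2 \<le> norm S ^ 2"
    proof -
      have "x ^ 2 \<le> norm S ^ 2" using S x0 by (intro power_mono) auto
      then show ?thesis using wle by linarith
    qed
    then have den: "norm w ^ 2 * (norm w ^ 2 / 2) \<le> norm w ^ 2 * norm S ^ 2" by (intro mult_left_mono) auto
    have "1 / w\<^sup>2 - 1 / S\<^sup>2 = (S - w) * (S + w) / (w\<^sup>2 * S\<^sup>2)"
      using w0 S0 by (simp add: field_simps power2_eq_square)
    then have "norm (1 / w\<^sup>2 - 1 / S\<^sup>2) = norm (S - w) * norm (S + w) / (norm w ^ 2 * norm S ^ 2)"
      by (simp add: norm_mult norm_divide norm_power)
    also have "\<dots> \<le> (3 / 8 * norm w ^ 3 * (3 * norm w)) / (norm w ^ 2 * (norm w ^ 2 / 2))"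
      using num den w0 by (intro frac_le) auto
    also have "\<dots> = 9 / 4" using w0 by (simp add: field_simps eval_nat_numeral)
    also have "\<dots> \<le> 4 * x powr (- 5 / 4)"
      using powr_mono2'[of "- 5 / 4" x 1] x0 True by simp
    finally show ?thesis unfolding e x_def by simp
  qed
qed

lemma bernoulli_rem_lipschitz:
  assumes "x > 0" "\<bar>y\<bar> \<le> x"
  shows "norm (bernoulli_rem (Complex x y) - bernoulli_rem (of_real x)) \<le> 4 * x powr (- 5 / 4) * \<bar>y\<bar>"
proof -
  let ?S = "closed_segment (complex_of_real x) (Complex x y)"
  have S: "Re w = x \<and> \<bar>Im w\<bar> \<le> x" if "w \<in> ?S" for w
  proof -
    obtain u where u: "0 \<le> u" "u \<le> 1" "w = (1 - u) *\<^sub>R complex_of_real x + u *\<^sub>R Complex x y"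
      using \<open>w \<in> ?S\<close> by (auto simp: in_segment)
    have "\<bar>u * y\<bar> \<le> 1 * x" unfolding abs_mult using u assms by (intro mult_mono) auto
    moreover have "Re w = (1 - u) * x + u * x" "Im w = u * y" using u(3) by simp_all
    ultimately show ?thesis by (simp add: algebra_simps)
  qed
  have "norm (bernoulli_rem (Complex x y) - bernoulli_rem (of_real x)) \<le> (4 * x powr (- 5 / 4)) * norm (Complex x y - of_real x)"
  proof (rule field_differentiable_bound[of ?S])
    fix w assume w: "w \<in> ?S"
    show "(bernoulli_rem has_field_derivative (1 / w\<^sup>2 - exp w / (exp w - 1)\<^sup>2)) (at w within ?S)"
      by (rule bernoulli_rem_deriv) (use S[OF w] assms in simp)
    show "norm (1 / w\<^sup>2 - exp w / (exp w - 1)\<^sup>2) \<le> 4 * x powr (- 5 / 4)"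
      using bernoulli_rem_deriv_bound[of w] S[OF w] assms by simp
  qed auto
  also have "norm (Complex x y - of_real x) = \<bar>y\<bar>"
    by (simp add: cmod_def)
  finally show ?thesis .
qed

text \<open>Each value of the series separately diverges logarithmically beyond its main term as t
  tends to 0; the difference from the real point does not. The coefficient 2/j cancels the j in the
  displacement j theta, and the factor (jt)^(-5/4) from the derivative bound makes the sum over j
  converge.\<close>

lemma lambert_atanh_local:
  assumes t: "0 < t" and th: "\<bar>\<theta>\<bar> \<le> t"
  shows "norm (lambert atanh_coeff (exp (- Complex t \<theta>)) - lambert atanh_coeff (of_real (exp (- t)))
       - (of_real (pi\<^sup>2 / 4) / Complex t \<theta> - of_real (pi\<^sup>2 / 4) / of_real t))
     \<le> 8 * (\<Sum>j. real j powr (- 5 / 4)) * \<bar>\<theta>\<bar> * t powr (- 5 / 4)"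
proof -
  let ?L = "lambert atanh_coeff" and ?A = "complex_of_real (pi\<^sup>2 / 4)"
  define z where "z = Complex t \<theta>"
  let ?a = "\<lambda>j. complex_of_real (atanh_coeff j)"
  have frac: "?a j * (exp (- u) ^ j / (1 - exp (- u) ^ j)) = ?a j / of_nat j * (1 / u) + ?a j * bernoulli_rem (of_nat j * u)"
    if u: "Re u > 0" for u j
  proof (cases "j = 0")
    case False
    define E where "E = exp (of_nat j * u)"
    have E: "E \<noteq> 1" "E \<noteq> 0" using exp_neq_1[of "of_nat j * u"] u False by (simp_all add: E_def)
    have "exp (- u) ^ j = 1 / E"
      by (simp add: E_def exp_minus exp_of_nat_mult power_inverse divide_inverse)
    then have "exp (- u) ^ j / (1 - exp (- u) ^ j) = (1 / E) / (1 - 1 / E)" by simp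
    also have "\<dots> = 1 / (E - 1)" using E by (simp add: field_simps)
    finally have "exp (- u) ^ j / (1 - exp (- u) ^ j) = 1 / (exp (of_nat j * u) - 1)"
      by (simp only: E_def)
    moreover have "u \<noteq> 0" using u by auto
    ultimately show ?thesis using False by (simp add: bernoulli_rem_def right_diff_distrib)
  qed (simp add: atanh_coeff_bounds)
  have s1: "(\<lambda>j. ?a j / of_nat j * (1 / u)) sums (?A * (1 / u))" for u :: complex
  proof -
    have "(\<lambda>j. complex_of_real (atanh_coeff j / real j)) sums of_real (pi\<^sup>2 / 4)"
      by (rule sums_of_real[OF atanh_coeff_sums])
    then show ?thesis by (intro sums_mult2) simp
  qed
  have sL: "(\<lambda>j. ?a j * (exp (- u) ^ j / (1 - exp (- u) ^ j))) sums ?L (exp (- u))" if "Re u > 0" for u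
    unfolding lambert_def
    by (intro summable_sums summable_norm_cancel[OF prod_tendsto_exp_lambert_atanh(1)]) (use that in simp)
  have s2: "(\<lambda>j. ?a j * bernoulli_rem (of_nat j * u)) sums (?L (exp (- u)) - ?A * (1 / u))"
    if "Re u > 0" for u
    using sums_diff[OF sL[OF that] s1[of u]] unfolding frac[OF that] by simp
  have ze: "exp (- complex_of_real t) = of_real (exp (- t))" by (simp flip: exp_of_real)
  have "(\<lambda>j. ?a j * bernoulli_rem (of_nat j * z) - ?a j * bernoulli_rem (of_nat j * of_real t)) sums
      ((?L (exp (- z)) - ?A * (1 / z)) - (?L (exp (- of_real t)) - ?A * (1 / of_real t)))"
    by (intro sums_diff s2) (use t in \<open>auto simp: z_def\<close>)
  also have "(?L (exp (- z)) - ?A * (1 / z)) - (?L (exp (- of_real t)) - ?A * (1 / of_real t))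
     = ?L (exp (- z)) - ?L (of_real (exp (- t))) - (?A / z - ?A / of_real t)"
    by (simp only: ze) (simp add: algebra_simps)
  finally have D: "(\<lambda>j. ?a j * bernoulli_rem (of_nat j * z) - ?a j * bernoulli_rem (of_nat j * of_real t)) sums
     (?L (exp (- z)) - ?L (of_real (exp (- t))) - (?A / z - ?A / of_real t))"
    (is "?d sums ?D") .
  have bound: "norm (?d j) \<le> 8 * \<bar>\<theta>\<bar> * t powr (- 5 / 4) * real j powr (- 5 / 4)" for j
  proof (cases "j = 0")
    case False
    have jt: "of_nat j * z = Complex (real j * t) (real j * \<theta>)" "of_nat j * complex_of_real t = of_real (real j * t)"
      by (simp_all add: z_def complex_eq_iff)
    have "norm (?d j) = atanh_coeff j * norm (bernoulli_rem (of_nat j * z) - bernoulli_rem (of_nat j * of_real t))"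
      using atanh_coeff_bounds(1)[of j] by (simp add: norm_mult flip: right_diff_distrib)
    also have "\<dots> \<le> (2 / real j) * (4 * (real j * t) powr (- 5 / 4) * \<bar>real j * \<theta>\<bar>)"
      unfolding jt using t th False
      by (intro mult_mono bernoulli_rem_lipschitz) (auto simp: abs_mult atanh_coeff_def)
    also have "\<dots> = 8 * \<bar>\<theta>\<bar> * t powr (- 5 / 4) * real j powr (- 5 / 4)"
      using False t by (simp add: powr_mult abs_mult)
    finally show ?thesis .
  qed (simp add: atanh_coeff_bounds)
  have summ: "summable (\<lambda>j. 8 * \<bar>\<theta>\<bar> * t powr (- 5 / 4) * real j powr (- 5 / 4))"
    by (intro summable_mult) (simp add: summable_real_powr_iff)
  have "norm ?D \<le> (\<Sum>j. 8 * \<bar>\<theta>\<bar> * t powr (- 5 / 4) * real j powr (- 5 / 4))"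
    using norm_suminf_le[OF bound summ] D by (simp add: sums_iff)
  also have "\<dots> = 8 * \<bar>\<theta>\<bar> * t powr (- 5 / 4) * (\<Sum>j. real j powr (- 5 / 4))"
    by (rule suminf_mult) (simp add: summable_real_powr_iff)
  finally show ?thesis by (simp add: z_def mult_ac)
qed

subsection \<open>Behaviour near the singularity\<close>

lemma gaussian_integral:
  assumes "k > 0"
  shows "has_bochner_integral lborel (\<lambda>x::real. exp (- k * x\<^sup>2)) (sqrt (pi / k))"
    and "has_bochner_integral lborel (\<lambda>x::real. indicator {0..} x * exp (- k * x\<^sup>2)) (sqrt (pi / k) / 2)"
proof -
  have s: "sqrt k \<noteq> 0" "sqrt k > 0" using assms by auto
  have full: "has_bochner_integral lborel (\<lambda>x::real. exp (- x\<^sup>2)) (sqrt pi)"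
  proof -
    have "has_bochner_integral lborel (\<lambda>x::real. exp (- x\<^sup>2)) (2 *\<^sub>R (sqrt pi / 2))"
      by (rule has_bochner_integral_even_function[OF gaussian_moment_0]) simp
    then show ?thesis by simp
  qed
  have "has_bochner_integral lborel (\<lambda>x. exp (- (0 + sqrt k * x)\<^sup>2)) (sqrt pi /\<^sub>R \<bar>sqrt k\<bar>)"
    using lborel_has_bochner_integral_real_affine_iff[OF s(1), of "\<lambda>x. exp (- x\<^sup>2)" "sqrt pi" 0] full by simp
  then show "has_bochner_integral lborel (\<lambda>x::real. exp (- k * x\<^sup>2)) (sqrt (pi / k))"
    using assms by (simp add: power_mult_distrib real_sqrt_mult real_sqrt_inverse divide_inverse mult.commute)
  have "has_bochner_integral lborel (\<lambda>x. indicator {0..} (0 + sqrt k * x) *\<^sub>R exp (- (0 + sqrt k * x)\<^sup>2)) (sqrt pi / 2 /\<^sub>R \<bar>sqrt k\<bar>)"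
    using lborel_has_bochner_integral_real_affine_iff[OF s(1), of "\<lambda>x. indicator {0..} x *\<^sub>R exp (- x\<^sup>2)" "sqrt pi / 2" 0] gaussian_moment_0 by simp
  moreover have "indicator {0..} (0 + sqrt k * x) = (indicator {0..} x :: real)" for x
    using s by (auto simp: indicator_def zero_le_mult_iff)
  moreover have "exp (- (0 + sqrt k * x)\<^sup>2) = exp (- k * x\<^sup>2)" for x
    using assms by (simp add: power_mult_distrib)
  moreover have "sqrt pi / 2 /\<^sub>R \<bar>sqrt k\<bar> = sqrt (pi / k) / 2"
    using s by (simp add: real_sqrt_divide field_simps)
  ultimately show "has_bochner_integral lborel (\<lambda>x::real. indicator {0..} x * exp (- k * x\<^sup>2)) (sqrt (pi / k) / 2)"
    by (simp only: real_scaleR_def)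
qed

text \<open>Writing a series as the integral of a step function makes dominated convergence for
  integrals available for Riemann sums on a half-line.\<close>

lemma has_bochner_integral_step:
  fixes c :: "nat \<Rightarrow> real"
  assumes c: "summable c" "\<And>m. c m \<ge> 0"
  shows "has_bochner_integral lborel (\<lambda>x::real. indicator {0..} x * c (nat \<lfloor>x\<rfloor>)) (suminf c)"
proof -
  let ?f = "\<lambda>m x. c m * indicator {real m..<real m + 1} x"
  have int: "has_bochner_integral lborel (?f m) (c m)" for m
  proof -
    have "has_bochner_integral lborel (\<lambda>x. c m * indicator {real m..<real m + 1} x) (c m * measure lborel {real m..<real m + 1})"
      by (intro has_bochner_integral_mult_right has_bochner_integral_real_indicator) auto
    then show ?thesis by simp
  qed
  have eq: "(\<lambda>m. ?f m x) sums (indicator {0..} x * c (nat \<lfloor>x\<rfloor>))" for x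
  proof (cases "x \<ge> 0")
    case True
    have "?f m x = (if m = nat \<lfloor>x\<rfloor> then c m else 0)" for m
    proof -
      have "x \<in> {real m..<real m + 1} \<longleftrightarrow> m = nat \<lfloor>x\<rfloor>"
        using True by (auto simp: nat_eq_iff2 floor_eq_iff le_nat_floor)
      then show ?thesis by (simp add: indicator_def)
    qed
    then show ?thesis using True by (simp add: sums_single)
  next
    case False
    then have "?f m x = 0" for m by (auto simp: indicator_def)
    then show ?thesis using False by simp
  qed
  have i: "integrable lborel (?f m)" for m using int[of m] by (simp add: has_bochner_integral_iff)
  have AE: "AE x in lborel. summable (\<lambda>m. norm (?f m x))"
    using eq c(2) by (auto simp: sums_iff abs_mult)
  have nint: "(\<integral>x. norm (?f m x) \<partial>lborel) = c m" for m
    using int[of m] c(2)[of m] by (simp add: has_bochner_integral_iff abs_mult)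
  have "integrable lborel (\<lambda>x. \<Sum>m. ?f m x)" "integral\<^sup>L lborel (\<lambda>x. \<Sum>m. ?f m x) = (\<Sum>m. integral\<^sup>L lborel (?f m))"
    by (rule integrable_suminf[OF i AE] integral_suminf[OF i AE]; simp only: nint c)+
  moreover have "(\<Sum>m. ?f m x) = indicator {0..} x * c (nat \<lfloor>x\<rfloor>)" for x
    using eq[of x] by (simp add: sums_iff)
  moreover have "integral\<^sup>L lborel (?f m) = c m" for m using int[of m] by (simp add: has_bochner_integral_iff)
  ultimately show ?thesis by (simp add: has_bochner_integral_iff)
qed

text \<open>After rescaling, \<open>suminf (c n) / N n\<close> is the integral over y >= 0 of the
  step function with value \<open>c n\<close> at the floor of N y. It is applied to the theta sum in
  \<open>overpartition_gf_asymp\<close> and to \<open>triple_coeff\<close>; an exponential majorant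
  is enough in both.\<close>

lemma riemann_sum_gaussian:
  fixes c :: "nat \<Rightarrow> nat \<Rightarrow> real" and N :: "nat \<Rightarrow> real"
  assumes N: "\<And>n. N n \<ge> 1" and k: "k > 0" and d: "d > 0"
    and lim: "\<And>y. y > 0 \<Longrightarrow> (\<lambda>n. c n (nat \<lfloor>N n * y\<rfloor>)) \<longlonglongrightarrow> exp (- k * y\<^sup>2)"
    and nonneg: "\<And>n m. c n m \<ge> 0"
    and bound: "\<And>n m. c n m \<le> C * exp (- d * (real m / N n))"
  shows "\<And>n. summable (c n)" and "(\<lambda>n. suminf (c n) / N n) \<longlonglongrightarrow> sqrt (pi / k) / 2"
proof -
  let ?m = "\<lambda>n y. nat \<lfloor>N n * y\<rfloor>"
  have N0: "N n > 0" for n using N[of n] by linarith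
  show summ: "summable (c n)" for n
  proof (rule summable_comparison_test')
    have "exp (- (d / N n)) < 1" using d N0 by simp
    then show "summable (\<lambda>m. C * exp (- (d / N n)) ^ m)" by (intro summable_mult summable_geometric) simp
    show "norm (c n m) \<le> C * exp (- (d / N n)) ^ m" for m
      using bound[of n m] nonneg[of n m] by (simp add: mult.commute flip: exp_of_nat_mult)
  qed
  have C: "C \<ge> 0"
    using bound[of 0 0] nonneg[of 0 0] by simp
  have int: "has_bochner_integral lborel (\<lambda>y. indicator {0..} y * c n (?m n y)) (suminf (c n) / N n)" for n
  proof -
    have "has_bochner_integral lborel (\<lambda>y. indicator {0..} (0 + N n * y) * c n (nat \<lfloor>0 + N n * y\<rfloor>)) (suminf (c n) /\<^sub>R \<bar>N n\<bar>)"
      using N0[of n]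
      by (intro lborel_has_bochner_integral_real_affine_iff[of "N n" "\<lambda>x. indicator {0..} x * c n (nat \<lfloor>x\<rfloor>)" _ 0, THEN iffD1]
          has_bochner_integral_step summ nonneg) simp
    moreover have "indicator {0..} (0 + N n * y) = (indicator {0..} y :: real)" for y
      using N0[of n] by (auto simp: indicator_def zero_le_mult_iff)
    ultimately show ?thesis using N0[of n] by (simp add: divide_inverse mult.commute)
  qed
  have "(\<lambda>n. LINT y|lborel. indicator {0..} y * c n (?m n y)) \<longlonglongrightarrow> (LINT y|lborel. indicator {0..} y * exp (- k * y\<^sup>2))"
  proof (rule integral_dominated_convergence[where w = "\<lambda>y. C * exp d * (indicator {0<..} y * exp (- d * y))"])
    show "(\<lambda>y. indicator {0..} y * exp (- k * y\<^sup>2)) \<in> borel_measurable lborel" by measurable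
    show "(\<lambda>y. indicator {0..} y * c n (?m n y)) \<in> borel_measurable lborel" for n
      using int[of n] by (simp add: has_bochner_integral_iff borel_measurable_integrable)
    have "integrable lborel (\<lambda>y. indicator {0<..} y * exp (- d * y))"
      using integrable_I0i_exp_mscale[OF d] by (simp add: set_integrable_def mult.commute)
    then show "integrable lborel (\<lambda>y. C * exp d * (indicator {0<..} y * exp (- d * y)))"
      by (rule integrable_mult_right)
    have nz: "AE y in lborel. y \<noteq> (0::real)" by (rule AE_lborel_singleton)
    from nz show "AE y in lborel. (\<lambda>n. indicator {0..} y * c n (?m n y)) \<longlonglongrightarrow> indicator {0..} y * exp (- k * y\<^sup>2)"
    proof eventually_elim
      case (elim y)
      then show ?case using lim[of y] by (cases "y > 0") (auto simp: indicator_def)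
    qed
    show "AE y in lborel. norm (indicator {0..} y * c n (?m n y)) \<le> C * exp d * (indicator {0<..} y * exp (- d * y))" for n
      using nz
    proof eventually_elim
      case (elim y)
      show "norm (indicator {0..} y * c n (?m n y)) \<le> C * exp d * (indicator {0<..} y * exp (- d * y))"
      proof (cases "y > 0")
        case True
        \<comment> \<open>The floor shifts the argument by at most 1/N <= 1, which costs the factor
          \<open>exp d\<close> in the majorant.\<close>
        have "N n * y - 1 \<le> real (?m n y)" by linarith
        then have "(N n * y - 1) / N n \<le> real (?m n y) / N n"
          using N0[of n] by (intro divide_right_mono) auto
        moreover have "(N n * y - 1) / N n \<ge> y - 1"
          using N[of n] N0[of n] by (simp add: field_simps)
        ultimately have "y - 1 \<le> real (?m n y) / N n" by linarith
        then have "- d * (real (?m n y) / N n) \<le> d + - d * y"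
          using d mult_left_mono[of "y - 1" "real (?m n y) / N n" d] by (simp add: algebra_simps)
        then have "C * exp (- d * (real (?m n y) / N n)) \<le> C * exp (d + - d * y)"
          using C by (intro mult_left_mono) auto
        then have "c n (?m n y) \<le> C * exp (d + - d * y)"
          using bound[of n "?m n y"] by linarith
        then show ?thesis using nonneg[of n "?m n y"] True
          unfolding exp_add by (simp add: mult.assoc)
      qed (use elim in simp)
    qed
  qed
  then show "(\<lambda>n. suminf (c n) / N n) \<longlonglongrightarrow> sqrt (pi / k) / 2"
    unfolding has_bochner_integral_integral_eq[OF int] has_bochner_integral_integral_eq[OF gaussian_integral(2)[OF k]] .
qed

section \<open>The product of 1 + q^k on the real axis\<close>

lemma nonneg_of_deriv_nonneg:
  fixes f :: "real \<Rightarrow> real"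
  assumes "\<And>x. x \<ge> 0 \<Longrightarrow> (f has_real_derivative f' x) (at x)" "\<And>x. x \<ge> 0 \<Longrightarrow> f' x \<ge> 0" "f 0 = 0" "x \<ge> 0"
  shows "f x \<ge> 0"
  using DERIV_nonneg_imp_nondecreasing[of 0 x f] assms by force

text \<open>The function and its first three derivatives vanish at 0, and its fourth derivative is x
  sinh x. Up to a negative factor it is the derivative of \<open>bernoulli_quot\<close>.\<close>

lemma hyperbolic_inequality:
  fixes x :: real
  assumes "x \<ge> 0"
  shows "x * sinh x + x\<^sup>2 - 4 * cosh x + 4 \<ge> 0"
proof -
  have 1: "x * cosh x - sinh x \<ge> 0" if "x \<ge> 0" for x :: real
    by (rule nonneg_of_deriv_nonneg[where f = "\<lambda>x. x * cosh x - sinh x" and f' = "\<lambda>x. x * sinh x"])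
       (use that in \<open>auto intro!: derivative_eq_intros\<close>)
  have 2: "x * sinh x + 2 - 2 * cosh x \<ge> 0" if "x \<ge> 0" for x :: real
    by (rule nonneg_of_deriv_nonneg[where f = "\<lambda>x. x * sinh x + 2 - 2 * cosh x" and f' = "\<lambda>x. x * cosh x - sinh x"])
       (use that 1 in \<open>auto intro!: derivative_eq_intros\<close>)
  have 3: "x * cosh x + 2 * x - 3 * sinh x \<ge> 0" if "x \<ge> 0" for x :: real
    by (rule nonneg_of_deriv_nonneg[where f = "\<lambda>x. x * cosh x + 2 * x - 3 * sinh x" and f' = "\<lambda>x. x * sinh x + 2 - 2 * cosh x"])
       (use that 2 in \<open>auto intro!: derivative_eq_intros\<close>)
  show ?thesis
    by (rule nonneg_of_deriv_nonneg[where f = "\<lambda>x. x * sinh x + x\<^sup>2 - 4 * cosh x + 4" and f' = "\<lambda>x. x * cosh x + 2 * x - 3 * sinh x"])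
       (use assms 3 in \<open>auto intro!: derivative_eq_intros\<close>)
qed

text \<open>This is (1/(e^x - 1) - 1/x + 1/2) / x. The extra division by x absorbs the 1/j of
  \<open>log_coeff\<close>, so that what remains of the Lambert series alternates in sign with
  decreasing terms.\<close>

definition bernoulli_quot :: "real \<Rightarrow> real" where
  "bernoulli_quot x = 1 / (x * (exp x - 1)) - 1 / x ^ 2 + 1 / (2 * x)"

lemma bernoulli_quot_antimono:
  assumes "0 < x" "x \<le> y"
  shows "bernoulli_quot y \<le> bernoulli_quot x"
proof (rule DERIV_nonpos_imp_nonincreasing[where f = bernoulli_quot, OF assms(2)])
  fix z assume z: "x \<le> z" "z \<le> y"
  then have z0: "z > 0" using assms by simp
  define E where "E = exp z"
  have E: "E > 1" using z0 by (simp add: E_def)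
  let ?d = "- (E - 1 + z * E) / (z * (E - 1)) ^ 2 + 2 / z ^ 3 - 1 / (2 * z ^ 2)"
  have "(bernoulli_quot has_real_derivative ?d) (at z)"
    unfolding bernoulli_quot_def[abs_def] E_def using z0 E
    by (auto intro!: derivative_eq_intros simp: E_def) (simp add: field_simps eval_nat_numeral)
  moreover have "?d \<le> 0"
  proof -
    have "0 \<le> z * sinh z + z\<^sup>2 - 4 * cosh z + 4" by (rule hyperbolic_inequality) (use z0 in simp)
    also have "\<dots> = (z * (E * E - 1) / 2 + z\<^sup>2 * E - 2 * (E - 1)\<^sup>2) / E"
      using E by (simp add: sinh_def cosh_def exp_minus E_def[symmetric] field_simps power2_eq_square)
    finally have "0 \<le> z * (E * E - 1) / 2 + z\<^sup>2 * E - 2 * (E - 1)\<^sup>2"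
      using E by (simp add: zero_le_divide_iff)
    moreover have "?d = - (z * (E * E - 1) / 2 + z\<^sup>2 * E - 2 * (E - 1)\<^sup>2) / (z ^ 3 * (E - 1) ^ 2)"
      using z0 E by (simp add: divide_simps) (simp add: algebra_simps eval_nat_numeral)
    ultimately show ?thesis using z0 E by (simp add: divide_nonpos_pos)
  qed
  ultimately show "\<exists>d. (bernoulli_quot has_real_derivative d) (at z) \<and> d \<le> 0" by blast
qed

lemma bernoulli_quot_nonneg:
  assumes "x > 0"
  shows "bernoulli_quot x \<ge> 0"
proof (rule tendsto_upperbound)
  show "(bernoulli_quot \<longlongrightarrow> 0) at_top"
    unfolding bernoulli_quot_def[abs_def] by real_asymp
  show "\<forall>\<^sub>F y in at_top. bernoulli_quot y \<le> bernoulli_quot x"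
    using eventually_ge_at_top[of x] by eventually_elim (use bernoulli_quot_antimono assms in auto)
qed simp

lemma bernoulli_quot_lim_0: "((\<lambda>x. x * bernoulli_quot x) \<longlongrightarrow> 0) (at_right 0)"
  unfolding bernoulli_quot_def by real_asymp

lemma log_coeff_sums: "(\<lambda>j. log_coeff (Suc j) / real (Suc j)) sums (pi\<^sup>2 / 12)"
proof -
  have "(\<lambda>n. 1 / (real n + 1)\<^sup>2 - (if odd n then 2 / (real n + 1)\<^sup>2 else 0)) sums (pi\<^sup>2 / 6 - 1 / 2 * (pi\<^sup>2 / 6))"
    by (intro sums_diff inverse_squares_sums' inverse_even_squares_sums)
  also have "(\<lambda>n. 1 / (real n + 1)\<^sup>2 - (if odd n then 2 / (real n + 1)\<^sup>2 else 0)) = (\<lambda>j. log_coeff (Suc j) / real (Suc j))"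
    by (auto simp: fun_eq_iff log_coeff_def power2_eq_square add.commute simp flip: diff_divide_distrib)
  finally show ?thesis by simp
qed

text \<open>Near \<open>t = 0\<close>, \<open>log \<Prod>\<^sub>k (1 + e\<^sup>-\<^sup>k\<^sup>t)\<close> is \<open>\<pi>\<^sup>2 / (12 t) - log 2 / 2\<close> up to an alternating sum of a decreasing sequence.\<close>

lemma lambert_log_bounds:
  assumes t: "t > 0"
  obtains s where "lambert log_coeff (of_real (exp (- t))) = of_real (pi\<^sup>2 / 12 / t - ln 2 / 2 + s)"
    "0 \<le> s" "s \<le> t * bernoulli_quot t"
proof -
  define a where "a = (\<lambda>n. t * bernoulli_quot (real (Suc n) * t))"
  \<comment> \<open>With j = n + 1 and x = jt, 1/(e^x - 1) is split into 1/x, -1/2 and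
    \<open>x * bernoulli_quot x\<close>. Weighted by \<open>log_coeff\<close>, the parts sum to
    pi^2/(12 t), to -(ln 2)/2 and to a Leibniz series.\<close>
  let ?S = "\<lambda>n. log_coeff (Suc n) / real (Suc n) / t - 1 / 2 * ((-1) ^ n / real (Suc n)) + (-1) ^ n * a n"
  let ?q = "complex_of_real (exp (- t))"
  have lim: "a \<longlonglongrightarrow> 0"
    unfolding a_def bernoulli_quot_def using t by real_asymp
  have pos: "a n \<ge> 0" for n
    unfolding a_def using t by (intro mult_nonneg_nonneg bernoulli_quot_nonneg) auto
  have mono: "a (Suc n) \<le> a n" for n
    unfolding a_def using t by (intro mult_left_mono bernoulli_quot_antimono mult_right_mono) auto
  note L = summable_Leibniz'[OF lim pos mono]
  define s where "s = (\<Sum>n. (-1) ^ n * a n)"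
  have s: "0 \<le> s" "s \<le> t * bernoulli_quot t"
    using L(2)[of 0] L(4)[of 0] by (simp_all add: s_def a_def)
  have "?S sums (pi\<^sup>2 / 12 / t - 1 / 2 * ln 2 + s)"
    unfolding s_def
    by (intro sums_add sums_diff sums_divide sums_mult log_coeff_sums alternating_harmonic_series_sums summable_sums L(1))
  also have "?S
     = (\<lambda>n. log_coeff (Suc n) / (exp (real (Suc n) * t) - 1))"
  proof
    fix n
    define x where "x = real (Suc n) * t"
    have x: "x > 0" using t by (simp add: x_def)
    then have "exp x - 1 \<noteq> 0" by simp
    have "(-1) ^ n * a n = log_coeff (Suc n) * (x * bernoulli_quot x)"
      by (simp add: a_def log_coeff_def x_def)
    also have "x * bernoulli_quot x = 1 / (exp x - 1) - 1 / x + 1 / 2"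
      using x \<open>exp x - 1 \<noteq> 0\<close> by (simp add: bernoulli_quot_def field_simps power2_eq_square)
    finally show "?S n
       = log_coeff (Suc n) / (exp (real (Suc n) * t) - 1)"
      by (simp add: log_coeff_def algebra_simps x_def del: of_nat_Suc)
  qed
  finally have "(\<lambda>n. complex_of_real (log_coeff (Suc n) / (exp (real (Suc n) * t) - 1))) sums of_real (pi\<^sup>2 / 12 / t - 1 / 2 * ln 2 + s)"
    by (rule sums_of_real)
  also have "(\<lambda>n. complex_of_real (log_coeff (Suc n) / (exp (real (Suc n) * t) - 1)))
      = (\<lambda>n. of_real (log_coeff (Suc n)) * (?q ^ Suc n / (1 - ?q ^ Suc n)))"
  proof
    fix n
    define E where "E = exp (real (Suc n) * t)"
    have E: "E > 1" using t by (simp add: E_def)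
    have "exp (- t) ^ Suc n = 1 / E"
      by (simp add: E_def exp_minus exp_of_nat_mult power_inverse divide_inverse del: of_nat_Suc power_Suc)
    then have "?q ^ Suc n = of_real (1 / E)" by (metis of_real_power)
    moreover have "complex_of_real (1 / E) / (1 - of_real (1 / E)) = of_real (1 / (E - 1))"
    proof -
      have "(1 / E) / (1 - 1 / E) = 1 / (E - 1)" using E by (simp add: field_simps)
      then show ?thesis by (metis of_real_1 of_real_diff of_real_divide)
    qed
    ultimately show "complex_of_real (log_coeff (Suc n) / (exp (real (Suc n) * t) - 1))
        = of_real (log_coeff (Suc n)) * (?q ^ Suc n / (1 - ?q ^ Suc n))"
      by (simp only: E_def[symmetric]) simp
  qed
  finally have "(\<lambda>j. of_real (log_coeff j) * (?q ^ j / (1 - ?q ^ j))) sums complex_of_real (pi\<^sup>2 / 12 / t - 1 / 2 * ln 2 + s)"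
    by (subst (asm) sums_Suc_iff) (simp add: log_coeff_bounds)
  then have "lambert log_coeff (?q) = of_real (pi\<^sup>2 / 12 / t - ln 2 / 2 + s)"
    by (simp add: lambert_def sums_iff)
  then show ?thesis using s that by blast
qed

lemma floor_scaled_tendsto:
  fixes N :: "nat \<Rightarrow> real"
  assumes "filterlim N at_top sequentially" "y \<ge> 0"
  shows "(\<lambda>n. real (nat \<lfloor>N n * y\<rfloor>) / N n) \<longlonglongrightarrow> y"
proof (rule tendsto_sandwich)
  have pos: "\<forall>\<^sub>F n in sequentially. N n > 0"
    using assms(1) by (simp add: filterlim_at_top_dense)
  show "\<forall>\<^sub>F n in sequentially. y - 1 / N n \<le> real (nat \<lfloor>N n * y\<rfloor>) / N n"
    using pos
  proof eventually_elim
    case (elim n)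
    have "N n * y - 1 \<le> real (nat \<lfloor>N n * y\<rfloor>)" by linarith
    then have "(N n * y - 1) / N n \<le> real (nat \<lfloor>N n * y\<rfloor>) / N n"
      using elim by (intro divide_right_mono) auto
    then show ?case using elim by (simp add: diff_divide_distrib)
  qed
  show "\<forall>\<^sub>F n in sequentially. real (nat \<lfloor>N n * y\<rfloor>) / N n \<le> y"
    using pos
  proof eventually_elim
    case (elim n)
    have "0 \<le> N n * y" using elim assms(2) by simp
    then have "real (nat \<lfloor>N n * y\<rfloor>) \<le> N n * y" by linarith
    then show ?case using elim by (simp add: divide_le_eq mult.commute)
  qed
  have "((\<lambda>n. 1 / N n) \<longlongrightarrow> 0) sequentially"
    by (rule tendsto_divide_0[OF tendsto_const filterlim_at_top_imp_at_infinity[OF assms(1)]])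
  then show "(\<lambda>n. y - 1 / N n) \<longlonglongrightarrow> y" using tendsto_diff[OF tendsto_const, of _ 0 _ y] by force
qed simp

section \<open>The theta sum over triangular numbers\<close>

definition triangular :: "nat \<Rightarrow> nat" where
  "triangular k = k * (k + 1) div 2"

lemma real_triangular: "real (triangular k) = real k * (real k + 1) / 2"
proof -
  have "2 * triangular k = k * (k + 1)" by (simp add: triangular_def)
  then have "2 * real (triangular k) = real k * (real k + 1)"
    by (metis of_nat_Suc of_nat_mult of_nat_numeral Suc_eq_plus1 add.commute)
  then show ?thesis by simp
qed

lemma triangular_ge: "k \<le> triangular k"
proof -
  have "2 * triangular k = k * (k + 1)" by (simp add: triangular_def)
  then show ?thesis by (cases k) auto
qed

lemma triangular_strict_mono: "strict_mono triangular"
  by (rule strict_monoI_Suc) (simp add: triangular_def)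

lemma tri_eq_triangular: "tri (int k) = triangular k" "tri (- int k - 1) = triangular k"
proof -
  have *: "2 * int (triangular k) = int k * (int k + 1)"
  proof -
    have "2 * triangular k = k * (k + 1)" by (simp add: triangular_def)
    then have "int (2 * triangular k) = int (k * (k + 1))" by (simp only:)
    then show ?thesis by (simp add: algebra_simps)
  qed
  show "tri (int k) = triangular k" "tri (- int k - 1) = triangular k"
    using tri_eq[of "int k"] tri_eq[of "- int k - 1"] * by (simp_all add: algebra_simps)
qed

lemma finite_triangular_le: "finite {k. triangular k \<le> n}"
  by (rule finite_subset[of _ "{..n}"]) (use triangular_ge order_trans in auto)

lemma triple_coeff_eq_sum: "triple_coeff n = (\<Sum>k | triangular k \<le> n. overpartition (n - triangular k))"
proof -
  let ?K = "{k. triangular k \<le> n}"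
  let ?A = "int ` ?K" and ?B = "(\<lambda>k. - int k - 1) ` ?K"
  have cases: "(\<exists>k. m = int k) \<or> (\<exists>k. m = - int k - 1)" for m :: int
  proof (cases "m \<ge> 0")
    case False
    then have "m = - int (nat (- m - 1)) - 1" by simp
    then show ?thesis by blast
  qed (metis nonneg_int_cases)
  have set: "{m. tri m \<le> n} = ?A \<union> ?B"
  proof (intro equalityI subsetI)
    fix m assume "m \<in> {m. tri m \<le> n}"
    then show "m \<in> ?A \<union> ?B" using cases[of m] by (auto simp: tri_eq_triangular)
  qed (auto simp: tri_eq_triangular)
  have "2 * triple_coeff n = class_sum 1 0 (overpartition_tri n)"
    by (rule triple_coeff_eq(2)[of n "Suc n"]) simp
  also have "\<dots> = (\<Sum>m | m \<in> ?A \<union> ?B \<and> [m = 0] (mod 1). overpartition_tri n m)"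
    by (rule class_sum_eq) (use set finite_triangular_le[of n] in \<open>auto simp: overpartition_tri_def split: if_splits\<close>)
  also have "\<dots> = (\<Sum>m\<in>?A \<union> ?B. overpartition_tri n m)" by (rule sum.cong) auto
  also have "\<dots> = (\<Sum>m\<in>?A. overpartition_tri n m) + (\<Sum>m\<in>?B. overpartition_tri n m)"
    by (rule sum.union_disjoint) (use finite_triangular_le in auto)
  also have "(\<Sum>m\<in>?A. overpartition_tri n m) = (\<Sum>k\<in>?K. overpartition (n - triangular k))"
    by (subst sum.reindex) (auto simp: inj_on_def overpartition_tri_def tri_eq_triangular)
  also have "(\<Sum>m\<in>?B. overpartition_tri n m) = (\<Sum>k\<in>?K. overpartition (n - triangular k))"
    by (subst sum.reindex) (auto simp: inj_on_def overpartition_tri_def tri_eq_triangular)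
  finally show ?thesis by simp
qed

definition triangular_series :: "int fps" where
  "triangular_series = Abs_fps (\<lambda>n. if n \<in> range triangular then 1 else 0)"

text \<open>Gauss's identity for triangular numbers, multiplied by P: the left side generates the
  coefficients of prod (1+q^k)^3.\<close>

lemma triple_series_eq: "Abs_fps triple_coeff = overpartition_series * triangular_series"
proof (rule fps_ext)
  fix n
  let ?K = "{k. triangular k \<le> n}"
  have "fps_nth (overpartition_series * triangular_series) n
      = (\<Sum>i=0..n. if n - i \<in> range triangular then overpartition i else 0)"
    by (simp add: fps_mult_nth triangular_series_def overpartition_def if_distrib cong: if_cong)
  also have "\<dots> = (\<Sum>i | i \<in> {0..n} \<and> n - i \<in> range triangular. overpartition i)"
    by (rule sum.inter_filter[symmetric]) simp
  also have "\<dots> = (\<Sum>k\<in>?K. overpartition (n - triangular k))"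
  proof (rule sum.reindex_bij_betw[symmetric])
    have inj: "triangular k = triangular k' \<longleftrightarrow> k = k'" for k k'
      using triangular_strict_mono by (simp add: strict_mono_eq)
    show "bij_betw (\<lambda>k. n - triangular k) ?K {i. i \<in> {0..n} \<and> n - i \<in> range triangular}"
      unfolding bij_betw_def
    proof
      show "inj_on (\<lambda>k. n - triangular k) ?K"
      proof (rule inj_onI)
        fix k k' assume "k \<in> ?K" "k' \<in> ?K" "n - triangular k = n - triangular k'"
        then have "triangular k = triangular k'" by simp
        then show "k = k'" by (simp add: inj)
      qed
      show "(\<lambda>k. n - triangular k) ` ?K = {i. i \<in> {0..n} \<and> n - i \<in> range triangular}"
      proof (intro equalityI subsetI)
        fix i assume "i \<in> {i. i \<in> {0..n} \<and> n - i \<in> range triangular}"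
        then obtain k where "i \<le> n" "n - i = triangular k" by auto
        then have "k \<in> ?K" "i = n - triangular k" by auto
        then show "i \<in> (\<lambda>k. n - triangular k) ` ?K" by blast
      qed auto
    qed
  qed
  finally show "fps_nth (Abs_fps triple_coeff) n = fps_nth (overpartition_series * triangular_series) n"
    by (simp add: triple_coeff_eq_sum)
qed

lemma fps_sums_triangular_series:
  assumes "norm z < 1"
  shows "fps_sums triangular_series z (\<Sum>m. z ^ triangular m)" "summable (\<lambda>m. z ^ triangular m)"
proof -
  let ?f = "\<lambda>n. of_int (fps_nth triangular_series n) * z ^ n"
  have 1: "summable (\<lambda>n. norm (?f n))"
    by (rule summable_comparison_test'[OF summable_geometric[of "norm z"]])
       (use assms in \<open>auto simp: triangular_series_def norm_power\<close>)
  have "?f sums suminf ?f" by (intro summable_sums summable_norm_cancel[OF 1])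
  then have "(\<lambda>m. ?f (triangular m)) sums suminf ?f"
    by (subst sums_mono_reindex[OF triangular_strict_mono]) (auto simp: triangular_series_def)
  then have s: "(\<lambda>m. z ^ triangular m) sums suminf ?f" by (simp add: triangular_series_def)
  then show "summable (\<lambda>m. z ^ triangular m)" by (rule sums_summable)
  show "fps_sums triangular_series z (\<Sum>m. z ^ triangular m)"
    unfolding fps_sums_def using 1 s \<open>?f sums suminf ?f\<close> by (simp add: sums_iff)
qed

section \<open>Asymptotics of P on the real axis\<close>

definition overpartition_gf :: "real \<Rightarrow> real" where
  "overpartition_gf t = exp (Re (lambert atanh_coeff (of_real (exp (- t)))))"

lemma exp_lambert_atanh_of_real:
  assumes "t > 0"
  shows "exp (lambert atanh_coeff (of_real (exp (- t)))) = of_real (overpartition_gf t)"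
proof -
  let ?L = "lambert atanh_coeff (of_real (exp (- t)))" and ?q = "complex_of_real (exp (- t))"
  have n: "norm (?q) < 1" using assms by simp
  have "(\<lambda>j. of_real (atanh_coeff j) * (?q ^ j / (1 - ?q ^ j))) sums ?L"
    unfolding lambert_def
    by (intro summable_sums summable_norm_cancel[OF prod_tendsto_exp_lambert_atanh(1)] n)
  from sums_Im[OF this] have "(\<lambda>j. 0) sums Im (?L)"
  proof (rule sums_cong[THEN iffD1, rotated])
    fix j
    have "complex_of_real (atanh_coeff j) * (?q ^ j / (1 - ?q ^ j))
       = of_real (atanh_coeff j * (exp (- t) ^ j / (1 - exp (- t) ^ j)))" by simp
    then show "Im (complex_of_real (atanh_coeff j) * (?q ^ j / (1 - ?q ^ j))) = 0"
      by (metis Im_complex_of_real)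
  qed
  then have "Im (?L) = 0" by (simp add: sums_iff)
  then have "?L = of_real (Re (?L))"
    by (simp add: complex_eq_iff)
  then show ?thesis unfolding overpartition_gf_def by (metis exp_of_real)
qed

lemma overpartition_gf_eq:
  assumes t: "t > 0"
  obtains s where "overpartition_gf t * (\<Sum>m. exp (- t) ^ triangular m) = exp (3 * (pi\<^sup>2 / 12 / t - ln 2 / 2 + s))"
    "0 \<le> s" "s \<le> t * bernoulli_quot t"
proof -
  obtain s where s: "lambert log_coeff (of_real (exp (- t))) = of_real (pi\<^sup>2 / 12 / t - ln 2 / 2 + s)"
    "0 \<le> s" "s \<le> t * bernoulli_quot t" by (rule lambert_log_bounds[OF t])
  define z where "z = complex_of_real (exp (- t))"
  have z: "norm z < 1" using t by (simp add: z_def)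
  have "fps_sums (Abs_fps triple_coeff) z (exp (lambert atanh_coeff z) * (\<Sum>m. z ^ triangular m))"
    unfolding triple_series_eq by (intro fps_sums_mult fps_sums_overpartition_series fps_sums_triangular_series z)
  moreover have "fps_sums (Abs_fps triple_coeff) z (exp (lambert log_coeff z) ^ 3)"
    by (rule fps_sums_triple_coeff[OF z])
  ultimately have "exp (lambert atanh_coeff z) * (\<Sum>m. z ^ triangular m) = exp (lambert log_coeff z) ^ 3"
    unfolding fps_sums_def by (blast intro: sums_unique2)
  moreover have "exp (lambert atanh_coeff z) = of_real (overpartition_gf t)"
    unfolding z_def by (rule exp_lambert_atanh_of_real[OF t])
  moreover have "exp (lambert log_coeff z) ^ 3 = of_real (exp (3 * (pi\<^sup>2 / 12 / t - ln 2 / 2 + s)))"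
    unfolding z_def s(1) by (simp only: exp_of_nat_mult[symmetric] exp_of_real[symmetric] of_real_mult) simp
  moreover have "(\<Sum>m. z ^ triangular m) = of_real (\<Sum>m. exp (- t) ^ triangular m)"
  proof -
    have "summable (\<lambda>m. z ^ triangular m)" by (rule fps_sums_triangular_series(2)[OF z])
    then have "summable (\<lambda>m. Re (z ^ triangular m))" by (rule summable_Re)
    then have "summable (\<lambda>m. exp (- t) ^ triangular m)" by (simp add: z_def flip: of_real_power)
    then have "(\<lambda>m. complex_of_real (exp (- t) ^ triangular m)) sums of_real (\<Sum>m. exp (- t) ^ triangular m)"
      by (intro sums_of_real summable_sums)
    then show ?thesis by (simp add: z_def sums_iff)
  qed
  ultimately have "complex_of_real (overpartition_gf t * (\<Sum>m. exp (- t) ^ triangular m)) = of_real (exp (3 * (pi\<^sup>2 / 12 / t - ln 2 / 2 + s)))"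
    by simp
  then have "overpartition_gf t * (\<Sum>m. exp (- t) ^ triangular m) = exp (3 * (pi\<^sup>2 / 12 / t - ln 2 / 2 + s))"
    by (simp only: of_real_eq_iff)
  then show ?thesis using s that by blast
qed

text \<open>The theta sum is a Riemann sum of exp (-y^2/2) with mesh sqrt t, hence asymptotic to
  sqrt (pi/(2t)); the cube of prod (1 + e^(-kt)) is asymptotic to 2^(-3/2) exp (pi^2/(4t)). Their
  quotient gives the constant.\<close>

lemma overpartition_gf_asymp:
  fixes t :: "nat \<Rightarrow> real"
  assumes t: "\<And>n. 0 < t n" "\<And>n. t n \<le> 1" "t \<longlonglongrightarrow> 0"
  shows "(\<lambda>n. overpartition_gf (t n) * exp (- (pi\<^sup>2 / 4 / t n)) / sqrt (t n)) \<longlonglongrightarrow> 1 / (2 * sqrt pi)"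
proof -
  have tr: "filterlim t (at_right 0) sequentially"
    using t by (intro tendsto_imp_filterlim_at_right) auto
  define N where "N = (\<lambda>n. 1 / sqrt (t n))"
  have N: "N n \<ge> 1" for n using t(1,2)[of n] by (simp add: N_def)
  have Ntop: "filterlim N at_top sequentially"
  proof -
    have "filterlim (\<lambda>x::real. 1 / sqrt x) at_top (at_right 0)" by real_asymp
    from filterlim_compose[OF this tr] show ?thesis by (simp add: N_def)
  qed
  have st: "sqrt (t n) = 1 / N n" "t n = (1 / N n) ^ 2" for n
    using t(1)[of n] by (simp_all add: N_def power_divide)
  define \<psi> where "\<psi> = (\<lambda>n. \<Sum>m. exp (- t n) ^ triangular m)"
  have c_eq: "exp (- t n) ^ triangular m = exp (- (1 / 2 * ((real m / N n)\<^sup>2 + real m / N n * (1 / N n))))" for n m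
  proof -
    have "real (triangular m) * t n = 1 / 2 * ((real m / N n)\<^sup>2 + real m / N n * (1 / N n))"
      unfolding st(2) real_triangular by (simp add: power2_eq_square distrib_left add_divide_distrib)
    then show ?thesis by (simp add: mult.commute flip: exp_of_nat_mult)
  qed
  have Ninv: "(\<lambda>n. 1 / N n) \<longlonglongrightarrow> 0"
    by (rule tendsto_divide_0[OF tendsto_const filterlim_at_top_imp_at_infinity[OF Ntop]])
  have lim: "(\<lambda>n. \<psi> n / N n) \<longlonglongrightarrow> sqrt (pi / (1 / 2)) / 2"
    unfolding \<psi>_def
  proof (rule riemann_sum_gaussian(2)[where d = "1 / 2" and C = "exp (1 / 2)"])
    show "(\<lambda>n. exp (- t n) ^ triangular (nat \<lfloor>N n * y\<rfloor>)) \<longlonglongrightarrow> exp (- (1 / 2) * y\<^sup>2)" if "y > 0" for y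
    proof -
      have fl: "(\<lambda>n. real (nat \<lfloor>N n * y\<rfloor>) / N n) \<longlonglongrightarrow> y"
        by (rule floor_scaled_tendsto[OF Ntop]) (use that in simp)
      have "(\<lambda>n. exp (- (1 / 2 * ((real (nat \<lfloor>N n * y\<rfloor>) / N n)\<^sup>2 + real (nat \<lfloor>N n * y\<rfloor>) / N n * (1 / N n))))) \<longlonglongrightarrow> exp (- (1 / 2 * (y\<^sup>2 + y * 0)))"
        by (intro tendsto_intros fl Ninv)
      then show ?thesis unfolding c_eq by simp
    qed
    show "exp (- t n) ^ triangular m \<le> exp (1 / 2) * exp (- (1 / 2) * (real m / N n))" for n m
    proof -
      define x where "x = real m / N n"
      have x: "x \<ge> 0" using N[of n] by (simp add: x_def)
      \<comment> \<open>This square trades the Gaussian decay for the exponential majorant.\<close>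
      have "0 \<le> (x - 1)\<^sup>2" "0 \<le> x * (1 / N n)" using x N[of n] by auto
      then have "- (1 / 2 * (x\<^sup>2 + x * (1 / N n))) \<le> 1 / 2 + - (1 / 2) * x"
        using x by (simp add: power2_eq_square algebra_simps)
      then show ?thesis unfolding c_eq x_def[symmetric] exp_add[symmetric] by simp
    qed
  qed (use N in auto)
  have psi: "(\<lambda>n. \<psi> n * sqrt (t n)) \<longlonglongrightarrow> sqrt (pi / 2)"
  proof -
    have "sqrt (pi / 2) = sqrt (pi / (1 / 2) / 4)" by simp
    also have "\<dots> = sqrt (pi / (1 / 2)) / 2" unfolding real_sqrt_divide[of _ 4] real_sqrt_four ..
    finally have e: "sqrt (pi / 2) = sqrt (pi / (1 / 2)) / 2" .
    show ?thesis using lim unfolding st(1) e by (simp only: times_divide_eq_right mult_1_right)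
  qed
  have "\<exists>s. overpartition_gf (t n) * \<psi> n = exp (3 * (pi\<^sup>2 / 12 / t n - ln 2 / 2 + s)) \<and> 0 \<le> s \<and> s \<le> t n * bernoulli_quot (t n)" for n
    unfolding \<psi>_def by (rule overpartition_gf_eq[OF t(1)[of n]]) blast
  then obtain s where s: "\<And>n. overpartition_gf (t n) * \<psi> n = exp (3 * (pi\<^sup>2 / 12 / t n - ln 2 / 2 + s n))"
    "\<And>n. 0 \<le> s n" "\<And>n. s n \<le> t n * bernoulli_quot (t n)"
    by metis
  have "(\<lambda>n. t n * bernoulli_quot (t n)) \<longlonglongrightarrow> 0"
    by (rule filterlim_compose[OF bernoulli_quot_lim_0 tr])
  then have s0: "s \<longlonglongrightarrow> 0"
    by (rule tendsto_sandwich[OF _ _ tendsto_const, rotated 2]) (use s in auto)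
  have "(\<lambda>n. exp (3 * (s n - ln 2 / 2)) / (\<psi> n * sqrt (t n))) \<longlonglongrightarrow> exp (3 * (0 - ln 2 / 2)) / sqrt (pi / 2)"
    by (intro tendsto_intros s0 psi) auto
  moreover have "exp (3 * (s n - ln 2 / 2)) / (\<psi> n * sqrt (t n)) = overpartition_gf (t n) * exp (- (pi\<^sup>2 / 4 / t n)) / sqrt (t n)" for n
  proof -
    have "\<psi> n \<noteq> 0" using s(1)[of n] by (metis exp_not_eq_zero mult_zero_right)
    then have "overpartition_gf (t n) = exp (3 * (pi\<^sup>2 / 12 / t n - ln 2 / 2 + s n)) / \<psi> n"
      using s(1)[of n] by (simp add: field_simps)
    moreover have "exp (3 * (pi\<^sup>2 / 12 / t n - ln 2 / 2 + s n)) * exp (- (pi\<^sup>2 / 4 / t n)) = exp (3 * (s n - ln 2 / 2))"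
      unfolding exp_add[symmetric] by (rule arg_cong[of _ _ exp]) (simp add: algebra_simps)
    ultimately show ?thesis by simp
  qed
  moreover have "exp (3 * (0 - ln 2 / 2)) / sqrt (pi / 2) = 1 / (2 * sqrt pi)"
  proof -
    have "exp (3 * (0 - ln 2 / 2)) = (2::real) powr (- 3 / 2)" by (simp add: powr_def)
    also have "\<dots> = 1 / (2 powr (1 + 1 / 2))" by (simp add: powr_minus_divide)
    also have "2 powr (1 + 1 / 2) = 2 * sqrt 2" unfolding powr_add by (simp add: powr_half_sqrt)
    finally show ?thesis by (simp add: real_sqrt_divide)
  qed
  ultimately show ?thesis by simp
qed

subsection \<open>The circle method\<close>

lemma integral_exp_imaginary:
  fixes j :: int
  shows "has_bochner_integral lborel (\<lambda>x. indicator {- pi..pi} x *\<^sub>R exp (\<i> * of_int j * complex_of_real x))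
     (if j = 0 then of_real (2 * pi) else 0)"
proof (cases "j = 0")
  case True
  have "has_bochner_integral lborel (\<lambda>x. indicator {- pi..pi} x *\<^sub>R (1::complex)) (of_real pi - of_real (- pi))"
    by (rule has_bochner_integral_FTC_Icc) (auto intro!: derivative_eq_intros)
  then show ?thesis using True by simp
next
  case False
  let ?c = "\<i> * complex_of_int j"
  have c: "?c \<noteq> 0" using False by simp
  have "has_bochner_integral lborel (\<lambda>x. indicator {- pi..pi} x *\<^sub>R exp (?c * of_real x))
     (exp (?c * of_real pi) / ?c - exp (?c * of_real (- pi)) / ?c)"
  proof (rule has_bochner_integral_FTC_Icc)
    fix x :: real
    have "((\<lambda>z. exp (?c * z) / ?c) has_field_derivative exp (?c * of_real x)) (at (of_real x))"
      using c by (auto intro!: derivative_eq_intros)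
    then show "((\<lambda>x. exp (?c * of_real x) / ?c) has_vector_derivative exp (?c * of_real x)) (at x within {- pi..pi})"
      by (rule has_vector_derivative_real_field)
  qed (auto intro!: continuous_intros)
  moreover have "exp (?c * of_real pi) = exp (?c * of_real (- pi))"
  proof -
    have "?c * of_real pi = ?c * of_real (- pi) + of_int j * (of_real (2 * pi) * \<i>)" by (simp add: algebra_simps)
    then show ?thesis using exp_plus_2pin[of "?c * of_real (- pi)" j] by (simp add: algebra_simps)
  qed
  ultimately show ?thesis using False by simp
qed

text \<open>Cauchy's formula on the circle of radius e^-t, obtained by integrating the absolutely
  convergent series term by term; only the term k = n survives.\<close>

lemma coefficient_integral:
  fixes t :: real
  assumes "t > 0" and F: "\<And>z. norm z < 1 \<Longrightarrow> fps_sums G z (F z)"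
  shows "has_bochner_integral lborel (\<lambda>x. indicator {- pi..pi} x *\<^sub>R (F (exp (- Complex t x)) * exp (\<i> * of_nat n * of_real x)))
     (of_real (2 * pi * of_int (fps_nth G n) * exp (- real n * t)))"
proof -
  let ?F = "\<lambda>x. indicator {- pi..pi} x *\<^sub>R (F (exp (- Complex t x)) * exp (\<i> * of_nat n * of_real x))"
  let ?c = "\<lambda>k. complex_of_int (fps_nth G k) * of_real (exp (- real k * t))"
  let ?f = "\<lambda>k x. ?c k * (indicator {- pi..pi} x *\<^sub>R exp (\<i> * of_int (int n - int k) * complex_of_real x))"
  have int: "has_bochner_integral lborel (?f k) (?c k * (if int n - int k = 0 then of_real (2 * pi) else 0))" for k
    by (intro has_bochner_integral_mult_right integral_exp_imaginary)
  have term_eq: "indicator {- pi..pi} x *\<^sub>R (of_int (fps_nth G k) * exp (- Complex t x) ^ k * exp (\<i> * of_nat n * of_real x)) = ?f k x" for k x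
  proof -
    have "exp (- Complex t x) ^ k = exp (of_real (- real k * t) - \<i> * of_nat k * of_real x)"
      unfolding exp_of_nat_mult[symmetric] by (rule arg_cong[of _ _ exp]) (simp add: complex_eq_iff)
    then have "exp (- Complex t x) ^ k * exp (\<i> * of_nat n * of_real x)
       = exp (of_real (- real k * t)) * exp (\<i> * of_int (int n - int k) * complex_of_real x)"
      unfolding exp_add[symmetric] by (simp add: algebra_simps flip: exp_add)
    also have "exp (of_real (- real k * t)) = complex_of_real (exp (- real k * t))" by (rule exp_of_real)
    finally show ?thesis by (simp add: scaleR_conv_of_real mult_ac)
  qed
  have n1: "norm (exp (- Complex t x)) < 1" for x using assms(1) by simp
  have sums: "(\<lambda>k. ?f k x) sums (?F x)" for x
  proof -
    have "(\<lambda>k. of_int (fps_nth G k) * exp (- Complex t x) ^ k) sums F (exp (- Complex t x))"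
      using F[OF n1] by (simp add: fps_sums_def)
    then have "(\<lambda>k. indicator {- pi..pi} x *\<^sub>R (of_int (fps_nth G k) * exp (- Complex t x) ^ k * exp (\<i> * of_nat n * of_real x)))
        sums (?F x)"
      by (intro sums_scaleR_right sums_mult2)
    then show ?thesis unfolding term_eq .
  qed
  have abs: "summable (\<lambda>k. norm (?c k))"
  proof -
    have "summable (\<lambda>k. norm (of_int (fps_nth G k) * exp (- Complex t 0) ^ k))"
      using F[OF n1[of 0]] by (simp add: fps_sums_def)
    moreover have "norm (exp (- Complex t 0) ^ k) = exp (- real k * t)" for k
      by (simp add: norm_power flip: exp_of_nat_mult)
    ultimately show ?thesis by (simp add: norm_mult)
  qed
  have norm_f: "norm (?f k x) = norm (?c k) * indicator {- pi..pi} x" for k x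
  proof -
    have "\<i> * of_int (int n - int k) * complex_of_real x = \<i> * of_real (of_int (int n - int k) * x)" by simp
    then show ?thesis unfolding norm_mult by (simp only: norm_exp_i_times norm_scaleR) (simp add: norm_mult)
  qed
  have i: "integrable lborel (?f k)" for k using int[of k] unfolding has_bochner_integral_iff by blast 
  have ae: "AE x in lborel. summable (\<lambda>k. norm (?f k x))"
    unfolding norm_f using abs by (intro AE_I2 summable_mult2)
  have sm: "summable (\<lambda>k. \<integral>x. norm (?f k x) \<partial>lborel)"
    unfolding norm_f using abs by (simp add: summable_mult2)
  note integrable_suminf[OF i ae sm] integral_suminf[OF i ae sm]
  moreover have "(\<lambda>x. \<Sum>k. ?f k x) = ?F"
    using sums by (simp add: sums_iff fun_eq_iff)
  moreover have "(\<Sum>k. integral\<^sup>L lborel (?f k)) = of_real (2 * pi * of_int (fps_nth G n) * exp (- real n * t))"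
  proof -
    have "(\<lambda>k. integral\<^sup>L lborel (?f k)) = (\<lambda>k. if k = n then ?c n * of_real (2 * pi) else 0)"
      using has_bochner_integral_integral_eq[OF int] by (auto simp: fun_eq_iff)
    then show ?thesis by (simp add: sums_single[THEN sums_unique, symmetric] mult_ac)
  qed
  ultimately show ?thesis by (simp add: has_bochner_integral_iff)
qed

lemma exp_minus_le_cube:
  fixes y :: real
  assumes "y > 0"
  shows "exp (- y) \<le> 27 / y ^ 3"
proof -
  have "(y / 3) ^ 3 \<le> exp (y / 3) ^ 3"
  proof (rule power_mono)
    show "y / 3 \<le> exp (y / 3)" using exp_ge_add_one_self[of "y / 3"] by linarith
  qed (use assms in simp)
  also have "\<dots> = exp y" by (simp flip: exp_of_nat_mult)
  finally show ?thesis using assms by (simp add: exp_minus field_simps)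
qed

text \<open>If s^2 t <= 1, the exponent is at least s^2/16. Otherwise it is at least 1/(16t), so the
  exponential is at most 27 (16t)^3, while the range of s gives (1+s^2) t^3 <= 17. The constant
  rounds up 27 * 16^3 * 17 = 1880064.\<close>

lemma arc_majorant:
  fixes s t :: real
  assumes t: "0 < t" "t \<le> 1 / 2" and s: "\<bar>s * (t * sqrt t)\<bar> \<le> pi"
  shows "exp (- (s\<^sup>2 / (8 * (1 + s\<^sup>2 * t)))) \<le> 2000000 / (1 + s\<^sup>2)"
proof -
  define x where "x = s\<^sup>2 / (8 * (1 + s\<^sup>2 * t))"
  have p: "1 + s\<^sup>2 * t > 0" using t by (intro add_pos_nonneg) auto
  have "(1 + s\<^sup>2) * exp (- x) \<le> 2000000"
  proof (cases "s\<^sup>2 * t \<le> 1")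
    case True
    then have "s\<^sup>2 / 16 \<le> x" unfolding x_def using p by (intro divide_left_mono) auto
    then have "1 + s\<^sup>2 \<le> 1 + 16 * x" by simp
    also have "\<dots> \<le> 16 * exp x" using exp_ge_add_one_self[of x] by linarith
    finally have "(1 + s\<^sup>2) * exp (- x) \<le> 16 * exp x * exp (- x)" by (intro mult_right_mono) auto
    also have "16 * exp x * exp (- x) = 16" by (simp add: exp_minus)
    finally show ?thesis by simp
  next
    case False
    then have s0: "s\<^sup>2 > 0" using t by (cases "s = 0") auto
    have "1 / (16 * t) = s\<^sup>2 / (8 * (s\<^sup>2 * t + s\<^sup>2 * t))" using s0 t by (simp add: field_simps)
    also have "\<dots> \<le> x"
      unfolding x_def
    proof (rule divide_left_mono)
      show "8 * (1 + s\<^sup>2 * t) \<le> 8 * (s\<^sup>2 * t + s\<^sup>2 * t)"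
      proof -
        have "8 * (1 + a) \<le> 8 * (a + a)" if "\<not> a \<le> 1" for a :: real using that by simp
        from this[OF False] show ?thesis .
      qed
      show "0 < 8 * (s\<^sup>2 * t + s\<^sup>2 * t) * (8 * (1 + s\<^sup>2 * t))"
        using p s0 t by (intro mult_pos_pos add_pos_pos) auto
    qed simp
    finally have "exp (- x) \<le> exp (- (1 / (16 * t)))" by simp
    also have "\<dots> \<le> 27 / (1 / (16 * t)) ^ 3" by (rule exp_minus_le_cube) (use t in simp)
    also have "\<dots> = 110592 * t ^ 3" using t by (simp add: field_simps eval_nat_numeral)
    finally have e: "exp (- x) \<le> 110592 * t ^ 3" .
    have "(s * (t * sqrt t))\<^sup>2 \<le> pi\<^sup>2" using power_mono[OF s, of 2] by simp
    moreover have "(s * (t * sqrt t))\<^sup>2 = s\<^sup>2 * t ^ 3" using t by (simp add: power_mult_distrib power2_eq_square power3_eq_cube)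
    moreover have "pi\<^sup>2 \<le> 4\<^sup>2" using pi_less_4 by (intro power_mono) auto
    ultimately have "s\<^sup>2 * t ^ 3 \<le> 16" by simp
    moreover have "t ^ 3 \<le> 1" using t by (intro power_le_one) auto
    ultimately have k: "(1 + s\<^sup>2) * t ^ 3 \<le> 17" by (simp add: algebra_simps)
    have "(1 + s\<^sup>2) * exp (- x) \<le> (1 + s\<^sup>2) * (110592 * t ^ 3)"
      using e by (intro mult_left_mono) auto
    also have "\<dots> = 110592 * ((1 + s\<^sup>2) * t ^ 3)" by (simp only: mult_ac)
    also have "\<dots> \<le> 110592 * 17" using k by (rule mult_left_mono) simp
    finally show ?thesis by simp
  qed
  moreover have "1 + s\<^sup>2 > 0" by (intro add_pos_nonneg) auto
  ultimately have "exp (- x) \<le> 2000000 / (1 + s\<^sup>2)"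
    by (simp add: pos_le_divide_eq mult.commute)
  then show ?thesis unfolding x_def .
qed

text \<open>Here u = sqrt t, the angle is s u^3 and A/u^4 is the index of the coefficient. For this
  choice of t the term linear in the angle cancels, and as u tends to 0 the exponent tends to -A
  s^2.\<close>

lemma saddle_exponent:
  fixes A s u :: real
  assumes "u > 0"
  shows "of_real A / Complex (u\<^sup>2) (s * u ^ 3) - of_real A / of_real (u\<^sup>2) + \<i> * of_real (A / u ^ 4 * (s * u ^ 3))
    = Complex (- A * s\<^sup>2 / (1 + s\<^sup>2 * u\<^sup>2)) (A * s ^ 3 * u / (1 + s\<^sup>2 * u\<^sup>2))"
proof -
  define d where "d = 1 + s\<^sup>2 * u\<^sup>2"
  have d: "d > 0" unfolding d_def by (intro add_pos_nonneg) auto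
  have cartesian: "of_real A / Complex a b - of_real A / of_real a + \<i> * of_real c
      = Complex (A * a / (a\<^sup>2 + b\<^sup>2) - A / a) (- (A * b) / (a\<^sup>2 + b\<^sup>2) + c)" for a b c
    unfolding of_real_divide[symmetric] by (simp add: complex_eq_iff Re_divide Im_divide power2_eq_square)
  have n: "(u\<^sup>2)\<^sup>2 + (s * u ^ 3)\<^sup>2 = u ^ 4 * d"
    by (simp add: d_def algebra_simps power2_eq_square eval_nat_numeral)
  have 1: "A * u\<^sup>2 / (u ^ 4 * d) - A / u\<^sup>2 = - A * s\<^sup>2 / d"
    using assms d by (simp add: divide_simps) (simp add: d_def algebra_simps eval_nat_numeral)
  have 2: "- (A * (s * u ^ 3)) / (u ^ 4 * d) + A / u ^ 4 * (s * u ^ 3) = A * s ^ 3 * u / d"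
    using assms d by (simp add: divide_simps) (simp add: d_def algebra_simps eval_nat_numeral)
  show ?thesis unfolding cartesian n 1 2 unfolding d_def ..
qed

text \<open>The radius is the saddle point: A/t + M t is minimal at t = sqrt (A/M). In the variable
  s = theta / t^(3/2) the normalised integrand tends pointwise to exp (-A s^2), and
  \<open>minor_arc_bound\<close> with \<open>arc_majorant\<close> dominates it everywhere, so the
  circle need not be cut into arcs.\<close>

lemma overpartition_scaled_tendsto:
  fixes t :: "nat \<Rightarrow> real" and M :: "nat \<Rightarrow> nat"
  assumes t: "\<And>n. 0 < t n" "\<And>n. t n \<le> 1 / 2" "t \<longlonglongrightarrow> 0"
    and M: "\<And>n. real (M n) = pi\<^sup>2 / 4 / (t n)\<^sup>2"
  shows "(\<lambda>n. 2 * pi * real_of_int (overpartition (M n)) * exp (- real (M n) * t n) / (t n * sqrt (t n) * overpartition_gf (t n))) \<longlonglongrightarrow> sqrt (pi / (pi\<^sup>2 / 4))"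
proof -
  define A where "A = pi\<^sup>2 / 4"
  have A: "A > 0" by (simp add: A_def)
  define u where "u = (\<lambda>n. sqrt (t n))"
  have u: "u n > 0" "t n = (u n)\<^sup>2" for n using t(1)[of n] by (simp_all add: u_def)
  have tu: "t n * sqrt (t n) = u n ^ 3" for n
    using t(1)[of n] by (simp add: u_def power3_eq_cube)
  have u0: "u \<longlonglongrightarrow> 0"
    using tendsto_real_sqrt[OF t(3)] by (simp add: u_def[abs_def])
  define P where "P = (\<lambda>n. overpartition_gf (t n))"
  have P: "P n > 0" for n by (simp add: P_def overpartition_gf_def)
  let ?C = "\<lambda>s v. Complex (- A * s\<^sup>2 / (1 + s\<^sup>2 * v\<^sup>2)) (A * s ^ 3 * v / (1 + s\<^sup>2 * v\<^sup>2))"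
  let ?V = "\<lambda>n. 2 * pi * of_int (overpartition (M n)) * exp (- real (M n) * t n)"
  define F where "F = (\<lambda>n x. exp (lambert atanh_coeff (exp (- Complex (t n) x))) * exp (\<i> * of_nat (M n) * of_real x) / of_real (P n))"
  let ?G = "\<lambda>n s. indicator {- pi..pi} (s * u n ^ 3) *\<^sub>R F n (s * u n ^ 3)"
  have int: "has_bochner_integral lborel (\<lambda>s. ?G n s)
     (of_real (?V n / (u n ^ 3 * P n)))" for n
  proof -
    have "has_bochner_integral lborel (\<lambda>x. indicator {- pi..pi} x *\<^sub>R (exp (lambert atanh_coeff (exp (- Complex (t n) x))) * exp (\<i> * of_nat (M n) * of_real x)))
       (of_real (?V n))"
      unfolding overpartition_def
      by (rule coefficient_integral[OF t(1)]) (rule fps_sums_overpartition_series)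
    from has_bochner_integral_divide_zero[OF this, of "complex_of_real (P n)"]
    have "has_bochner_integral lborel (\<lambda>x. indicator {- pi..pi} x *\<^sub>R F n x) (of_real (?V n) / of_real (P n))"
      by (simp only: F_def scaleR_conv_of_real times_divide_eq_right)
    then have "has_bochner_integral lborel (\<lambda>s. indicator {- pi..pi} (0 + u n ^ 3 * s) *\<^sub>R F n (0 + u n ^ 3 * s))
      ((of_real (?V n) / of_real (P n)) /\<^sub>R \<bar>u n ^ 3\<bar>)"
      by (rule lborel_has_bochner_integral_real_affine_iff[THEN iffD1, rotated]) (use u(1)[of n] in simp)
    moreover have "(of_real (?V n) / of_real (P n)) /\<^sub>R \<bar>u n ^ 3\<bar>
        = complex_of_real (?V n / (u n ^ 3 * P n))"
      using u(1)[of n] by (simp add: scaleR_conv_of_real divide_inverse mult_ac)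
    ultimately show ?thesis by (simp only: add_0_left mult.commute[of "u n ^ 3"])
  qed
  have "(\<lambda>n. integral\<^sup>L lborel (\<lambda>s. ?G n s)) \<longlonglongrightarrow> integral\<^sup>L lborel (\<lambda>s. complex_of_real (exp (- A * s\<^sup>2)))"
  proof (rule integral_dominated_convergence[where w = "\<lambda>s. 2000000 * inverse (1 + s\<^sup>2)"])
    show "(\<lambda>s. complex_of_real (exp (- A * s\<^sup>2))) \<in> borel_measurable lborel" by measurable
    show "(\<lambda>s. ?G n s) \<in> borel_measurable lborel" for n
      by (rule borel_measurable_has_bochner_integral[OF int])
    show "integrable lborel (\<lambda>s::real. 2000000 * inverse (1 + s\<^sup>2))"
      using integrable_inverse_1_plus_square by (intro integrable_mult_right) (simp add: set_integrable_def)
    show "AE s in lborel. norm (?G n s) \<le> 2000000 * inverse (1 + s\<^sup>2)" for n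
    proof (intro AE_I2)
      fix s :: real
      show "norm (?G n s) \<le> 2000000 * inverse (1 + s\<^sup>2)"
      proof (cases "\<bar>s * u n ^ 3\<bar> \<le> pi")
        case True
        let ?x = "s * u n ^ 3"
        have "norm (F n ?x) = norm (exp (lambert atanh_coeff (exp (- Complex (t n) ?x)))) / P n"
        proof -
          have "\<i> * of_nat (M n) * complex_of_real ?x = \<i> * of_real (real (M n) * ?x)" by simp
          then have "norm (exp (\<i> * of_nat (M n) * complex_of_real ?x)) = 1" by (simp only: norm_exp_i_times)
          then show ?thesis using P[of n] by (simp add: F_def norm_mult norm_divide)
        qed
        also have "\<dots> \<le> P n * exp (- (?x\<^sup>2 / (8 * t n * ((t n)\<^sup>2 + ?x\<^sup>2)))) / P n"
          using minor_arc_bound[OF t(1,2) True, of n] P[of n] unfolding P_def overpartition_gf_def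
          by (intro divide_right_mono) auto
        also have "\<dots> = exp (- (?x\<^sup>2 / (8 * t n * ((t n)\<^sup>2 + ?x\<^sup>2))))" using P[of n] by simp
        also have "?x\<^sup>2 / (8 * t n * ((t n)\<^sup>2 + ?x\<^sup>2)) = s\<^sup>2 / (8 * (1 + s\<^sup>2 * t n))"
        proof -
          have d: "1 + s\<^sup>2 * (u n)\<^sup>2 > 0" by (intro add_pos_nonneg) auto
          have "8 * (u n)\<^sup>2 * (((u n)\<^sup>2)\<^sup>2 + ?x\<^sup>2) = u n ^ 6 * (8 * (1 + s\<^sup>2 * (u n)\<^sup>2))"
            by (simp add: algebra_simps eval_nat_numeral)
          moreover have "?x\<^sup>2 = u n ^ 6 * s\<^sup>2" by (simp add: algebra_simps eval_nat_numeral)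
          ultimately show ?thesis unfolding u(2) using u(1)[of n] by (simp only:) simp
        qed
        also have "exp (- (s\<^sup>2 / (8 * (1 + s\<^sup>2 * t n)))) \<le> 2000000 / (1 + s\<^sup>2)"
          by (rule arc_majorant[OF t(1,2)]) (use True in \<open>simp add: tu\<close>)
        finally show ?thesis using True by (simp add: divide_inverse abs_le_iff indicator_def)
      next
        case False
        then have "indicator {- pi..pi} (s * u n ^ 3) = (0::real)" by (auto simp: indicator_def)
        then show ?thesis by simp
      qed
    qed
    show "AE s in lborel. (\<lambda>n. ?G n s) \<longlonglongrightarrow> complex_of_real (exp (- A * s\<^sup>2))"
    proof (intro AE_I2)
      fix s :: real
      define x where "x = (\<lambda>n. s * u n ^ 3)"
      define E where "E = (\<lambda>n. lambert atanh_coeff (exp (- Complex (t n) (x n))) - lambert atanh_coeff (of_real (exp (- t n)))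
         - (of_real A / Complex (t n) (x n) - of_real A / of_real (t n)))"
      have su: "(\<lambda>n. \<bar>s * u n\<bar>) \<longlonglongrightarrow> \<bar>s * 0\<bar>" by (intro tendsto_intros u0)
      then have "\<forall>\<^sub>F n in sequentially. \<bar>s * u n\<bar> < 1" by (rule order_tendstoD) simp
      then have small: "\<forall>\<^sub>F n in sequentially. \<bar>x n\<bar> \<le> t n"
      proof eventually_elim
        case (elim n)
        have "\<bar>x n\<bar> = \<bar>s * u n\<bar> * t n" using u(1)[of n] by (simp add: x_def u(2) abs_mult power2_eq_square power3_eq_cube)
        also have "\<dots> \<le> 1 * t n" using elim t(1)[of n] by (intro mult_right_mono) auto
        finally show ?case by simp
      qed
      \<comment> \<open>On the Gaussian scale the error from \<open>lambert_atanh_local\<close> has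
        order t^(3/2) * t^(-5/4) = t^(1/4).\<close>
      have "E \<longlonglongrightarrow> 0"
      proof (rule Lim_null_comparison)
        show "\<forall>\<^sub>F n in sequentially. norm (E n) \<le> 8 * (\<Sum>j. real j powr (- 5 / 4)) * \<bar>s\<bar> * t n powr (1 / 4)"
          using small
        proof eventually_elim
          case (elim n)
          have "u n ^ 3 * t n powr (- 5 / 4) = t n powr 1 * t n powr (1 / 2) * t n powr (- 5 / 4)"
            using t(1)[of n] by (simp add: tu[symmetric] powr_half_sqrt)
          also have "\<dots> = t n powr (1 / 4)" unfolding powr_add[symmetric] by simp
          finally have "\<bar>x n\<bar> * t n powr (- 5 / 4) = \<bar>s\<bar> * t n powr (1 / 4)"
            using u(1)[of n] by (simp add: x_def abs_mult)
          then show ?case using lambert_atanh_local[OF t(1) elim] unfolding E_def A_def by (simp add: mult.assoc)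
        qed
        have "(\<lambda>n. t n powr (1 / 4)) \<longlonglongrightarrow> 0 powr (1 / 4)"
          by (intro tendsto_powr' t(3) tendsto_const) (use t(1) in \<open>auto simp: less_imp_le\<close>)
        then show "(\<lambda>n. 8 * (\<Sum>j. real j powr (- 5 / 4)) * \<bar>s\<bar> * t n powr (1 / 4)) \<longlonglongrightarrow> 0"
          by (intro tendsto_mult_right_zero) simp
      qed
      moreover have "(\<lambda>n. ?C s (u n)) \<longlonglongrightarrow> ?C s 0"
        by (intro tendsto_Complex tendsto_intros u0) auto
      ultimately have "(\<lambda>n. exp (E n + ?C s (u n))) \<longlonglongrightarrow> exp (0 + ?C s 0)"
        by (intro tendsto_exp tendsto_add)
      also have "0 + ?C s 0 = of_real (- A * s\<^sup>2)"
        by (simp add: complex_eq_iff)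
      also have "exp (of_real (- A * s\<^sup>2)) = complex_of_real (exp (- A * s\<^sup>2))" by (rule exp_of_real)
      finally have lim: "(\<lambda>n. exp (E n + ?C s (u n))) \<longlonglongrightarrow> complex_of_real (exp (- A * s\<^sup>2))" .
      show "(\<lambda>n. ?G n s) \<longlonglongrightarrow> complex_of_real (exp (- A * s\<^sup>2))"
      proof (rule Lim_transform_eventually[OF lim])
        show "\<forall>\<^sub>F n in sequentially. exp (E n + ?C s (u n))
           = ?G n s"
          using small
        proof eventually_elim
          case (elim n)
          have "\<bar>x n\<bar> \<le> pi" using elim t(2)[of n] pi_gt3 by linarith
          then have ind: "indicator {- pi..pi} (s * u n ^ 3) = (1::real)" by (auto simp: x_def abs_le_iff)
          have Mx: "\<i> * of_nat (M n) * of_real (x n) = \<i> * complex_of_real (A / u n ^ 4 * (s * u n ^ 3))"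
          proof -
            have "real (M n) = A / u n ^ 4" unfolding M u(2) A_def by (simp flip: power_mult)
            then have "of_nat (M n) * complex_of_real (x n) = of_real (A / u n ^ 4 * (s * u n ^ 3))"
              unfolding x_def by (metis of_real_mult of_real_of_nat_eq)
            then show ?thesis by (simp only: mult.assoc)
          qed
          have "F n (x n) = exp (lambert atanh_coeff (exp (- Complex (t n) (x n))) + \<i> * of_nat (M n) * of_real (x n) - lambert atanh_coeff (of_real (exp (- t n))))"
            unfolding F_def P_def exp_diff exp_add exp_lambert_atanh_of_real[OF t(1)] ..
          also have "lambert atanh_coeff (exp (- Complex (t n) (x n))) + \<i> * of_nat (M n) * of_real (x n) - lambert atanh_coeff (of_real (exp (- t n)))
             = E n + (of_real A / Complex ((u n)\<^sup>2) (s * u n ^ 3) - of_real A / of_real ((u n)\<^sup>2) + \<i> * of_real (A / u n ^ 4 * (s * u n ^ 3)))"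
            unfolding Mx E_def u(2)[symmetric] by (simp add: x_def)
          also have "\<dots> = E n + ?C s (u n)"
            unfolding saddle_exponent[OF u(1)] ..
          finally show ?case unfolding ind by (simp add: x_def)
        qed
      qed
    qed
  qed
  then have "(\<lambda>n. complex_of_real (?V n / (u n ^ 3 * P n))) \<longlonglongrightarrow> of_real (sqrt (pi / A))"
    unfolding has_bochner_integral_integral_eq[OF int] 
      has_bochner_integral_integral_eq[OF has_bochner_integral_of_real[OF gaussian_integral(1)[OF A]]] .
  then show ?thesis unfolding tu[symmetric] P_def A_def tendsto_of_real_iff .
qed

lemma overpartition_limit:
  "(\<lambda>n. 8 * real n * real_of_int (overpartition n) * exp (- (pi * sqrt (real n)))) \<longlonglongrightarrow> 1"
proof (rule LIMSEQ_offset[of _ 10])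
  \<comment> \<open>The saddle point for index n + 10. The shift ensures t <= 1/2, because pi^2 <
    10.\<close>
  define t where "t = (\<lambda>n::nat. pi / (2 * sqrt (real (n + 10))))"
  have t0: "t n > 0" for n by (simp add: t_def)
  let ?X = "\<lambda>n. 2 * pi * real_of_int (overpartition (n + 10)) * exp (- real (n + 10) * t n) / (t n * sqrt (t n) * overpartition_gf (t n))"
  let ?Y = "\<lambda>n. overpartition_gf (t n) * exp (- (pi\<^sup>2 / 4 / t n)) / sqrt (t n)"
  let ?Z = "\<lambda>n. 8 * real (n + 10) * real_of_int (overpartition (n + 10)) * exp (- (pi * sqrt (real (n + 10))))"
  have t1: "t n \<le> 1 / 2" for n
  proof -
    have "pi \<le> 79 / 25" using pi_approx by simp
    also have "\<dots> \<le> sqrt 10" by (rule real_le_rsqrt) (simp add: power2_eq_square)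
    also have "\<dots> \<le> sqrt (real (n + 10))" by simp
    finally show ?thesis by (simp add: t_def divide_le_eq)
  qed
  have t2: "t n \<le> 1" for n using t1[of n] by simp
  have tlim: "t \<longlonglongrightarrow> 0" unfolding t_def by real_asymp
  have M: "real (n + 10) = pi\<^sup>2 / 4 / (t n)\<^sup>2" for n
    by (simp add: t_def power_divide power_mult_distrib)
  have "(\<lambda>n. ?X n * ?Y n) \<longlonglongrightarrow> sqrt (pi / (pi\<^sup>2 / 4)) * (1 / (2 * sqrt pi))"
    by (intro tendsto_mult overpartition_scaled_tendsto overpartition_gf_asymp t0 t1 t2 tlim M)
  then have "(\<lambda>n. pi * (?X n * ?Y n)) \<longlonglongrightarrow> pi * (sqrt (pi / (pi\<^sup>2 / 4)) * (1 / (2 * sqrt pi)))"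
    by (rule tendsto_mult_left)
  also have "pi * (sqrt (pi / (pi\<^sup>2 / 4)) * (1 / (2 * sqrt pi))) = 1"
    by (simp add: real_sqrt_divide real_sqrt_mult)
  also have "(\<lambda>n. pi * (?X n * ?Y n))
    = (\<lambda>n. ?Z n)"
  proof
    fix n
    define w where "w = sqrt (real (n + 10))"
    have w: "w > 0" "w\<^sup>2 = real (n + 10)" by (simp_all add: w_def)
    have tw: "t n = pi / (2 * w)" by (simp add: t_def w_def)
    have P: "overpartition_gf (t n) > 0" by (simp add: overpartition_gf_def)
    have e: "exp (- real (n + 10) * t n) * exp (- (pi\<^sup>2 / 4 / t n)) = exp (- (pi * w))"
      unfolding exp_add[symmetric] w(2)[symmetric] tw using w(1) by (simp add: field_simps power2_eq_square)
    have s: "sqrt (t n) * sqrt (t n) = t n" using t0[of n] by simp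
    have "pi * (?X n * ?Y n)
     = 2 * pi\<^sup>2 * real_of_int (overpartition (n + 10)) * (exp (- real (n + 10) * t n) * exp (- (pi\<^sup>2 / 4 / t n))) / (t n * (sqrt (t n) * sqrt (t n)))"
      using P t0[of n] by (simp add: field_simps power2_eq_square)
    also have "\<dots> = 2 * (pi\<^sup>2 / (t n * t n)) * real_of_int (overpartition (n + 10)) * exp (- (pi * w))"
      unfolding e s by simp
    also have "pi\<^sup>2 / (t n * t n) = 4 * real (n + 10)"
      unfolding tw w(2)[symmetric] using w(1) by (simp add: field_simps power2_eq_square)
    finally show "pi * (?X n * ?Y n)
     = ?Z n"
      by (simp add: w_def)
  qed
  finally show "(\<lambda>n. ?Z n) \<longlonglongrightarrow> 1" .
qed

subsection \<open>Overpartitions at nearby arguments\<close>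

lemma overpartition_ge_1: "overpartition n \<ge> 1"
proof -
  have "overpartition 0 = 1" using overpartition_eq[of 0 0] by (simp add: overpartition_prod_def)
  then show ?thesis using monoD[OF overpartition_mono, of 0 n] by simp
qed

text \<open>The factor n + 1 instead of n keeps the value positive at 0, so that two-sided bounds
  hold for every index, including n - j = 0.\<close>

definition scaled_op :: "nat \<Rightarrow> real" where
  "scaled_op n = (real n + 1) * real_of_int (overpartition n) * exp (- (pi * sqrt (real n)))"

lemma scaled_op_pos: "scaled_op n > 0"
  using overpartition_ge_1[of n] by (simp add: scaled_op_def)

lemma overpartition_eq_scaled: "real_of_int (overpartition n) = scaled_op n * exp (pi * sqrt (real n)) / (real n + 1)"
proof -
  have "exp (- (pi * sqrt (real n))) * exp (pi * sqrt (real n)) = 1" by (simp flip: exp_add)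
  moreover have "real n + 1 \<noteq> 0" by linarith
  ultimately show ?thesis by (simp add: scaled_op_def mult.assoc)
qed

lemma scaled_op_limit: "scaled_op \<longlonglongrightarrow> 1 / 8"
proof -
  have "(\<lambda>n. (real n + 1) / (8 * real n)) \<longlonglongrightarrow> 1 / 8" by real_asymp
  from tendsto_mult[OF this overpartition_limit]
  have "(\<lambda>n. (real n + 1) / (8 * real n) * (8 * real n * real_of_int (overpartition n) * exp (- (pi * sqrt (real n))))) \<longlonglongrightarrow> 1 / 8" by simp
  then show ?thesis
  proof (rule Lim_transform_eventually)
    show "\<forall>\<^sub>F n in sequentially. (real n + 1) / (8 * real n) * (8 * real n * real_of_int (overpartition n) * exp (- (pi * sqrt (real n)))) = scaled_op n"
      using eventually_gt_at_top[of 0] by eventually_elim (simp add: scaled_op_def)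
  qed
qed

lemma scaled_op_bounds:
  obtains c1 c2 where "0 < c1" "\<And>n. c1 \<le> scaled_op n" "\<And>n. scaled_op n \<le> c2"
proof -
  have "Bseq scaled_op" using scaled_op_limit by (intro convergent_imp_Bseq) (auto simp: convergent_def)
  then obtain c2 where c2: "\<And>n. norm (scaled_op n) \<le> c2" by (auto simp: Bseq_def)
  have "(\<lambda>n. inverse (scaled_op n)) \<longlonglongrightarrow> inverse (1 / 8)"
    by (intro tendsto_inverse scaled_op_limit) simp
  then have "Bseq (\<lambda>n. inverse (scaled_op n))" by (intro convergent_imp_Bseq) (auto simp: convergent_def)
  then obtain K where K: "K > 0" "\<And>n. norm (inverse (scaled_op n)) \<le> K" by (auto simp: Bseq_def)
  have "1 / K \<le> scaled_op n" for n
  proof -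
    have "inverse (scaled_op n) \<le> K" using K(2)[of n] scaled_op_pos[of n] by simp
    then show ?thesis using scaled_op_pos[of n] K(1) by (simp add: field_simps)
  qed
  moreover have "scaled_op n \<le> c2" for n using c2[of n] by simp
  ultimately show ?thesis using that[of "1 / K" c2] K(1) by simp
qed

lemma sqrt_diff_le:
  assumes "j \<le> n" "n > 0"
  shows "sqrt (real (n - j)) \<le> sqrt (real n) - real j / (2 * sqrt (real n))"
proof -
  have "real (n - j) = real n - real j" using assms by simp
  also have "\<dots> \<le> (sqrt (real n) - real j / (2 * sqrt (real n)))\<^sup>2"
    using assms by (simp add: power2_diff)
  finally have le: "real (n - j) \<le> (sqrt (real n) - real j / (2 * sqrt (real n)))\<^sup>2" .
  have "real j \<le> 2 * real n" using assms by simp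
  also have "\<dots> = sqrt (real n) * (2 * sqrt (real n))" by (simp add: mult.left_commute)
  finally have "real j \<le> sqrt (real n) * (2 * sqrt (real n))" .
  then have "0 \<le> sqrt (real n) - real j / (2 * sqrt (real n))"
    using assms by (simp add: divide_le_eq)
  then show ?thesis using le by (rule real_le_lsqrt)
qed

text \<open>Put x = j / sqrt n. By concavity of the square root the exponentials contribute at most
  exp (-(pi/2) x), and pi/2 > 3/2. The quotient (n+1)/(n-j+1) is at most 2 if 2j <= n and at most
  432 e^x otherwise, where x >= sqrt n / 2. Spending e^x on it leaves exp (-x/2); 30000 is a
  generous constant.\<close>

lemma overpartition_ratio_bound:
  obtains C where "\<And>n j. n > 0 \<Longrightarrow> j \<le> n \<Longrightarrow>
    real_of_int (overpartition (n - j)) / real_of_int (overpartition n) \<le> C * exp (- (1 / 2 * (real j / sqrt (real n))))"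
proof -
  obtain c1 c2 where c: "0 < c1" "\<And>n. c1 \<le> scaled_op n" "\<And>n. scaled_op n \<le> c2" by (rule scaled_op_bounds) blast
  have c2: "c2 > 0" using c(1) c(2)[of 0] c(3)[of 0] by linarith
  have main: "real_of_int (overpartition (n - j)) / real_of_int (overpartition n) \<le> c2 / c1 * 30000 * exp (- (1 / 2 * (real j / sqrt (real n))))"
    if n: "n > 0" and j: "j \<le> n" for n j
  proof -
    define w where "w = sqrt (real n)"
    have w: "w \<ge> 1" "w\<^sup>2 = real n" using n by (simp_all add: w_def)
    define x where "x = real j / w"
    have x: "x \<ge> 0" using w by (simp add: x_def)
    have "pi * sqrt (real (n - j)) \<le> pi * (w - real j / (2 * w))"
      using sqrt_diff_le[OF j n] by (intro mult_left_mono) (auto simp: w_def)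
    also have "\<dots> = pi * w - pi / 2 * x" by (simp add: x_def algebra_simps)
    also have "\<dots> \<le> pi * w - 3 / 2 * x" using pi_gt3 x by (intro diff_left_mono mult_right_mono) auto
    finally have ex: "exp (pi * sqrt (real (n - j))) \<le> exp (pi * w - 3 / 2 * x)" by simp
    have up: "real_of_int (overpartition (n - j)) \<le> c2 * exp (pi * w - 3 / 2 * x) / (real (n - j) + 1)"
      unfolding overpartition_eq_scaled using c(3)[of "n - j"] scaled_op_pos[of "n - j"] ex
      by (intro divide_right_mono mult_mono) auto
    have low: "c1 * exp (pi * w) / (real n + 1) \<le> real_of_int (overpartition n)"
      unfolding overpartition_eq_scaled[of n] w_def using c(2)[of n] by (intro divide_right_mono mult_right_mono) auto
    have "real_of_int (overpartition (n - j)) / real_of_int (overpartition n)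
       \<le> (c2 * exp (pi * w - 3 / 2 * x) / (real (n - j) + 1)) / (c1 * exp (pi * w) / (real n + 1))"
      using up low overpartition_ge_1[of "n - j"] c(1) c2
      by (intro frac_le) (auto intro!: divide_pos_pos)
    also have "\<dots> = c2 / c1 * ((real n + 1) / (real (n - j) + 1)) * exp (- (3 / 2 * x))"
    proof -
      have e: "exp (pi * w - 3 / 2 * x) = exp (pi * w) * exp (- (3 / 2 * x))" by (simp flip: exp_add)
      have eq: "(c2 * (a * b) / d) / (c1 * a / d') = c2 / c1 * (d' / d) * b" if "a > 0" "d > 0" "d' > 0" for a b d d' :: real
        using that c(1) by (simp add: field_simps)
      show ?thesis unfolding e by (rule eq) auto
    qed
    also have "\<dots> \<le> c2 / c1 * (30000 * exp x) * exp (- (3 / 2 * x))"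
    proof (intro mult_right_mono mult_left_mono)
      show "(real n + 1) / (real (n - j) + 1) \<le> 30000 * exp x"
      proof (cases "2 * j \<le> n")
        case True
        then have "real n + 1 \<le> 2 * (real (n - j) + 1)" by simp
        then have "(real n + 1) / (real (n - j) + 1) \<le> 2" by (simp add: divide_le_eq)
        also have "2 \<le> 30000 * (1::real)" by simp
        also have "30000 * 1 \<le> 30000 * exp x" using x by (intro mult_left_mono) auto
        finally show ?thesis .
      next
        case False
        then have "w\<^sup>2 / 2 \<le> real j" unfolding w(2) by simp
        then have "w / 2 \<le> x" using w by (simp add: x_def field_simps power2_eq_square)
        have "(real n + 1) / (real (n - j) + 1) \<le> (real n + 1) / 1" by (intro divide_left_mono) auto
        also have "\<dots> \<le> 2 * w\<^sup>2" using n unfolding w(2) by simp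
        also have "w\<^sup>2 \<le> w ^ 3" using w by (intro power_increasing) auto
        also have "2 * w ^ 3 = 16 * (w / 2) ^ 3" by (simp add: power_divide)
        also have "(w / 2) ^ 3 \<le> 27 * exp (w / 2)"
          using exp_minus_le_cube[of "w / 2"] w by (simp add: exp_minus field_simps)
        also have "16 * (27 * exp (w / 2)) \<le> 16 * (27 * exp x)" using \<open>w / 2 \<le> x\<close> by simp
        also have "\<dots> \<le> 30000 * exp x" by simp
        finally show ?thesis by simp
      qed
    qed (use c(1) c2 in auto)
    also have "\<dots> = c2 / c1 * 30000 * (exp x * exp (- (3 / 2 * x)))" by simp
    also have "exp x * exp (- (3 / 2 * x)) = exp (- (1 / 2 * x))" unfolding exp_add[symmetric] by simp
    finally show ?thesis by (simp add: x_def w_def)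
  qed
  show ?thesis by (rule that[OF main])
qed

text \<open>The rationalised form sqrt n - sqrt (n - j) = (j / sqrt n) / (1 + sqrt (1 - j/n)) tends
  to y/2, since j/n tends to 0.\<close>

lemma overpartition_ratio_limit:
  fixes j :: "nat \<Rightarrow> nat"
  assumes j: "(\<lambda>n. real (j n) / sqrt (real n)) \<longlonglongrightarrow> y"
  shows "\<forall>\<^sub>F n in sequentially. j n \<le> n"
    and "(\<lambda>n. real_of_int (overpartition (n - j n)) / real_of_int (overpartition n)) \<longlonglongrightarrow> exp (- (pi * (y / 2)))"
proof -
  let ?R = "\<lambda>n. (1 + 1 / real n) / (1 - real (j n) / real n + 1 / real n)"
  let ?E = "\<lambda>n. exp (- (pi * (real (j n) / sqrt (real n) / (1 + sqrt (1 - real (j n) / real n)))))"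
  let ?Q = "\<lambda>n. real_of_int (overpartition (n - j n)) / real_of_int (overpartition n)"
  have isq: "(\<lambda>n. 1 / sqrt (real n)) \<longlonglongrightarrow> 0" by real_asymp
  have jn: "(\<lambda>n. real (j n) / real n) \<longlonglongrightarrow> 0"
  proof -
    have "(\<lambda>n. real (j n) / sqrt (real n) * (1 / sqrt (real n))) \<longlonglongrightarrow> y * 0"
      by (intro tendsto_mult j isq)
    then show ?thesis by simp
  qed
  then have "\<forall>\<^sub>F n in sequentially. real (j n) / real n < 1 / 2" by (rule order_tendstoD) simp
  then have half: "\<forall>\<^sub>F n in sequentially. 2 * j n \<le> n \<and> n > 0"
    using eventually_gt_at_top[of 0]
  proof eventually_elim
    case (elim n)
    then have "2 * real (j n) < real n" by (simp add: divide_less_eq)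
    then show ?case using elim by linarith
  qed
  then show le: "\<forall>\<^sub>F n in sequentially. j n \<le> n" by eventually_elim simp
  have top: "filterlim (\<lambda>n. n - j n) at_top sequentially"
    unfolding filterlim_at_top
  proof
    fix Z :: nat
    show "\<forall>\<^sub>F n in sequentially. Z \<le> n - j n"
      using half eventually_ge_at_top[of "2 * Z"] by eventually_elim linarith
  qed
  have e1: "(\<lambda>n. scaled_op (n - j n) / scaled_op n) \<longlonglongrightarrow> (1 / 8) / (1 / 8)"
    by (intro tendsto_divide filterlim_compose[OF scaled_op_limit top] scaled_op_limit) simp
  have e2: "(\<lambda>n. ?R n) \<longlonglongrightarrow> (1 + 0) / (1 - 0 + 0)"
    by (intro tendsto_intros jn lim_1_over_n) auto
  have e3: "(\<lambda>n. ?E n) \<longlonglongrightarrow> exp (- (pi * (y / (1 + sqrt (1 - 0)))))"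
    by (intro tendsto_intros j jn) auto
  have "(\<lambda>n. scaled_op (n - j n) / scaled_op n * (?R n)
     * ?E n) \<longlonglongrightarrow>
      (1 / 8) / (1 / 8) * ((1 + 0) / (1 - 0 + 0)) * exp (- (pi * (y / (1 + sqrt (1 - 0)))))"
    by (intro tendsto_mult e1 e2 e3)
  then have lim: "(\<lambda>n. scaled_op (n - j n) / scaled_op n * (?R n)
     * ?E n) \<longlonglongrightarrow> exp (- (pi * (y / 2)))"
    by simp
  show "(\<lambda>n. ?Q n) \<longlonglongrightarrow> exp (- (pi * (y / 2)))"
  proof (rule Lim_transform_eventually[OF lim])
    show "\<forall>\<^sub>F n in sequentially. scaled_op (n - j n) / scaled_op n * (?R n)
     * ?E n
      = ?Q n"
      using half
    proof eventually_elim
      case (elim n)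
      define w v where "w = sqrt (real n)" and "v = sqrt (real (n - j n))"
      have n: "real n > 0" and r: "real (n - j n) = real n - real (j n)" using elim by simp_all
      have w: "w > 0" "w * w = real n" using elim by (simp_all add: w_def)
      have v: "v \<ge> 0" "v * v = real n - real (j n)" using r by (simp_all add: v_def)
      have "1 - real (j n) / real n = real (n - j n) / real n" using n r by (simp add: field_simps)
      then have sq: "sqrt (1 - real (j n) / real n) = v / w" by (simp add: real_sqrt_divide v_def w_def)
      have "real (j n) / w / (1 + v / w) = w - v"
      proof -
        have "real (j n) = (w - v) * (w + v)" using w(2) v(2) by (simp add: algebra_simps)
        moreover have "w + v > 0" using w v by linarith
        ultimately show ?thesis using w(1) by (simp add: field_simps)
      qed
      then have "- (pi * (real (j n) / w / (1 + v / w))) = pi * v - pi * w"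
        by (simp only:) (simp add: algebra_simps)
      then have ee: "?E n = exp (pi * v) / exp (pi * w)"
        unfolding sq w_def[symmetric] by (simp only: exp_diff)
      have "?R n = ((1 + 1 / real n) * real n) / ((1 - real (j n) / real n + 1 / real n) * real n)"
        using n by simp
      also have "\<dots> = (real n + 1) / (real (n - j n) + 1)"
        unfolding r using n by (simp add: algebra_simps)
      finally have "?R n = (real n + 1) / (real (n - j n) + 1)" .
      then show ?case
        unfolding ee unfolding overpartition_eq_scaled w_def[symmetric] v_def[symmetric] by (simp add: mult_ac)
    qed
  qed
qed

text \<open>The exact order of \<open>triple_coeff\<close>, and the common normalisation from here
  on. It exceeds the overpartition function by n^(1/4), so errors of the size of p(n)
  vanish.\<close>

definition op_scale :: "nat \<Rightarrow> real" where
  "op_scale n = real n powr (1 / 4) * real_of_int (overpartition n)"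

lemma op_scale_pos: "n > 0 \<Longrightarrow> op_scale n > 0"
  using overpartition_ge_1[of n] by (simp add: op_scale_def)

text \<open>For m near y n^(1/4), T(m) is near (y^2/2) sqrt n, and p(n - T(m)) / p(n) tends to exp
  (-pi y^2 / 4). The integral of this over y >= 0 is 1.\<close>

lemma triple_coeff_limit: "(\<lambda>n. real_of_int (triple_coeff n) / op_scale n) \<longlonglongrightarrow> 1"
proof (rule LIMSEQ_offset[of _ 1])
  define N where "N = (\<lambda>n. real (n + 1) powr (1 / 4))"
  have N: "N n \<ge> 1" for n
    using powr_mono2[of "1/4" 1 "real (n + 1)"] by (simp add: N_def)
  have Ntop: "filterlim N at_top sequentially" unfolding N_def by real_asymp
  have N2: "N n ^ 2 = sqrt (real (n + 1))" for n
    by (simp add: N_def powr_half_sqrt[symmetric] powr_powr flip: powr_numeral)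
  let ?m = "\<lambda>n y. nat \<lfloor>N n * y\<rfloor>"
  define c where "c = (\<lambda>n m. if triangular m \<le> n + 1 then real_of_int (overpartition (n + 1 - triangular m)) / real_of_int (overpartition (n + 1)) else 0)"
  obtain C where C: "\<And>n j. n > 0 \<Longrightarrow> j \<le> n \<Longrightarrow>
    real_of_int (overpartition (n - j)) / real_of_int (overpartition n) \<le> C * exp (- (1 / 2 * (real j / sqrt (real n))))"
    by (rule overpartition_ratio_bound) blast
  have C0: "C \<ge> 0"
    using C[of 1 0] overpartition_ge_1[of 1] by simp
  have tri_N: "real (triangular m) / sqrt (real (n + 1)) = ((real m / N n)\<^sup>2 + real m / N n * (1 / N n)) / 2" for m n
    using N[of n] unfolding real_triangular N2[symmetric]
    by (simp add: power2_eq_square distrib_left add_divide_distrib)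
  have Ninv: "(\<lambda>n. 1 / N n) \<longlonglongrightarrow> 0"
    by (rule tendsto_divide_0[OF tendsto_const filterlim_at_top_imp_at_infinity[OF Ntop]])
  have "(\<lambda>n. suminf (c n) / N n) \<longlonglongrightarrow> sqrt (pi / (pi / 4)) / 2"
  proof (rule riemann_sum_gaussian(2)[where d = "1 / 4" and C = "C * exp (1 / 4)"])
    show "c n m \<ge> 0" for n m using overpartition_ge_1 by (simp add: c_def overpartition_nonneg)
    show "c n m \<le> C * exp (1 / 4) * exp (- (1 / 4) * (real m / N n))" for n m
    proof (cases "triangular m \<le> n + 1")
      case True
      define x where "x = real m / N n"
      have x: "x \<ge> 0" using N[of n] by (simp add: x_def)
      have "0 \<le> x * (1 / N n)" using x N[of n] by auto
      moreover have "0 \<le> (x - 1)\<^sup>2" by simp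
      then have "2 * x - 1 \<le> x\<^sup>2" by (simp add: power2_eq_square algebra_simps)
      ultimately have "2 * x - 1 \<le> x\<^sup>2 + x * (1 / N n)" by simp
      moreover have "- (1 / 2 * (z / 2)) \<le> 1 / 4 + - (1 / 4) * x" if "2 * x - 1 \<le> z" for z
        using that x by simp
      ultimately have "- (1 / 2 * ((x\<^sup>2 + x * (1 / N n)) / 2)) \<le> 1 / 4 + - (1 / 4) * x" by blast
      then have "exp (- (1 / 2 * ((x\<^sup>2 + x * (1 / N n)) / 2))) \<le> exp (1 / 4) * exp (- (1 / 4) * x)"
        unfolding exp_add[symmetric] by simp
      then have "C * exp (- (1 / 2 * ((x\<^sup>2 + x * (1 / N n)) / 2))) \<le> C * (exp (1 / 4) * exp (- (1 / 4) * x))"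
        using C0 by (rule mult_left_mono)
      moreover have "c n m \<le> C * exp (- (1 / 2 * (real (triangular m) / sqrt (real (n + 1)))))"
        using C[of "n + 1" "triangular m"] True by (simp add: c_def)
      ultimately show ?thesis unfolding tri_N x_def[symmetric] by (simp add: mult.assoc)
    next
      case False
      then show ?thesis using C0 by (simp add: c_def)
    qed
    show "(\<lambda>n. c n (?m n y)) \<longlonglongrightarrow> exp (- (pi / 4) * y\<^sup>2)" if y: "y > 0" for y
    proof -
      \<comment> \<open>\<open>N n\<close> belongs to the argument n + 1, hence the index n -
        1.\<close>
      define j where "j = (\<lambda>n. triangular (nat \<lfloor>N (n - 1) * y\<rfloor>))"
      have fl: "(\<lambda>n. real (?m n y) / N n) \<longlonglongrightarrow> y"
        by (rule floor_scaled_tendsto[OF Ntop]) (use y in simp)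
      have "(\<lambda>n. ((real (?m n y) / N n)\<^sup>2 + real (?m n y) / N n * (1 / N n)) / 2) \<longlonglongrightarrow> (y\<^sup>2 + y * 0) / 2"
        by (intro tendsto_intros fl Ninv) simp
      then have "(\<lambda>n. real (j (n + 1)) / sqrt (real (n + 1))) \<longlonglongrightarrow> y\<^sup>2 / 2"
        unfolding tri_N[symmetric] by (simp add: j_def)
      then have jl: "(\<lambda>n. real (j n) / sqrt (real n)) \<longlonglongrightarrow> y\<^sup>2 / 2"
        by (rule LIMSEQ_offset)
      have le: "\<forall>\<^sub>F n in sequentially. j (n + 1) \<le> n + 1"
        by (rule iffD2[OF eventually_sequentially_seg[of "\<lambda>n. j n \<le> n" 1] overpartition_ratio_limit(1)[OF jl]])
      have "(\<lambda>n. real_of_int (overpartition (n + 1 - j (n + 1))) / real_of_int (overpartition (n + 1))) \<longlonglongrightarrow> exp (- (pi * (y\<^sup>2 / 2 / 2)))"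
        by (rule LIMSEQ_ignore_initial_segment[OF overpartition_ratio_limit(2)[OF jl], of 1])
      then have "(\<lambda>n. c n (?m n y)) \<longlonglongrightarrow> exp (- (pi * (y\<^sup>2 / 2 / 2)))"
      proof (rule Lim_transform_eventually)
        show "\<forall>\<^sub>F n in sequentially. real_of_int (overpartition (n + 1 - j (n + 1))) / real_of_int (overpartition (n + 1)) = c n (?m n y)"
          using le by eventually_elim (simp add: c_def j_def)
      qed
      then show ?thesis by simp
    qed
  qed (use N in auto)
  moreover have "suminf (c n) / N n = real_of_int (triple_coeff (n + 1)) / op_scale (n + 1)" for n
  proof -
    have "suminf (c n) = (\<Sum>m | triangular m \<le> n + 1. c n m)"
      by (rule suminf_finite[OF finite_triangular_le]) (simp add: c_def)
    also have "\<dots> = real_of_int (triple_coeff (n + 1)) / real_of_int (overpartition (n + 1))"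
      unfolding triple_coeff_eq_sum of_int_sum sum_divide_distrib by (rule sum.cong) (auto simp: c_def)
    finally show ?thesis by (simp add: op_scale_def N_def add.commute mult.commute)
  qed
  ultimately show "(\<lambda>n. real_of_int (triple_coeff (n + 1)) / op_scale (n + 1)) \<longlonglongrightarrow> 1"
    by simp
qed

lemma overpartition_over_op_scale: "(\<lambda>n. real_of_int (overpartition n) / op_scale n) \<longlonglongrightarrow> 0"
proof -
  have "(\<lambda>n. 1 / real n powr (1 / 4)) \<longlonglongrightarrow> 0" by real_asymp
  moreover have "1 / real n powr (1 / 4) = real_of_int (overpartition n) / op_scale n" for n
    using overpartition_ge_1[of n] by (simp add: op_scale_def)
  ultimately show ?thesis by simp
qed

lemma op_scale_shift: "(\<lambda>n. op_scale n / op_scale (Suc n)) \<longlonglongrightarrow> 1"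
proof -
  have "(\<lambda>n. real (1::nat) / sqrt (real n)) \<longlonglongrightarrow> 0" by real_asymp
  from LIMSEQ_Suc[OF overpartition_ratio_limit(2)[OF this]]
  have "(\<lambda>n. real_of_int (overpartition n) / real_of_int (overpartition (Suc n))) \<longlonglongrightarrow> 1" by simp
  moreover have "(\<lambda>n. real n powr (1 / 4) / real (Suc n) powr (1 / 4)) \<longlonglongrightarrow> 1" by real_asymp
  ultimately have "(\<lambda>n. real n powr (1 / 4) / real (Suc n) powr (1 / 4) * (real_of_int (overpartition n) / real_of_int (overpartition (Suc n)))) \<longlonglongrightarrow> 1 * 1"
    by (intro tendsto_mult)
  then show ?thesis by (simp add: op_scale_def)
qed

subsection \<open>Equidistribution\<close>

text \<open>The sequence is symmetric under m -> -m-1 and decreasing for m >= 0, so its total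
  variation is at most twice its maximum p(n).\<close>

lemma overpartition_tri_diff_le:
  "(\<Sum>m\<in>{- int M - 1..int M}. \<bar>overpartition_tri n m - overpartition_tri n (m + 1)\<bar>) \<le> 2 * overpartition n"
proof -
  define G where "G = (\<lambda>k. overpartition_tri n (int k))"
  let ?d = "\<lambda>m. \<bar>overpartition_tri n m - overpartition_tri n (m + 1)\<bar>"
  have G_neg: "overpartition_tri n (- int k - 1) = G k" for k
    by (simp add: G_def overpartition_tri_def tri_eq_triangular)
  have G_mono: "G l \<le> G k" if "k \<le> l" for k l
  proof -
    have "triangular k \<le> triangular l" using triangular_strict_mono that by (simp add: strict_mono_less_eq)
    then show ?thesis
      using monoD[OF overpartition_mono, of "n - triangular l" "n - triangular k"] overpartition_nonneg
      by (auto simp: G_def overpartition_tri_def tri_eq_triangular)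
  qed
  have G0: "G 0 = overpartition n" by (simp add: G_def overpartition_tri_def tri_def)
  have G_nonneg: "G k \<ge> 0" for k by (simp add: G_def overpartition_tri_def overpartition_nonneg)
  have set: "{- int M - 1..int M} = int ` {..M} \<union> (\<lambda>k. - int k - 1) ` {..M}"
  proof (intro equalityI subsetI)
    fix m assume m: "m \<in> {- int M - 1..int M}"
    show "m \<in> int ` {..M} \<union> (\<lambda>k. - int k - 1) ` {..M}"
    proof (cases "m \<ge> 0")
      case True
      then have "m = int (nat m)" "nat m \<le> M" using m by auto
      then show ?thesis by blast
    next
      case False
      then have "m = - int (nat (- m - 1)) - 1" "nat (- m - 1) \<le> M" using m by auto
      then show ?thesis by blast
    qed
  qed auto
  have "(\<Sum>m\<in>{- int M - 1..int M}. ?d m) = (\<Sum>m\<in>int ` {..M}. ?d m) + (\<Sum>m\<in>(\<lambda>k. - int k - 1) ` {..M}. ?d m)"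
    unfolding set by (rule sum.union_disjoint) auto
  also have "(\<Sum>m\<in>int ` {..M}. ?d m) = (\<Sum>k\<le>M. G k - G (Suc k))"
    by (subst sum.reindex) (use G_mono[of k "Suc k" for k] in \<open>auto simp: G_def inj_on_def add.commute intro!: sum.cong\<close>)
  also have "\<dots> = G 0 - G (Suc M)" by (rule sum_telescope)
  also have "(\<Sum>m\<in>(\<lambda>k. - int k - 1) ` {..M}. ?d m) = (\<Sum>k\<le>M. G (k - 1) - G k)"
  proof (subst sum.reindex)
    \<comment> \<open>At k = 0 the truncated k - 1 = 0 is the right index, because T(-1) = T(0) and
      the corresponding difference is 0.\<close>
    have "overpartition_tri n (- int k - 1 + 1) = G (k - 1)" for k
    proof (cases k)
      case (Suc l)
      then have "- int k - 1 + 1 = - int l - 1" by simp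
      then show ?thesis using G_neg[of l] Suc by (simp only:) simp
    qed (simp add: G_def)
    then show "sum (?d \<circ> (\<lambda>k. - int k - 1)) {..M} = (\<Sum>k\<le>M. G (k - 1) - G k)"
      using G_mono[of "k - 1" k for k] by (intro sum.cong refl) (simp add: G_neg abs_of_nonpos)
  qed (auto simp: inj_on_def)
  also have "(\<Sum>k\<le>M. G (k - 1) - G k) = G 0 - G M"
    by (induction M) simp_all
  finally show ?thesis using G0 G_nonneg[of M] G_nonneg[of "Suc M"] by simp
qed

lemma finite_overpartition_tri: "finite {m. overpartition_tri n m \<noteq> 0}"
  by (rule finite_subset[OF _ finite_tri_le[of n]]) (auto simp: overpartition_tri_def)

text \<open>The next class is the same class of the shifted sequence, so the difference of the two
  sums is part of the total variation.\<close>

lemma class_sum_overpartition_tri_diff: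
  "\<bar>class_sum c a (overpartition_tri n) - class_sum c (a + 1) (overpartition_tri n)\<bar> \<le> 2 * overpartition n"
proof -
  define g where "g = overpartition_tri n"
  let ?A = "{- int n - 2 - 1..int n + 2}"
  have supp: "m \<in> {- int n - 1..int n + 1}" if "g m \<noteq> 0" for m
    using that tri_ge[of m] by (auto simp: g_def overpartition_tri_def split: if_splits)
  have 1: "class_sum c a g = (\<Sum>m | m \<in> ?A \<and> [m = a] (mod c). g m)"
    by (rule class_sum_eq) (use supp in fastforce)+
  have "class_sum c (a + 1) g = class_sum c a (\<lambda>m. g (m + 1))" by (rule class_sum_shift[symmetric])
  also have "\<dots> = (\<Sum>m | m \<in> ?A \<and> [m = a] (mod c). g (m + 1))"
    by (rule class_sum_eq) (use supp in fastforce)+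
  finally have "\<bar>class_sum c a g - class_sum c (a + 1) g\<bar> = \<bar>\<Sum>m | m \<in> ?A \<and> [m = a] (mod c). g m - g (m + 1)\<bar>"
    unfolding 1 by (simp add: sum_subtractf)
  also have "\<dots> \<le> (\<Sum>m | m \<in> ?A \<and> [m = a] (mod c). \<bar>g m - g (m + 1)\<bar>)" by (rule sum_abs)
  also have "\<dots> \<le> (\<Sum>m\<in>?A. \<bar>g m - g (m + 1)\<bar>)" by (rule sum_mono2) auto
  also have "\<dots> \<le> 2 * overpartition n"
    using overpartition_tri_diff_le[where M = "n + 2" and n = n] by (simp add: g_def algebra_simps)
  finally show ?thesis by (simp add: g_def)
qed

lemma sum_class_sum:
  fixes f :: "int \<Rightarrow> 'a::comm_ring_1"
  assumes "finite {m. f m \<noteq> 0}" "c > 0"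
  shows "(\<Sum>i<nat c. class_sum c (a + int i) f) = class_sum 1 0 f"
proof -
  let ?S = "{m. f m \<noteq> 0}"
  have "class_sum c b f = (\<Sum>m\<in>?S. if [m = b] (mod c) then f m else 0)" for b
    unfolding class_sum_def using assms(1) by (simp add: sum.If_cases Int_def conj_commute)
  then have "(\<Sum>i<nat c. class_sum c (a + int i) f) = (\<Sum>m\<in>?S. \<Sum>i<nat c. if [m = a + int i] (mod c) then f m else 0)"
    by (simp add: sum.swap[of _ "{..<nat c}"])
  also have "\<dots> = (\<Sum>m\<in>?S. f m)"
  proof (rule sum.cong[OF refl])
    fix m
    define i0 where "i0 = nat ((m - a) mod c)"
    have i0: "i0 < nat c" "int i0 = (m - a) mod c" using assms(2) by (auto simp: i0_def nat_less_iff)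
    have iff: "[m = a + int i] (mod c) \<longleftrightarrow> i = i0" if "i < nat c" for i
    proof -
      have "[m = a + int i] (mod c) \<longleftrightarrow> [m - a = int i] (mod c)"
        by (metis add.commute cong_add_rcancel diff_add_cancel)
      also have "\<dots> \<longleftrightarrow> (m - a) mod c = int i" using that by (simp add: cong_def)
      also have "\<dots> \<longleftrightarrow> i = i0" using i0(2) by auto
      finally show ?thesis .
    qed
    have "(\<Sum>i<nat c. if [m = a + int i] (mod c) then f m else 0) = (\<Sum>i<nat c. if i = i0 then f m else 0)"
      by (rule sum.cong) (use iff in auto)
    also have "\<dots> = f m" using i0(1) by simp
    finally show "(\<Sum>i<nat c. if [m = a + int i] (mod c) then f m else 0) = f m" .
  qed
  also have "\<dots> = class_sum 1 0 f" by (simp add: class_sum_def)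
  finally show ?thesis .
qed

text \<open>Classes i steps apart differ by at most 2 i p(n); comparing one class with the average
  over all c of them gives the bound.\<close>

lemma class_sum_overpartition_tri_close:
  assumes "c > 0"
  shows "\<bar>c * class_sum c a (overpartition_tri n) - 2 * triple_coeff n\<bar> \<le> 2 * c\<^sup>2 * overpartition n"
proof -
  define J where "J = (\<lambda>b. class_sum c b (overpartition_tri n))"
  have step: "\<bar>J a - J (a + int i)\<bar> \<le> 2 * int i * overpartition n" for i
  proof (induction i)
    case (Suc i)
    have "\<bar>J (a + int i) - J (a + int (Suc i))\<bar> \<le> 2 * overpartition n"
    proof -
      have "a + int (Suc i) = a + int i + 1" by simp
      then show ?thesis using class_sum_overpartition_tri_diff[of c "a + int i" n] by (simp only: J_def)
    qed
    with Suc show ?case by (simp add: algebra_simps)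
  qed simp
  have "2 * triple_coeff n = (\<Sum>i<nat c. J (a + int i))"
    using triple_coeff_eq(2)[of n "Suc n" 0] sum_class_sum[OF finite_overpartition_tri assms, of a n]
    by (simp add: J_def)
  moreover have "c * J a = (\<Sum>i<nat c. J a)" using assms by simp
  ultimately have "c * J a - 2 * triple_coeff n = (\<Sum>i<nat c. J a - J (a + int i))"
    by (simp add: sum_subtractf)
  also have "\<bar>\<dots>\<bar> \<le> (\<Sum>i<nat c. \<bar>J a - J (a + int i)\<bar>)" by (rule sum_abs)
  also have "\<dots> \<le> (\<Sum>i<nat c. 2 * c * overpartition n)"
  proof (rule sum_mono)
    fix i assume "i \<in> {..<nat c}"
    then have "2 * int i * overpartition n \<le> 2 * c * overpartition n"
      by (intro mult_right_mono overpartition_nonneg) auto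
    with step[of i] show "\<bar>J a - J (a + int i)\<bar> \<le> 2 * c * overpartition n" by linarith
  qed
  also have "\<dots> = 2 * c\<^sup>2 * overpartition n" using assms by (simp add: power2_eq_square)
  finally show ?thesis by (simp add: J_def)
qed

lemma class_sum_overpartition_tri_limit:
  assumes "c > 0"
  shows "(\<lambda>n. real_of_int (class_sum c a (overpartition_tri n)) / op_scale n) \<longlonglongrightarrow> 2 / real_of_int c"
proof -
  define D where "D = (\<lambda>n. real_of_int c * real_of_int (class_sum c a (overpartition_tri n)) / op_scale n - 2 * (real_of_int (triple_coeff n) / op_scale n))"
  have "D \<longlonglongrightarrow> 0"
  proof (rule Lim_null_comparison)
    show "\<forall>\<^sub>F n in sequentially. norm (D n) \<le> 2 * (real_of_int c)\<^sup>2 * (real_of_int (overpartition n) / op_scale n)"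
      using eventually_gt_at_top[of 0]
    proof eventually_elim
      case (elim n)
      have "D n = real_of_int (c * class_sum c a (overpartition_tri n) - 2 * triple_coeff n) / op_scale n"
        by (simp add: D_def diff_divide_distrib)
      then have "norm (D n) = real_of_int \<bar>c * class_sum c a (overpartition_tri n) - 2 * triple_coeff n\<bar> / op_scale n"
        using op_scale_pos[OF elim] by simp
      also have "\<dots> \<le> real_of_int (2 * c\<^sup>2 * overpartition n) / op_scale n"
        using op_scale_pos[OF elim] class_sum_overpartition_tri_close[OF assms, of a n]
        by (intro divide_right_mono) (auto simp only: of_int_le_iff less_imp_le)
      finally show ?case by simp
    qed
    have "(\<lambda>n. 2 * (real_of_int c)\<^sup>2 * (real_of_int (overpartition n) / op_scale n)) \<longlonglongrightarrow> 2 * (real_of_int c)\<^sup>2 * 0"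
      by (intro tendsto_mult tendsto_const overpartition_over_op_scale)
    then show "(\<lambda>n. 2 * (real_of_int c)\<^sup>2 * (real_of_int (overpartition n) / op_scale n)) \<longlonglongrightarrow> 0" by simp
  qed
  then have "(\<lambda>n. (D n + 2 * (real_of_int (triple_coeff n) / op_scale n)) / real_of_int c) \<longlonglongrightarrow> (0 + 2 * 1) / real_of_int c"
    by (intro tendsto_divide tendsto_add tendsto_mult tendsto_const triple_coeff_limit) (use assms in auto)
  then show ?thesis using assms by (simp add: D_def)
qed

text \<open>The signed sum telescopes to f(a) - (-1)^k f(a + kd), which is 2 f(a) by periodicity and
  oddness of k. For even k a function changing sign at every step would be in the kernel, which is
  where odd moduli enter.\<close>

lemma alternating_sum_inversion:
  fixes f g :: "int \<Rightarrow> real"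
  assumes "\<And>a. f a + f (a + d) = g a" "odd k" "f (a + int k * d) = f a"
  shows "2 * f a = (\<Sum>i<k. (-1) ^ i * g (a + int i * d))"
proof -
  have "(\<Sum>i<j. (-1) ^ i * g (a + int i * d)) = f a - (-1) ^ j * f (a + int j * d)" for j
    unfolding assms(1)[symmetric] by (induction j) (simp_all add: algebra_simps)
  from this[of k] show ?thesis using assms by simp
qed

lemma alternating_limit:
  fixes f g :: "nat \<Rightarrow> int \<Rightarrow> real"
  assumes fg: "\<And>n a. f n a + f n (a + d) = g n a" and k: "odd k"
    and per: "\<And>n a. f n (a + int k * d) = f n a"
    and lim: "\<And>a. (\<lambda>n. g n a) \<longlonglongrightarrow> 2 * L"
  shows "(\<lambda>n. f n a) \<longlonglongrightarrow> L"
proof -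
  have alt: "(\<Sum>i<k. (-1) ^ i * (2 * L)) = 2 * L"
    using alternating_sum_inversion[of "\<lambda>_. L" d "\<lambda>_. 2 * L" k a] k by simp
  have lim': "(\<lambda>n. (\<Sum>i<k. (-1) ^ i * g n (a + int i * d)) / 2) \<longlonglongrightarrow> (\<Sum>i<k. (-1) ^ i * (2 * L)) / 2"
    by (intro tendsto_divide tendsto_sum tendsto_mult tendsto_const lim) simp
  have eq: "f n a = (\<Sum>i<k. (-1) ^ i * g n (a + int i * d)) / 2" for n
    using alternating_sum_inversion[of "f n" d "g n" k a, OF fg k per] by simp
  show ?thesis unfolding eq using lim' unfolding alt by simp
qed

lemma class_coeff_limit:
  assumes "c > 0" "odd c"
  shows "(\<lambda>n. real_of_int (fps_nth (class_coeff c (Suc n) a) n) / op_scale n) \<longlonglongrightarrow> 1 / real_of_int c"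
proof (rule alternating_limit[where f = "\<lambda>n a. real_of_int (fps_nth (class_coeff c (Suc n) a) n) / op_scale n" and d = 1 and k = "nat c" and g = "\<lambda>n a. real_of_int (class_sum c a (overpartition_tri n)) / op_scale n"])
  show "real_of_int (fps_nth (class_coeff c (Suc n) a) n) / op_scale n + real_of_int (fps_nth (class_coeff c (Suc n) (a + 1)) n) / op_scale n
      = real_of_int (class_sum c a (overpartition_tri n)) / op_scale n" for n a
    using class_coeff_add_class_coeff[of n "Suc n" c a] by (simp flip: add_divide_distrib of_int_add)
  show "odd (nat c)" using assms by (simp add: even_nat_iff)
  have "class_coeff c N (a + int (nat c) * 1) = class_coeff c N a" for N a
    unfolding class_coeff_def using assms(1)
    by (subst class_sum_cong_class[of "a + int (nat c) * 1" a]) (auto simp: cong_def)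
  then show "real_of_int (fps_nth (class_coeff c (Suc n) (a + int (nat c) * 1)) n) / op_scale n
      = real_of_int (fps_nth (class_coeff c (Suc n) a) n) / op_scale n" for n a by simp
  show "(\<lambda>n. real_of_int (class_sum c a (overpartition_tri n)) / op_scale n) \<longlonglongrightarrow> 2 * (1 / real_of_int c)" for a
    using class_sum_overpartition_tri_limit[OF assms(1)] by simp
qed

text \<open>What separates the pair from the class of R_oo is the step errors plus at most 1. By
  \<open>step_error_sum_le\<close> this is at most a difference of two terms, both asymptotic to
  \<open>op_scale (Suc n)\<close>.\<close>

lemma oddbal_mod_pair_limit:
  assumes "c > 0" "odd c"
  shows "(\<lambda>n. real_of_int (oddbal_mod (a - 1) c n + oddbal_mod (a + 1) c n) / op_scale (Suc n)) \<longlonglongrightarrow> 1 / real_of_int c"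
proof -
  let ?T = "\<lambda>n. real_of_int (triple_coeff n)"
  let ?s = "\<lambda>n. op_scale (Suc n)"
  define R where "R = (\<lambda>n. fps_nth (class_coeff c (Suc n) a) n)"
  define E where "E = (\<lambda>n. R (Suc n) - (oddbal_mod (a - 1) c n + oddbal_mod (a + 1) c n))"
  have E: "0 \<le> E n" "E n \<le> triple_coeff (Suc (Suc n)) - triple_coeff (Suc n) + 1" for n
    using oddbal_mod_recurrence[of n "Suc n" c a] step_error_sum_nonneg[of c a "Suc (Suc n)" "Suc n"]
      step_error_sum_le[of n "Suc n" c a]
    unfolding E_def R_def by (simp_all split: if_splits)
  have t: "(\<lambda>n. ?T (Suc n) / ?s n) \<longlonglongrightarrow> 1"
    by (rule LIMSEQ_Suc[OF triple_coeff_limit])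
  have t2: "(\<lambda>n. ?T (Suc (Suc n)) / ?s n) \<longlonglongrightarrow> 1"
  proof -
    have lim: "(\<lambda>n. ?T (Suc (Suc n)) / ?s (Suc n) / (?s n / ?s (Suc n))) \<longlonglongrightarrow> 1 / 1"
      by (intro tendsto_divide LIMSEQ_Suc[OF LIMSEQ_Suc[OF triple_coeff_limit]] LIMSEQ_Suc[OF op_scale_shift]) simp
    have eq: "?T (Suc (Suc n)) / ?s (Suc n) / (?s n / ?s (Suc n))
        = ?T (Suc (Suc n)) / ?s n" for n
      using op_scale_pos[of "Suc n"] op_scale_pos[of "Suc (Suc n)"] by simp
    show ?thesis using lim unfolding eq by simp
  qed
  have one: "(\<lambda>n. 1 / ?s n) \<longlonglongrightarrow> 0"
  proof (rule tendsto_sandwich[OF _ _ tendsto_const LIMSEQ_Suc[OF overpartition_over_op_scale]])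
    show "\<forall>\<^sub>F n in sequentially. 0 \<le> 1 / ?s n"
      using op_scale_pos[of "Suc n" for n] by (intro always_eventually allI) (simp add: less_imp_le)
    show "\<forall>\<^sub>F n in sequentially. 1 / ?s n \<le> real_of_int (overpartition (Suc n)) / ?s n"
      using op_scale_pos[of "Suc n" for n] overpartition_ge_1
      by (intro always_eventually allI divide_right_mono) (auto simp: less_imp_le)
  qed
  have "(\<lambda>n. real_of_int (E n) / ?s n) \<longlonglongrightarrow> 0"
  proof (rule tendsto_sandwich[OF _ _ tendsto_const])
    show "\<forall>\<^sub>F n in sequentially. 0 \<le> real_of_int (E n) / ?s n"
      using E(1) op_scale_pos[of "Suc n" for n] by (intro always_eventually allI divide_nonneg_pos) auto
    show "\<forall>\<^sub>F n in sequentially. real_of_int (E n) / ?s n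
        \<le> ?T (Suc (Suc n)) / ?s n - ?T (Suc n) / ?s n + 1 / ?s n"
    proof (intro always_eventually allI)
      fix n
      have "real_of_int (E n) \<le> real_of_int (triple_coeff (Suc (Suc n)) - triple_coeff (Suc n) + 1)"
        using E(2)[of n] by (simp only: of_int_le_iff)
      then have "real_of_int (E n) / ?s n \<le> real_of_int (triple_coeff (Suc (Suc n)) - triple_coeff (Suc n) + 1) / ?s n"
        using op_scale_pos[of "Suc n"] by (intro divide_right_mono) auto
      then show "real_of_int (E n) / ?s n
        \<le> ?T (Suc (Suc n)) / ?s n - ?T (Suc n) / ?s n + 1 / ?s n"
        by (simp add: add_divide_distrib diff_divide_distrib)
    qed
    show "(\<lambda>n. ?T (Suc (Suc n)) / ?s n - ?T (Suc n) / ?s n + 1 / ?s n) \<longlonglongrightarrow> 0"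
      using tendsto_add[OF tendsto_diff[OF t2 t] one] by simp
  qed
  moreover have "(\<lambda>n. real_of_int (R (Suc n)) / ?s n) \<longlonglongrightarrow> 1 / real_of_int c"
    unfolding R_def by (rule LIMSEQ_Suc[OF class_coeff_limit[OF assms]])
  ultimately have "(\<lambda>n. real_of_int (R (Suc n)) / ?s n - real_of_int (E n) / ?s n) \<longlonglongrightarrow> 1 / real_of_int c - 0"
    by (intro tendsto_diff)
  then show ?thesis by (simp add: E_def flip: diff_divide_distrib of_int_diff)
qed

text \<open>The factor u = w + 1/w pairs the classes a and a + 2, so the inversion runs with step d
  = 2; after c steps the argument has moved by 2c and is back in its class.\<close>

lemma oddbal_mod_limit:
  assumes "c > 0" "odd c"
  shows "(\<lambda>n. real_of_int (oddbal_mod a c n) / op_scale n) \<longlonglongrightarrow> 1 / (2 * real_of_int c)"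
proof -
  have "(\<lambda>n. real_of_int (oddbal_mod a c n) / op_scale (Suc n)) \<longlonglongrightarrow> 1 / (2 * real_of_int c)"
  proof (rule alternating_limit[where f = "\<lambda>n a. real_of_int (oddbal_mod a c n) / op_scale (Suc n)" and d = 2 and k = "nat c" and g = "\<lambda>n a. real_of_int (oddbal_mod a c n + oddbal_mod (a + 2) c n) / op_scale (Suc n)"])
    show "odd (nat c)" using assms by (simp add: even_nat_iff)
    have "oddbal_mod (a + int (nat c) * 2) c n = oddbal_mod a c n" for a n
    proof -
      have "[m = a + int (nat c) * 2] (mod c) \<longleftrightarrow> [m = a] (mod c)" for m
        using assms(1) by (simp add: cong_def)
      then show ?thesis by (simp add: oddbal_mod_def)
    qed
    then show "real_of_int (oddbal_mod (a + int (nat c) * 2) c n) / op_scale (Suc n) = real_of_int (oddbal_mod a c n) / op_scale (Suc n)" for a n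
      by simp
    show "(\<lambda>n. real_of_int (oddbal_mod a c n + oddbal_mod (a + 2) c n) / op_scale (Suc n)) \<longlonglongrightarrow> 2 * (1 / (2 * real_of_int c))" for a
      using oddbal_mod_pair_limit[OF assms, of "a + 1"] by (simp add: add.commute add.left_commute)
  qed (simp add: add_divide_distrib)
  then have lim: "(\<lambda>n. real_of_int (oddbal_mod a c n) / op_scale (Suc n) / (op_scale n / op_scale (Suc n))) \<longlonglongrightarrow> 1 / (2 * real_of_int c) / 1"
    by (rule tendsto_divide[OF _ op_scale_shift]) simp
  have eq: "real_of_int (oddbal_mod a c n) / op_scale (Suc n) / (op_scale n / op_scale (Suc n)) = real_of_int (oddbal_mod a c n) / op_scale n" for n
    using op_scale_pos[of "Suc n"] by simp
  show ?thesis using lim unfolding eq by simp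
qed

theorem theorem1p1:
  fixes a c :: int
  assumes "c > 1" and "odd c"
  shows "((\<lambda>n. real_of_int (oddbal_mod a c n)) \<sim>[at_top]
           (\<lambda>n. 1 / (16 * real_of_int c * real n powr (3/4)) * exp (pi * sqrt (real n)))) \<and>
         ((\<lambda>n. 1 / (16 * real_of_int c * real n powr (3/4)) * exp (pi * sqrt (real n))) \<sim>[at_top]
           (\<lambda>n. real n powr (1/4) / (2 * real_of_int c) * real_of_int (overpartition n)))"
proof -
  let ?f = "\<lambda>n. 1 / (16 * real_of_int c * real n powr (3/4)) * exp (pi * sqrt (real n))"
  let ?g = "\<lambda>n. real n powr (1/4) / (2 * real_of_int c) * real_of_int (overpartition n)"
  have c: "real_of_int c > 0" "c > 0" using assms by simp_all
  have fg: "?f \<sim>[at_top] ?g"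
  proof (rule asymp_equiv_symI, rule asymp_equivI')
    show "(\<lambda>n. ?g n / ?f n) \<longlonglongrightarrow> 1"
    proof (rule Lim_transform_eventually[OF overpartition_limit])
      show "\<forall>\<^sub>F n in sequentially. 8 * real n * real_of_int (overpartition n) * exp (- (pi * sqrt (real n))) = ?g n / ?f n"
        using eventually_gt_at_top[of 0]
      proof eventually_elim
        case (elim n)
        have AB: "real n powr (1 / 4) * real n powr (3 / 4) = real n"
          using elim by (simp flip: powr_add)
        have "A / (2 * d) * p / (1 / (16 * d * B) * E) = 8 * (A * B) * p * inverse E"
          if "A > 0" "B > 0" "d > 0" "E > 0" for A B d E p :: real
          using that by (simp add: field_simps)
        from this[of "real n powr (1 / 4)" "real n powr (3 / 4)" "real_of_int c" "exp (pi * sqrt (real n))" "real_of_int (overpartition n)"]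
        show ?case unfolding AB exp_minus using c elim by simp
      qed
    qed
  qed
  have "(\<lambda>n. real_of_int (oddbal_mod a c n)) \<sim>[at_top] ?g"
  proof (rule asymp_equivI')
    have "(\<lambda>n. 2 * real_of_int c * (real_of_int (oddbal_mod a c n) / op_scale n)) \<longlonglongrightarrow> 2 * real_of_int c * (1 / (2 * real_of_int c))"
      by (intro tendsto_mult tendsto_const oddbal_mod_limit c assms)
    moreover have "2 * real_of_int c * (real_of_int (oddbal_mod a c n) / op_scale n) = real_of_int (oddbal_mod a c n) / ?g n" for n
      using c by (simp add: op_scale_def)
    ultimately show "(\<lambda>n. real_of_int (oddbal_mod a c n) / ?g n) \<longlonglongrightarrow> 1"
      using c by simp
  qed
  then have "(\<lambda>n. real_of_int (oddbal_mod a c n)) \<sim>[at_top] ?f"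
    using asymp_equiv_trans asymp_equiv_symI[OF fg] by blast
  with fg show ?thesis by blast
qed

end
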